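(* If $\sigma_k>\sigma_{k+1}$, then the error exponent $\bar{\mathrm E}_k(r)$ satisfies $$\bar{\mathrm E}_k(r)=-\lim_{\epsilon\to0^+}\frac1\epsilon\lim_{n\to\infty}\frac1n\log\mathbb P_{n,m}\left\{\|\tilde{\mathbf B}\mathbf\Phi_k\|_{\mathrm F}^2-\|\tilde{\mathbf B}\bar{\mathbf\Phi}_k\|_{\mathrm F}^2>\epsilon\right\}=\frac1{2\bar\alpha_k(r)}.$$
   Context: Setting. Let $\mathcal X=\{1,\dots,|\mathcal X|\}$ and $\mathcal Y=\{1,\dots,|\mathcal Y|\}$ be finite alphabets and $P_{XY}$ a joint probability distribution on $\mathcal X\times\mathcal Y$ whose marginals satisfy $P_X(x)>0$, $P_Y(y)>0$ for all $x,y$. Let $d=|\mathcal X|$. The matrix $\tilde{\mathbf B}\in\mathbb R^{|\mathcal Y|\times|\mathcal X|}$ has entries $\tilde B(y,x)=\frac{P_{XY}(x,y)-P_X(x)P_Y(y)}{\sqrt{P_X(x)P_Y(y)}}$. Let $\sigma_1\ge\dots\ge\sigma_d\ge0$ be its singular values ($\sigma_i=0$ for $i>|\mathcal Y|$) and $\boldsymbol\phi_1,\dots,\boldsymbol\phi_d\in\mathbb R^d$ corresponding orthonormal right singular vectors (so $\tilde{\mathbf B}^{\mathrm T}\tilde{\mathbf B}\boldsymbol\phi_i=\sigma_i^2\boldsymbol\phi_i$). Let $k\in\{1,\dots,d-1\}$ and $\mathbf\Phi_k=[\boldsymbol\phi_1,\dots,\boldsymbol\phi_k]$. $\|\cdot\|_{\mathrm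 F}$ is the Frobenius norm; logarithms are natural. Semi-supervised estimation. Fix $r\ge0$. One observes $n$ i.i.d. samples $(x_i,y_i)$ from $P_{XY}$ and, independently, $m=nr$ (an integer) i.i.d. samples from $P_X$; $\mathbb P_{n,m}$ denotes the resulting probability. Let $\hat P_{XY}$ be the empirical joint distribution of the labeled samples (with marginal $\hat P_X$ and conditional $\hat P_{Y|X}$), $Q_X$ the empirical distribution of the unlabeled samples, $\bar P_X=\frac1{1+r}\hat P_X+\frac r{1+r}Q_X$, $\bar P_{XY}(x,y)=\hat P_{Y|X}(y|x)\bar P_X(x)$, and $\bar P_Y$ the $\mathcal Y$-marginal of $\bar P_{XY}$. Let $\bar{\mathbf B}\in\mathbb R^{|\mathcal Y|\times|\mathcal X|}$ have entries $\bar B(y,x)=\frac{\bar P_{XY}(x,y)}{\sqrt{\bar P_X(x)\bar P_Y(y)}}-\sqrt{\bar P_X(x)\bar P_Y(y)}$, and let $\bar{\mathbf\Phi}_k\in\mathbb R^{d\times k}$ have as orthonormal columns right singular vectors of $\bar{\mathbf B}$ for its $k$ largest singular values. (An arbitrary fixed convention is used when a denominator vanishes or singular values tie.) Definition of $\bar\alpha_k(r)$. Let $\mathbf L$ be the $(|\mathcal X||\mathcal Y|)\times(|\mathcal X||\mathcal Y|)$ matrix whose entry in row $(x-1)|\mathcal Y|+y$ and column $(x'-1)|\mathcal Y|+y'$ is $$\sqrt{\frac{P_{XY}(x',y')}{P_X(x)P_Y(y)}}\left[\delta_{xx'}\delta_{yy'}-\frac12\left(\frac{\delta_{xx'}}{P_X(x)}+\frac{\delta_{yy'}}{P_Y(y)}\right)\left(P_{XY}(x,y)+P_X(x)P_Y(y)\right)\right].$$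 Let $\boldsymbol\theta_{ij}=\boldsymbol\phi_j\otimes(\tilde{\mathbf B}\boldsymbol\phi_i)+\boldsymbol\phi_i\otimes(\tilde{\mathbf B}\boldsymbol\phi_j)$ and $\mathbf G_k=\mathbf L^{\mathrm T}\left(\sum_{i=1}^k\sum_{j=k+1}^d\frac{\boldsymbol\theta_{ij}\boldsymbol\theta_{ij}^{\mathrm T}}{\sigma_i^2-\sigma_j^2}\right)\mathbf L$. Let $\bar{\mathbf L}(r)$ be the $(|\mathcal X||\mathcal Y|)\times[|\mathcal X|(|\mathcal Y|+1)]$ matrix whose entry in row $(x-1)|\mathcal Y|+y$ and column $(x'-1)|\mathcal Y|+y'$ is $\delta_{xx'}\delta_{yy'}-\frac r{1+r}\sqrt{P_{Y|X}(y|x)P_{Y|X}(y'|x')}\,\delta_{xx'}$, and whose entry in row $(x-1)|\mathcal Y|+y$ and column $|\mathcal X||\mathcal Y|+x'$ is $\frac{\sqrt r}{1+r}\sqrt{P_{Y|X}(y|x)}\,\delta_{xx'}$. Then $\bar\alpha_k(r)$ is the spectral norm of $\bar{\mathbf G}_k(r)=\bar{\mathbf L}(r)^{\mathrm T}\mathbf G_k\bar{\mathbf L}(r)$. *)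

theory Defs
  imports "HOL-Probability.Probability"
begin

text \<open>
  The alphabets are finite types \<open>'x\<close>, \<open>'y\<close>, and coordinates of vectors over
  \<open>'x \<times> 'y\<close> are indexed by pairs: \<open>(x, y)\<close> stands for position \<open>(x - 1) |Y| + y\<close>. In the
  same way the index type \<open>('x \<times> 'y) + 'x\<close> has \<open>Inl (x, y)\<close> for position \<open>(x - 1) |Y| + y\<close>
  and \<open>Inr x\<close> for position \<open>|X| |Y| + x\<close>. Singular values and vectors are numbered by
  natural numbers from 1 to \<open>CARD('x)\<close>.
\<close>

definition PX :: "('x \<times> 'y) pmf \<Rightarrow> 'x \<Rightarrow> real" where
  "PX P x = pmf (map_pmf fst P) x"

definition PY :: "('x \<times> 'y) pmf \<Rightarrow> 'y \<Rightarrow> real" where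
  "PY P y = pmf (map_pmf snd P) y"

definition Bt :: "('x::finite \<times> 'y::finite) pmf \<Rightarrow> real^'x^'y" where
  "Bt P = (\<chi> y x. (pmf P (x, y) - PX P x * PY P y) / sqrt (PX P x * PY P y))"

text \<open>
  All \<open>CARD('x)\<close> singular values are listed, in descending order, so those with index beyond
  the number of rows are 0.
\<close>

definition right_singular_system ::
    "real^'x^'y \<Rightarrow> (nat \<Rightarrow> real) \<Rightarrow> (nat \<Rightarrow> real^'x) \<Rightarrow> bool" where
  "right_singular_system M \<sigma> \<phi> \<longleftrightarrow>
     (\<forall>i\<in>{1..CARD('x)}. 0 \<le> \<sigma> i) \<and>
     (\<forall>i\<in>{1..CARD('x)}. \<forall>j\<in>{1..CARD('x)}. i \<le> j \<longrightarrow> \<sigma> j \<le> \<sigma> i) \<and>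
     (\<forall>i\<in>{1..CARD('x)}. \<forall>j\<in>{1..CARD('x)}. \<phi> i \<bullet> \<phi> j = of_bool (i = j)) \<and>
     (\<forall>i\<in>{1..CARD('x)}. (transpose M ** M) *v \<phi> i = (\<sigma> i)\<^sup>2 *\<^sub>R \<phi> i)"

definition top_right_singular_vectors ::
    "nat \<Rightarrow> real^'x^'y \<Rightarrow> (nat \<Rightarrow> real^'x) \<Rightarrow> bool" where
  "top_right_singular_vectors k M \<Psi> \<longleftrightarrow>
     (\<exists>\<sigma> \<phi>. right_singular_system M \<sigma> \<phi> \<and> (\<forall>i\<in>{1..k}. \<Psi> i = \<phi> i))"

text \<open>A matrix with \<open>k\<close> columns is represented by the family of its columns \<open>1, \<dots>, k\<close>.\<close>

definition frob_norm :: "nat \<Rightarrow> (nat \<Rightarrow> real^'n) \<Rightarrow> real" where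
  "frob_norm k A = sqrt (\<Sum>j=1..k. \<Sum>i\<in>UNIV. (A j $ i)\<^sup>2)"

definition mat_cols :: "real^'n^'m \<Rightarrow> (nat \<Rightarrow> real^'n) \<Rightarrow> nat \<Rightarrow> real^'m" where
  "mat_cols M A j = M *v A j"

definition spectral_norm :: "real^'n^'m \<Rightarrow> real" where
  "spectral_norm M = onorm ((*v) M)"

definition emp :: "'a list \<Rightarrow> 'a \<Rightarrow> real" where
  "emp zs z = real (count_list zs z) / real (length zs)"

definition emp_X :: "('x \<times> 'y) list \<Rightarrow> 'x \<Rightarrow> real" where
  "emp_X zs x = emp (map fst zs) x"

text \<open>The parameter \<open>c\<close> supplies the values used when the denominator vanishes.\<close>

definition emp_cond ::
    "('x \<Rightarrow> 'y \<Rightarrow> real) \<Rightarrow> ('x \<times> 'y) list \<Rightarrow> 'x \<Rightarrow> 'y \<Rightarrow> real" where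
  "emp_cond c zs x y = (if emp_X zs x = 0 then c x y else emp zs (x, y) / emp_X zs x)"

definition bar_PX :: "real \<Rightarrow> ('x \<times> 'y) list \<Rightarrow> 'x list \<Rightarrow> 'x \<Rightarrow> real" where
  "bar_PX r zs us x = 1 / (1 + r) * emp_X zs x + r / (1 + r) * emp us x"

definition bar_PXY ::
    "real \<Rightarrow> ('x \<Rightarrow> 'y \<Rightarrow> real) \<Rightarrow> ('x \<times> 'y) list \<Rightarrow> 'x list \<Rightarrow> 'x \<Rightarrow> 'y \<Rightarrow> real" where
  "bar_PXY r c zs us x y = emp_cond c zs x y * bar_PX r zs us x"

definition bar_PY ::
    "real \<Rightarrow> ('x::finite \<Rightarrow> 'y \<Rightarrow> real) \<Rightarrow> ('x \<times> 'y) list \<Rightarrow> 'x list \<Rightarrow> 'y \<Rightarrow> real" where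
  "bar_PY r c zs us y = (\<Sum>x\<in>UNIV. bar_PXY r c zs us x y)"

text \<open>Similarly, \<open>b\<close> supplies the entries whose denominator vanishes.\<close>

definition bar_B ::
    "real \<Rightarrow> ('x::finite \<Rightarrow> 'y::finite \<Rightarrow> real) \<Rightarrow> ('y \<Rightarrow> 'x \<Rightarrow> real) \<Rightarrow>
     ('x \<times> 'y) list \<Rightarrow> 'x list \<Rightarrow> real^'x^'y" where
  "bar_B r c b zs us = (\<chi> y x.
     if bar_PX r zs us x * bar_PY r c zs us y = 0 then b y x
     else bar_PXY r c zs us x y / sqrt (bar_PX r zs us x * bar_PY r c zs us y)
          - sqrt (bar_PX r zs us x * bar_PY r c zs us y))"

definition samples :: "('x \<times> 'y) pmf \<Rightarrow> nat \<Rightarrow> nat \<Rightarrow> (('x \<times> 'y) list \<times> 'x list) pmf" where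
  "samples P n m = pair_pmf (replicate_pmf n P) (replicate_pmf m (map_pmf fst P))"

text \<open>\<open>n \<rightarrow> \<infinity>\<close> through those \<open>n\<close> for which \<open>n r\<close> is an integer (a proper
  filter exactly for rational \<open>r\<close>).\<close>

definition admissible_at_top :: "real \<Rightarrow> nat filter" where
  "admissible_at_top r = inf at_top (principal {n. real n * r \<in> \<nat>})"

text \<open>Natural logarithm with value \<open>-\<infinity>\<close> at 0; the real-valued \<^const>\<open>ln\<close> has \<open>ln 0 = 0\<close>.\<close>

definition log_prob :: "real \<Rightarrow> ereal" where
  "log_prob p = (if p = 0 then -\<infinity> else ereal (ln p))"

definition L_mat :: "('x::finite \<times> 'y::finite) pmf \<Rightarrow> real^('x \<times> 'y)^('x \<times> 'y)" where
  "L_mat P = (\<chi> z z'. let x = fst z; y = snd z; x' = fst z'; y' = snd z' in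
     sqrt (pmf P (x', y') / (PX P x * PY P y)) *
     (of_bool (x = x') * of_bool (y = y')
      - 1/2 * (of_bool (x = x') / PX P x + of_bool (y = y') / PY P y)
            * (pmf P (x, y) + PX P x * PY P y)))"

definition kron :: "real^'a \<Rightarrow> real^'b \<Rightarrow> real^('a \<times> 'b)" where
  "kron u v = (\<chi> z. u $ fst z * v $ snd z)"

definition outer :: "real^'a \<Rightarrow> real^'b \<Rightarrow> real^'b^'a" where
  "outer u v = (\<chi> i j. u $ i * v $ j)"

definition theta ::
    "('x::finite \<times> 'y::finite) pmf \<Rightarrow> (nat \<Rightarrow> real^'x) \<Rightarrow> nat \<Rightarrow> nat \<Rightarrow> real^('x \<times> 'y)" where
  "theta P \<phi> i j = kron (\<phi> j) (Bt P *v \<phi> i) + kron (\<phi> i) (Bt P *v \<phi> j)"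

definition G_mat ::
    "('x::finite \<times> 'y::finite) pmf \<Rightarrow> (nat \<Rightarrow> real) \<Rightarrow> (nat \<Rightarrow> real^'x) \<Rightarrow> nat \<Rightarrow>
     real^('x \<times> 'y)^('x \<times> 'y)" where
  "G_mat P \<sigma> \<phi> k =
     transpose (L_mat P) **
     (\<Sum>i=1..k. \<Sum>j=k+1..CARD('x).
        (1 / ((\<sigma> i)\<^sup>2 - (\<sigma> j)\<^sup>2)) *\<^sub>R outer (theta P \<phi> i j) (theta P \<phi> i j)) **
     L_mat P"

definition PYX :: "('x \<times> 'y) pmf \<Rightarrow> 'y \<Rightarrow> 'x \<Rightarrow> real" where
  "PYX P y x = pmf P (x, y) / PX P x"

definition bar_L ::
    "('x::finite \<times> 'y::finite) pmf \<Rightarrow> real \<Rightarrow> real^(('x \<times> 'y) + 'x)^('x \<times> 'y)" where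
  "bar_L P r = (\<chi> z w. let x = fst z; y = snd z in
     case w of
       Inl (x', y') \<Rightarrow> of_bool (x = x') * of_bool (y = y')
                       - r / (1 + r) * sqrt (PYX P y x * PYX P y' x') * of_bool (x = x')
     | Inr x' \<Rightarrow> sqrt r / (1 + r) * sqrt (PYX P y x) * of_bool (x = x'))"

definition bar_G ::
    "('x::finite \<times> 'y::finite) pmf \<Rightarrow> (nat \<Rightarrow> real) \<Rightarrow> (nat \<Rightarrow> real^'x) \<Rightarrow> nat \<Rightarrow> real \<Rightarrow>
     real^(('x \<times> 'y) + 'x)^(('x \<times> 'y) + 'x)" where
  "bar_G P \<sigma> \<phi> k r = transpose (bar_L P r) ** G_mat P \<sigma> \<phi> k ** bar_L P r"

definition bar_alpha ::
    "('x::finite \<times> 'y::finite) pmf \<Rightarrow> (nat \<Rightarrow> real) \<Rightarrow> (nat \<Rightarrow> real^'x) \<Rightarrow> nat \<Rightarrow> real \<Rightarrow> real" where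
  "bar_alpha P \<sigma> \<phi> k r = spectral_norm (bar_G P \<sigma> \<phi> k r)"

end

theory Submission
  imports Defs "HOL-Real_Asymp.Real_Asymp"
begin

text \<open>
  Near the true distribution the event depends on the samples only through their pair of types.
  By the method of types its probability decays exactly at the rate given by the infimum of the
  divergence over the event; since the upper bound only looks at types inside the event and the
  lower bound only needs the loss to be continuous at types, the limit in \<open>n\<close> exists for every
  small \<open>\<epsilon>\<close> without comparing open and closed events.

  For a matrix with a gap after its \<open>k\<close>-th eigenvalue, Ky Fan's maximum principle bounds the
  rotation of the top eigenspace linearly in the perturbation, and the commutation of the spectral
  projection with the perturbed matrix identifies the rotation to first order. The loss is therefore a
  quadratic form in the perturbation of the types up to a cubic error, while the divergence is half a
  weighted squared norm up to a negligible error. In normalised coordinates the quadratic form is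
  the one of \<^const>\<open>bar_G\<close>, so the smallest divergence at loss \<open>\<epsilon>\<close> is asymptotically
  \<open>\<epsilon>\<close> divided by twice its largest eigenvalue; the linear constraints (total mass, support) cost
  nothing because the form is invariant along the directions they remove.
\<close>

text \<open>The obstacle is the estimator: its singular vectors are chosen sample by sample, so
  globally the loss is neither a function of the types nor continuous in them. Two facts make this
  harmless. The loss sees the chosen vectors only through the projection on their span, and the gap
  persists on a ball around the truth; there the projection is determined by the types and
  continuous in them, and the loss lies between two envelopes that are plain functions of the types.
  Outside the ball the rate is bounded below by a positive constant, while reaching loss
  \<open>\<epsilon>\<close> costs only a multiple of \<open>\<epsilon>\<close>, so for small
  \<open>\<epsilon>\<close> the behaviour of the estimator there is irrelevant. Both estimates in
  \<open>\<epsilon>\<close> rest on the rate dominating the squared distance to the truth: an error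
  of smaller order than that distance squared can be charged to the rate itself, which takes the
  place of a compactness argument. The quotient by \<open>bar_alpha\<close> needs its positivity,
  which has an argument of its own: the top singular vectors cannot stay fixed when the
  \<open>X\<close>-marginal moves.\<close>

declare One_nat_def [simp del]

subsection \<open>Perturbation of the top eigenspace\<close>

lemma sum_split_at:
  fixes f :: "nat \<Rightarrow> real"
  assumes "k \<le> d"
  shows "(\<Sum>i=1..d. f i) = (\<Sum>i=1..k. f i) + (\<Sum>i=k+1..d. f i)"
proof -
  have "{1..d} = {1..k} \<union> {k+1..d}" "{1..k} \<inter> {k+1..d} = {}" using assms by auto
  then show ?thesis by (simp add: sum.union_disjoint)
qed

lemma sum_mult_le_L2:
  fixes f g :: "'a \<Rightarrow> real"
  shows "\<bar>\<Sum>i\<in>I. f i * g i\<bar> \<le> sqrt (\<Sum>i\<in>I. (f i)\<^sup>2) * sqrt (\<Sum>i\<in>I. (g i)\<^sup>2)"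
proof -
  have "(\<Sum>i\<in>I. f i * g i)\<^sup>2 \<le> (\<Sum>i\<in>I. (f i)\<^sup>2) * (\<Sum>i\<in>I. (g i)\<^sup>2)"
    by (rule Cauchy_Schwarz_ineq_sum)
  then show ?thesis
    by (metis real_sqrt_abs real_sqrt_le_iff real_sqrt_mult)
qed

lemma sum2_mult_le_L2:
  fixes f g :: "'a \<Rightarrow> 'b \<Rightarrow> real"
  shows "\<bar>\<Sum>i\<in>I. \<Sum>j\<in>J. f i j * g i j\<bar>
    \<le> sqrt (\<Sum>i\<in>I. \<Sum>j\<in>J. (f i j)\<^sup>2) * sqrt (\<Sum>i\<in>I. \<Sum>j\<in>J. (g i j)\<^sup>2)"
  using sum_mult_le_L2[of "\<lambda>(i, j). f i j" "\<lambda>(i, j). g i j" "I \<times> J"]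
  by (simp add: sum.cartesian_product case_prod_beta)

text \<open>
  Everything is expressed in an eigenbasis of the unperturbed matrix: it is
  \<open>diag lam\<close>, the perturbed matrix is \<open>a\<close>, and the columns of the orthogonal matrix \<open>c\<close> are
  eigenvectors of \<open>a\<close>, with eigenvalues \<open>mu\<close>. Below, \<open>X\<close> and \<open>Xc\<close> are the projection on the
  top \<open>k\<close> eigenvectors of \<open>a\<close> and its complement, and \<open>Y\<close> is the change of the projection.
\<close>

locale spectral_perturbation =
  fixes d k :: nat and lam mu :: "nat \<Rightarrow> real" and a c :: "nat \<Rightarrow> nat \<Rightarrow> real"
  assumes k: "1 \<le> k" "k < d"
    and lam_antimono: "\<And>i j. 1 \<le> i \<Longrightarrow> i \<le> j \<Longrightarrow> j \<le> d \<Longrightarrow> lam j \<le> lam i"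
    and lam_nonneg: "\<And>i. 1 \<le> i \<Longrightarrow> i \<le> d \<Longrightarrow> 0 \<le> lam i"
    and mu_antimono: "\<And>i j. 1 \<le> i \<Longrightarrow> i \<le> j \<Longrightarrow> j \<le> d \<Longrightarrow> mu j \<le> mu i"
    and c_cols: "\<And>l m. l \<in> {1..d} \<Longrightarrow> m \<in> {1..d} \<Longrightarrow> (\<Sum>i=1..d. c i l * c i m) = of_bool (l = m)"
    and c_rows: "\<And>i j. i \<in> {1..d} \<Longrightarrow> j \<in> {1..d} \<Longrightarrow> (\<Sum>l=1..d. c i l * c j l) = of_bool (i = j)"
    and a_eq: "\<And>i j. i \<in> {1..d} \<Longrightarrow> j \<in> {1..d} \<Longrightarrow> a i j = (\<Sum>l=1..d. mu l * (c i l * c j l))"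
    and gap_pos: "lam (k + 1) < lam k"
begin

text \<open>Functional calculus: \<open>T f\<close> is the matrix with eigenvalue \<open>f l\<close>
  on column \<open>l\<close> of \<open>c\<close>. The perturbed matrix and its spectral projections
  all have this form, so products and traces are computed on the functions \<open>f\<close>, and
  these matrices commute.\<close>

definition T :: "(nat \<Rightarrow> real) \<Rightarrow> nat \<Rightarrow> nat \<Rightarrow> real" where
  "T f i j = (\<Sum>l=1..d. f l * (c i l * c j l))"

definition X :: "nat \<Rightarrow> nat \<Rightarrow> real" where
  "X = T (\<lambda>l. of_bool (l \<le> k))"

definition Y :: "nat \<Rightarrow> nat \<Rightarrow> real" where
  "Y i j = X i j - of_bool (i = j \<and> i \<le> k)"

definition err :: "nat \<Rightarrow> nat \<Rightarrow> real" where
  "err i j = a i j - of_bool (i = j) * lam i"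

definition err_norm :: real where
  "err_norm = sqrt (\<Sum>i=1..d. \<Sum>j=1..d. (err i j)\<^sup>2)"

definition gap :: real where
  "gap = lam k - lam (k + 1)"

definition loss :: real where
  "loss = (\<Sum>i=1..k. lam i) - (\<Sum>i=1..d. lam i * X i i)"

text \<open>The sum of the squared sines of the principal angles between the old and the new top
  eigenspace; this is the measure of rotation in all bounds below.\<close>

definition leak :: real where
  "leak = (\<Sum>j=k+1..d. X j j)"

lemma T_sym: "T f i j = T f j i"
  by (simp add: T_def mult.commute)

lemma T_mult:
  "(\<Sum>m=1..d. T f i m * T h m j) = T (\<lambda>l. f l * h l) i j"
proof -
  have "(\<Sum>m=1..d. T f i m * T h m j) =
    (\<Sum>m=1..d. \<Sum>l=1..d. \<Sum>n=1..d. (f l * h n * c i l * c j n) * (c m l * c m n))"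
    unfolding T_def sum_product by (intro sum.cong refl) (simp add: algebra_simps)
  also have "\<dots> = (\<Sum>l=1..d. \<Sum>m=1..d. \<Sum>n=1..d. (f l * h n * c i l * c j n) * (c m l * c m n))"
    by (rule sum.swap)
  also have "\<dots> = (\<Sum>l=1..d. \<Sum>n=1..d. \<Sum>m=1..d. (f l * h n * c i l * c j n) * (c m l * c m n))"
    by (intro sum.cong refl sum.swap)
  also have "\<dots> = (\<Sum>l=1..d. \<Sum>n=1..d. (f l * h n * c i l * c j n) * of_bool (l = n))"
    by (intro sum.cong refl) (simp add: sum_distrib_left[symmetric] c_cols)
  also have "\<dots> = (\<Sum>l=1..d. f l * h l * c i l * c j l)"
    by (intro sum.cong refl) (simp add: of_bool_def if_distrib cong: if_cong)
  finally show ?thesis by (simp add: T_def mult.assoc)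
qed

lemma T_trace: "(\<Sum>i=1..d. T f i i) = (\<Sum>l=1..d. f l)"
proof -
  have "(\<Sum>i=1..d. T f i i) = (\<Sum>l=1..d. \<Sum>i=1..d. f l * (c i l * c i l))"
    unfolding T_def by (rule sum.swap)
  also have "\<dots> = (\<Sum>l=1..d. f l * (\<Sum>i=1..d. c i l * c i l))"
    by (simp add: sum_distrib_left)
  also have "\<dots> = (\<Sum>l=1..d. f l)"
    by (intro sum.cong refl) (simp add: c_cols)
  finally show ?thesis .
qed

text \<open>\<open>T f\<close> is positive semidefinite for nonnegative \<open>f\<close>. Applied to
  projections, this makes the squared entries of a diagonal block quadratic in its trace.\<close>

lemma T_Cauchy_Schwarz:
  assumes "\<And>l. 0 \<le> f l"
  shows "(T f i j)\<^sup>2 \<le> T f i i * T f j j"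
proof -
  have "(\<Sum>l=1..d. (sqrt (f l) * c i l) * (sqrt (f l) * c j l))\<^sup>2
      \<le> (\<Sum>l=1..d. (sqrt (f l) * c i l)\<^sup>2) * (\<Sum>l=1..d. (sqrt (f l) * c j l)\<^sup>2)"
    by (rule Cauchy_Schwarz_ineq_sum)
  moreover have "(sqrt (f l) * c i l) * (sqrt (f l) * c j l) = f l * (c i l * c j l)" for i j l
    using assms[of l] by (simp add: algebra_simps)
  ultimately show ?thesis
    unfolding T_def power2_eq_square by simp
qed

lemma T_diag_nonneg:
  assumes "\<And>l. 0 \<le> f l"
  shows "0 \<le> T f i i"
  unfolding T_def by (intro sum_nonneg mult_nonneg_nonneg[OF assms] zero_le_square)

definition Xc :: "nat \<Rightarrow> nat \<Rightarrow> real" where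
  "Xc = T (\<lambda>l. of_bool (\<not> l \<le> k))"

lemma X_plus_Xc:
  assumes "i \<in> {1..d}" "j \<in> {1..d}"
  shows "X i j + Xc i j = of_bool (i = j)"
proof -
  have "X i j + Xc i j = (\<Sum>l=1..d. c i l * c j l)"
    unfolding X_def Xc_def T_def sum.distrib[symmetric] by (intro sum.cong refl) auto
  with c_rows[OF assms] show ?thesis by simp
qed

lemma X_idem: "(\<Sum>m=1..d. X i m * X m j) = X i j"
  unfolding X_def T_mult by (simp add: of_bool_def if_distrib cong: if_cong)

lemma X_sym: "X i j = X j i" and Xc_sym: "Xc i j = Xc j i"
  unfolding X_def Xc_def by (rule T_sym)+

lemma X_diag_sq: "X i i = (\<Sum>m=1..d. (X i m)\<^sup>2)"
  using X_idem[of i i] X_sym by (simp add: power2_eq_square)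

lemma Xc_idem: "(\<Sum>m=1..d. Xc i m * Xc m j) = Xc i j"
  unfolding Xc_def T_mult by (simp add: of_bool_def if_distrib cong: if_cong)

lemma Xc_diag_sq: "Xc i i = (\<Sum>m=1..d. (Xc i m)\<^sup>2)"
  using Xc_idem[of i i] Xc_sym by (simp add: power2_eq_square)

lemma X_diag_nonneg: "0 \<le> X i i" and Xc_diag_nonneg: "0 \<le> Xc i i"
  unfolding X_def Xc_def by (rule T_diag_nonneg; simp)+

lemma sum_indicator_k: "(\<Sum>l=1..d. of_bool (l \<le> k) :: real) = real k"
proof -
  have "{1..d} \<inter> {l. l \<le> k} = {1..k}" using k by auto
  then show ?thesis by (simp add: of_bool_def sum.If_cases)
qed

lemma X_trace: "(\<Sum>i=1..d. X i i) = real k"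
  unfolding X_def T_trace by (rule sum_indicator_k)

text \<open>The old and the new projection both have trace \<open>k\<close>, so what the top block
  loses is what the rest gains.\<close>

lemma leak_eq: "leak = (\<Sum>i=1..k. Xc i i)"
proof -
  have "(\<Sum>i=1..k. Xc i i) = (\<Sum>i=1..k. 1 - X i i)"
    using X_plus_Xc k by (intro sum.cong refl) (force simp: algebra_simps)
  also have "\<dots> = real k - (\<Sum>i=1..k. X i i)" by (simp add: sum_subtractf)
  also have "\<dots> = leak"
    using X_trace sum_split_at[of k d "\<lambda>i. X i i"] k by (simp add: leak_def)
  finally show ?thesis by simp
qed

lemma leak_nonneg: "0 \<le> leak"
  unfolding leak_def by (intro sum_nonneg X_diag_nonneg)

lemma loss_eq: "loss = (\<Sum>i=1..k. lam i * Xc i i) - (\<Sum>j=k+1..d. lam j * X j j)"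
proof -
  have "(\<Sum>i=1..k. lam i * Xc i i) = (\<Sum>i=1..k. lam i - lam i * X i i)"
  proof (intro sum.cong refl)
    fix i assume "i \<in> {1..k}"
    then have "Xc i i = 1 - X i i" using X_plus_Xc[of i i] k by simp
    then show "lam i * Xc i i = lam i - lam i * X i i" by (simp add: right_diff_distrib)
  qed
  then show ?thesis
    using sum_split_at[of k d "\<lambda>i. lam i * X i i"] k by (simp add: loss_def sum_subtractf)
qed

text \<open>Both sums in \<open>loss_eq\<close> carry total mass \<open>leak\<close>; it is priced
  at \<open>lam k\<close> or more where it leaves and at \<open>lam (k + 1)\<close> or less where it
  arrives.\<close>

lemma gap_leak_le_loss: "gap * leak \<le> loss"
proof -
  have "(\<Sum>i=1..k. lam i * Xc i i) \<ge> (\<Sum>i=1..k. lam k * Xc i i)"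
    using k by (intro sum_mono mult_right_mono lam_antimono Xc_diag_nonneg) auto
  moreover have "(\<Sum>j=k+1..d. lam j * X j j) \<le> (\<Sum>j=k+1..d. lam (k+1) * X j j)"
    using k by (intro sum_mono mult_right_mono lam_antimono X_diag_nonneg) auto
  ultimately show ?thesis
    unfolding loss_eq gap_def sum_distrib_left[symmetric] leak_def[symmetric] leak_eq[symmetric]
    by (simp add: algebra_simps)
qed

lemma of_bool_conj_sum:
  "(\<Sum>i=1..d. \<Sum>j=1..d. of_bool (i = j \<and> i \<le> k) * f i j) = (\<Sum>i=1..k. f i i)" for f :: "nat \<Rightarrow> nat \<Rightarrow> real"
proof -
  have "(\<Sum>i=1..d. \<Sum>j=1..d. of_bool (i = j \<and> i \<le> k) * f i j) = (\<Sum>i=1..d. of_bool (i \<le> k) * f i i)"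
    by (intro sum.cong refl) (auto simp: of_bool_def if_distrib if_distribR cong: if_cong)
  also have "\<dots> = (\<Sum>i=1..k. f i i)"
    using k by (subst sum_split_at[of k d]) auto
  finally show ?thesis .
qed

text \<open>For two projections of rank \<open>k\<close> only the cross term of the squared distance
  is unknown, and it equals \<open>k - leak\<close>.\<close>

lemma Y_norm: "(\<Sum>i=1..d. \<Sum>j=1..d. (Y i j)\<^sup>2) = 2 * leak"
proof -
  have "(\<Sum>i=1..d. \<Sum>j=1..d. (Y i j)\<^sup>2) =
     (\<Sum>i=1..d. \<Sum>j=1..d. (X i j)\<^sup>2 - of_bool (i = j \<and> i \<le> k) * (2 * X i j - 1))"
    by (intro sum.cong refl) (auto simp: Y_def power2_eq_square algebra_simps)
  also have "\<dots> = (\<Sum>i=1..d. X i i) - (\<Sum>i=1..k. 2 * X i i - 1)"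
    unfolding sum_subtractf of_bool_conj_sum using X_diag_sq by simp
  also have "\<dots> = 2 * (real k - (\<Sum>i=1..k. X i i))"
    by (simp add: X_trace sum_subtractf sum_distrib_left[symmetric])
  also have "real k - (\<Sum>i=1..k. X i i) = leak"
    using X_trace sum_split_at[of k d "\<lambda>i. X i i"] k by (simp add: leak_def)
  finally show ?thesis .
qed

lemma a_T: "i \<in> {1..d} \<Longrightarrow> j \<in> {1..d} \<Longrightarrow> a i j = T mu i j"
  by (simp add: a_eq T_def)

lemma a_trace_X: "(\<Sum>i=1..d. \<Sum>j=1..d. a i j * X i j) = (\<Sum>l=1..k. mu l)"
proof -
  have "(\<Sum>i=1..d. \<Sum>j=1..d. a i j * X i j) = (\<Sum>i=1..d. \<Sum>j=1..d. T mu i j * X j i)"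
    using X_sym by (intro sum.cong refl) (simp add: a_T)
  also have "\<dots> = (\<Sum>l=1..d. mu l * of_bool (l \<le> k))"
    unfolding X_def T_mult T_trace by simp
  also have "\<dots> = (\<Sum>l=1..k. mu l)"
    using k by (subst sum_split_at[of k d]) auto
  finally show ?thesis .
qed

text \<open>The trace of the top block is a combination of the \<open>mu l\<close> with weights
  \<open>w l\<close> between 0 and 1 of total mass \<open>k\<close>; such a combination is largest
  when the whole mass sits on the first \<open>k\<close> values.\<close>

lemma Ky_Fan: "(\<Sum>i=1..k. a i i) \<le> (\<Sum>l=1..k. mu l)"
proof -
  define w where "w l = (\<Sum>i=1..k. c i l * c i l)" for l
  have w0: "0 \<le> w l" for l unfolding w_def by (intro sum_nonneg) simp
  have w1: "w l \<le> 1" if "l \<in> {1..d}" for l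
  proof -
    have "w l \<le> (\<Sum>i=1..d. c i l * c i l)"
      unfolding w_def using k by (intro sum_mono2) auto
    then show ?thesis using c_cols[OF that that] by simp
  qed
  have "(\<Sum>l=1..d. w l) = (\<Sum>i=1..k. \<Sum>l=1..d. c i l * c i l)"
    unfolding w_def by (rule sum.swap)
  also have "\<dots> = (\<Sum>i=1..k. 1)"
    using k by (intro sum.cong refl) (simp add: c_rows)
  finally have wk: "(\<Sum>l=1..k. w l) + (\<Sum>l=k+1..d. w l) = real k"
    using sum_split_at[of k d w] k by simp
  have "(\<Sum>i=1..k. a i i) = (\<Sum>i=1..k. \<Sum>l=1..d. mu l * (c i l * c i l))"
    using k by (intro sum.cong refl) (simp add: a_eq)
  also have "\<dots> = (\<Sum>l=1..d. mu l * w l)"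
    unfolding w_def sum_distrib_left by (rule sum.swap)
  also have "\<dots> = (\<Sum>l=1..k. mu l * w l) + (\<Sum>l=k+1..d. mu l * w l)"
    using sum_split_at[of k d] k by simp
  \<comment> \<open>Weight missing at the top and weight present below are both priced at
    \<open>mu k\<close>; the total mass \<open>k\<close> makes the two amounts cancel.\<close>
  also have "\<dots> \<le> (\<Sum>l=1..k. mu l - mu k * (1 - w l)) + (\<Sum>l=k+1..d. mu k * w l)"
  proof (intro add_mono sum_mono mult_right_mono w0)
    fix l assume "l \<in> {1..k}"
    then have "mu k * (1 - w l) \<le> mu l * (1 - w l)"
      using k w1[of l] by (intro mult_right_mono mu_antimono) auto
    then show "mu l * w l \<le> mu l - mu k * (1 - w l)" by (simp add: algebra_simps)
  next
    fix l assume "l \<in> {k+1..d}"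
    then show "mu l \<le> mu k" using k by (intro mu_antimono) auto
  qed
  also have "\<dots> = (\<Sum>l=1..k. mu l) - mu k * (real k - (\<Sum>l=1..k. w l)) + mu k * (\<Sum>l=k+1..d. w l)"
    by (simp add: sum_subtractf sum_distrib_left[symmetric])
  also have "\<dots> = (\<Sum>l=1..k. mu l)"
    using wk by (simp add: algebra_simps flip: distrib_left)
  finally show ?thesis .
qed

text \<open>The pairing of \<open>err\<close> with \<open>Y\<close> equals \<open>loss\<close> plus
  the excess of the top \<open>k\<close> perturbed eigenvalues over the trace of \<open>a\<close> on
  the old top block, and \<open>Ky_Fan\<close> makes that excess nonnegative.\<close>

lemma loss_le_err_Y: "loss \<le> (\<Sum>i=1..d. \<Sum>j=1..d. err i j * Y i j)"
proof -
  have "(\<Sum>i=1..d. \<Sum>j=1..d. err i j * Y i j) =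
    (\<Sum>i=1..d. \<Sum>j=1..d. a i j * X i j - of_bool (i = j) * (lam i * X i j)
        - of_bool (i = j \<and> i \<le> k) * (a i j - lam i))"
    by (intro sum.cong refl) (auto simp: err_def Y_def algebra_simps)
  also have "\<dots> = (\<Sum>l=1..k. mu l) - (\<Sum>i=1..d. \<Sum>j=1..d. of_bool (i = j) * (lam i * X i j))
      - (\<Sum>i=1..k. a i i - lam i)"
    unfolding sum_subtractf of_bool_conj_sum a_trace_X by simp
  also have "(\<Sum>i=1..d. \<Sum>j=1..d. of_bool (i = j) * (lam i * X i j)) = (\<Sum>i=1..d. lam i * X i i)"
    by (intro sum.cong refl) (auto simp: of_bool_def if_distrib if_distribR cong: if_cong)
  finally show ?thesis using Ky_Fan by (simp add: loss_def sum_subtractf)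
qed

lemma err_norm_nonneg: "0 \<le> err_norm"
  unfolding err_norm_def by (intro real_sqrt_ge_zero sum_nonneg) simp

lemma loss_le: "loss \<le> err_norm * sqrt (2 * leak)"
  using loss_le_err_Y sum2_mult_le_L2[of err Y "{1..d}" "{1..d}"]
  unfolding Y_norm err_norm_def by linarith

text \<open>Growth \<open>gap * leak \<le> loss\<close> meets \<open>loss_le\<close>, which has only
  the root of \<open>leak\<close>; cancelling one root leaves a bound that is linear in the
  perturbation and asks for no smallness of it.\<close>

lemma sqrt_leak_le: "sqrt (2 * leak) \<le> 2 * err_norm / gap"
proof (cases "leak = 0")
  case True
  then show ?thesis using err_norm_nonneg gap_pos by (simp add: gap_def)
next
  case False
  define q where "q = sqrt (2 * leak)"
  have q: "q > 0" "2 * leak = q\<^sup>2" using False leak_nonneg by (auto simp: q_def)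
  have "gap * (q\<^sup>2 / 2) \<le> err_norm * q"
  proof -
    have "q\<^sup>2 / 2 = leak" using q(2) by simp
    then show ?thesis using order_trans[OF gap_leak_le_loss loss_le] unfolding q_def[symmetric] by (simp only:)
  qed
  then have "gap * q \<le> 2 * err_norm"
    using q(1) by (simp add: power2_eq_square field_simps)
  then show ?thesis using gap_pos by (simp add: gap_def q_def field_simps)
qed

lemma leak_le: "leak \<le> 2 * (err_norm / gap)\<^sup>2"
proof -
  have "(sqrt (2 * leak))\<^sup>2 \<le> (2 * err_norm / gap)\<^sup>2"
    using sqrt_leak_le by (intro power_mono) (auto simp: leak_nonneg)
  then show ?thesis using leak_nonneg by (simp add: power2_eq_square)
qed

lemma c_quadratic_err:
  assumes "l \<in> {1..d}"
  shows "\<bar>\<Sum>i=1..d. \<Sum>j=1..d. err i j * (c i l * c j l)\<bar> \<le> err_norm"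
proof -
  have "(\<Sum>i=1..d. \<Sum>j=1..d. (c i l * c j l)\<^sup>2) = (\<Sum>i=1..d. c i l * c i l) * (\<Sum>j=1..d. c j l * c j l)"
    unfolding sum_product by (intro sum.cong refl) (simp add: power2_eq_square algebra_simps)
  also have "\<dots> = 1" using c_cols[OF assms assms] by simp
  finally show ?thesis
    using sum2_mult_le_L2[of err "\<lambda>i j. c i l * c j l" "{1..d}" "{1..d}"] by (simp add: err_norm_def)
qed

lemma mu_eq:
  assumes l: "l \<in> {1..d}"
  shows "mu l = (\<Sum>i=1..d. lam i * (c i l)\<^sup>2) + (\<Sum>i=1..d. \<Sum>j=1..d. err i j * (c i l * c j l))"
proof -
  have "T (\<lambda>m. of_bool (m = l)) i j = c i l * c j l" for i j
    unfolding T_def using l by (simp add: of_bool_def if_distrib if_distribR cong: if_cong)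
  then have "(\<Sum>i=1..d. \<Sum>j=1..d. a i j * (c i l * c j l)) =
    (\<Sum>i=1..d. \<Sum>j=1..d. T mu i j * T (\<lambda>m. of_bool (m = l)) j i)"
    by (intro sum.cong refl) (simp add: a_T)
  also have "\<dots> = mu l" unfolding T_mult T_trace using l by (simp add: of_bool_def if_distrib if_distribR cong: if_cong)
  finally have "mu l = (\<Sum>i=1..d. \<Sum>j=1..d. a i j * (c i l * c j l))" ..
  also have "\<dots> = (\<Sum>i=1..d. (\<Sum>j=1..d. of_bool (i = j) * (lam i * (c i l * c j l))) +
      (\<Sum>j=1..d. err i j * (c i l * c j l)))"
    unfolding sum.distrib[symmetric] by (intro sum.cong refl) (simp add: err_def algebra_simps)
  also have "\<dots> = (\<Sum>i=1..d. lam i * (c i l)\<^sup>2) + (\<Sum>i=1..d. \<Sum>j=1..d. err i j * (c i l * c j l))"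
    unfolding sum.distrib by (simp add: of_bool_def if_distrib if_distribR power2_eq_square cong: if_cong)
  finally show ?thesis .
qed

text \<open>Rayleigh quotients: column \<open>k\<close> of \<open>c\<close> has squared mass at most
  \<open>leak\<close> outside the old top block and column \<open>k + 1\<close> at most
  \<open>leak\<close> inside it, so \<open>mu k\<close> cannot drop and \<open>mu (k + 1)\<close>
  cannot rise by much.\<close>

lemma mu_gap: "gap - 2 * lam 1 * leak - 2 * err_norm \<le> mu k - mu (k + 1)"
proof -
  have kd: "k \<in> {1..d}" "k + 1 \<in> {1..d}" using k by auto
  define s1 where "s1 = (\<Sum>i=k+1..d. (c i k)\<^sup>2)"
  define s2 where "s2 = (\<Sum>i=1..k. (c i (k+1))\<^sup>2)"
  have "s1 \<le> leak"
    unfolding s1_def leak_def X_def T_def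
  proof (intro sum_mono)
    fix i assume "i \<in> {k+1..d}"
    show "(c i k)\<^sup>2 \<le> (\<Sum>l=1..d. of_bool (l \<le> k) * (c i l * c i l))"
      using member_le_sum[of k "{1..d}" "\<lambda>l. of_bool (l \<le> k) * (c i l * c i l)"] kd
      by (simp add: power2_eq_square)
  qed
  have "s2 \<le> leak"
    unfolding s2_def leak_eq Xc_def T_def
  proof (intro sum_mono)
    fix i assume "i \<in> {1..k}"
    show "(c i (k+1))\<^sup>2 \<le> (\<Sum>l=1..d. of_bool (\<not> l \<le> k) * (c i l * c i l))"
      using member_le_sum[of "k+1" "{1..d}" "\<lambda>l. of_bool (\<not> l \<le> k) * (c i l * c i l)"] kd
      by (simp add: power2_eq_square)
  qed
  have n1: "(\<Sum>i=1..k. (c i k)\<^sup>2) = 1 - s1"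
    using c_cols[OF kd(1) kd(1)] sum_split_at[of k d "\<lambda>i. (c i k)\<^sup>2"] k
    by (simp add: s1_def power2_eq_square)
  have n2: "(\<Sum>i=k+1..d. (c i (k+1))\<^sup>2) = 1 - s2"
    using c_cols[OF kd(2) kd(2)] sum_split_at[of k d "\<lambda>i. (c i (k+1))\<^sup>2"] k
    by (simp add: s2_def power2_eq_square)
  have "s1 \<ge> 0" "s2 \<ge> 0" unfolding s1_def s2_def by (auto intro: sum_nonneg)
  have "(\<Sum>i=1..d. lam i * (c i k)\<^sup>2) \<ge> (\<Sum>i=1..k. lam i * (c i k)\<^sup>2)"
    using k by (intro sum_mono2) (auto intro!: mult_nonneg_nonneg lam_nonneg)
  moreover have "(\<Sum>i=1..k. lam i * (c i k)\<^sup>2) \<ge> (\<Sum>i=1..k. lam k * (c i k)\<^sup>2)"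
    using k by (intro sum_mono mult_right_mono lam_antimono) auto
  ultimately have "(\<Sum>i=1..d. lam i * (c i k)\<^sup>2) \<ge> lam k * (1 - s1)"
    unfolding sum_distrib_left[symmetric] n1 by linarith
  moreover have "lam k * s1 \<le> lam 1 * leak"
    using \<open>s1 \<le> leak\<close> \<open>s1 \<ge> 0\<close> k by (intro mult_mono lam_antimono lam_nonneg) auto
  ultimately have "mu k \<ge> lam k - lam 1 * leak - err_norm"
    using mu_eq[OF kd(1)] c_quadratic_err[OF kd(1)] by (simp add: algebra_simps)
  have "(\<Sum>i=1..d. lam i * (c i (k+1))\<^sup>2) =
     (\<Sum>i=1..k. lam i * (c i (k+1))\<^sup>2) + (\<Sum>i=k+1..d. lam i * (c i (k+1))\<^sup>2)"
    using k by (intro sum_split_at) auto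
  also have "\<dots> \<le> (\<Sum>i=1..k. lam 1 * (c i (k+1))\<^sup>2) + (\<Sum>i=k+1..d. lam (k+1) * (c i (k+1))\<^sup>2)"
    using k by (intro add_mono sum_mono mult_right_mono lam_antimono) auto
  also have "\<dots> = lam 1 * s2 + lam (k+1) * (1 - s2)"
    unfolding sum_distrib_left[symmetric] n2 s2_def ..
  also have "\<dots> \<le> lam 1 * leak + lam (k+1)"
  proof -
    have "lam 1 * s2 \<le> lam 1 * leak" using \<open>s2 \<le> leak\<close> k by (intro mult_left_mono lam_nonneg) auto
    moreover have "0 \<le> lam (k+1) * s2" using \<open>s2 \<ge> 0\<close> k by (intro mult_nonneg_nonneg lam_nonneg) auto
    ultimately show ?thesis by (simp add: algebra_simps)
  qed
  finally have "mu (k+1) \<le> lam (k+1) + lam 1 * leak + err_norm"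
    using mu_eq[OF kd(2)] c_quadratic_err[OF kd(2)] by simp
  with \<open>mu k \<ge> _\<close> show ?thesis by (simp add: gap_def)
qed

text \<open>A diagonal entry of a projection is the squared norm of its row, which splits
  \<open>loss\<close> into off-diagonal and diagonal blocks. The latter (\<open>p\<close> and
  \<open>q\<close>) are quadratic in \<open>leak\<close>, hence of fourth order in the
  perturbation.\<close>

lemma loss_offdiagonal:
  "\<bar>loss - (\<Sum>i=1..k. \<Sum>j=k+1..d. (lam i - lam j) * (X i j)\<^sup>2)\<bar> \<le> 2 * lam 1 * leak\<^sup>2"
proof -
  define p where "p = (\<Sum>i=1..k. lam i * (\<Sum>m=1..k. (Xc i m)\<^sup>2))"
  define q where "q = (\<Sum>j=k+1..d. lam j * (\<Sum>m=k+1..d. (X j m)\<^sup>2))"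
  have 1: "Xc i i = (\<Sum>m=1..k. (Xc i m)\<^sup>2) + (\<Sum>j=k+1..d. (X i j)\<^sup>2)" if "i \<in> {1..k}" for i
  proof -
    have "(\<Sum>j=k+1..d. (Xc i j)\<^sup>2) = (\<Sum>j=k+1..d. (X i j)\<^sup>2)"
    proof (intro sum.cong refl)
      fix j assume "j \<in> {k+1..d}"
      then have "X i j + Xc i j = 0" using X_plus_Xc[of i j] that k by simp
      then have "Xc i j = - X i j" by linarith
      then show "(Xc i j)\<^sup>2 = (X i j)\<^sup>2" by simp
    qed
    then show ?thesis using Xc_diag_sq[of i] sum_split_at[of k d "\<lambda>m. (Xc i m)\<^sup>2"] k by simp
  qed
  have 2: "X j j = (\<Sum>m=k+1..d. (X j m)\<^sup>2) + (\<Sum>i=1..k. (X i j)\<^sup>2)" for j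
  proof -
    have "(\<Sum>m=1..k. (X j m)\<^sup>2) = (\<Sum>i=1..k. (X i j)\<^sup>2)"
      by (intro sum.cong refl arg_cong[of _ _ "\<lambda>t. t\<^sup>2"] X_sym)
    then show ?thesis using sum_split_at[of k d "\<lambda>m. (X j m)\<^sup>2"] k X_diag_sq[of j] by linarith
  qed
  have "(\<Sum>i=1..k. lam i * Xc i i) = p + (\<Sum>i=1..k. \<Sum>j=k+1..d. lam i * (X i j)\<^sup>2)"
    unfolding p_def sum.distrib[symmetric]
  proof (intro sum.cong refl)
    fix i assume "i \<in> {1..k}"
    from arg_cong[OF 1[OF this], of "\<lambda>t. lam i * t"]
    show "lam i * Xc i i = lam i * (\<Sum>m=1..k. (Xc i m)\<^sup>2) + (\<Sum>j=k+1..d. lam i * (X i j)\<^sup>2)"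
      by (simp only: distrib_left sum_distrib_left)
  qed
  moreover have "(\<Sum>j=k+1..d. lam j * X j j) = q + (\<Sum>j=k+1..d. \<Sum>i=1..k. lam j * (X i j)\<^sup>2)"
    unfolding q_def sum.distrib[symmetric]
  proof (intro sum.cong refl)
    fix j
    from arg_cong[OF 2[of j], of "\<lambda>t. lam j * t"]
    show "lam j * X j j = lam j * (\<Sum>m=k+1..d. (X j m)\<^sup>2) + (\<Sum>i=1..k. lam j * (X i j)\<^sup>2)"
      by (simp only: distrib_left sum_distrib_left)
  qed
  moreover have "(\<Sum>j=k+1..d. \<Sum>i=1..k. lam j * (X i j)\<^sup>2) = (\<Sum>i=1..k. \<Sum>j=k+1..d. lam j * (X i j)\<^sup>2)"
    by (rule sum.swap)
  ultimately have "loss - (\<Sum>i=1..k. \<Sum>j=k+1..d. (lam i - lam j) * (X i j)\<^sup>2) = p - q"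
    unfolding loss_eq by (simp add: left_diff_distrib sum_subtractf)
  moreover have "0 \<le> p" "0 \<le> q"
    unfolding p_def q_def using k by (auto intro!: sum_nonneg mult_nonneg_nonneg lam_nonneg)
  moreover have "p \<le> lam 1 * leak\<^sup>2"
  proof -
    have "p \<le> (\<Sum>i=1..k. lam 1 * (\<Sum>m=1..k. Xc i i * Xc m m))"
      unfolding p_def
    proof (intro sum_mono mult_mono)
      fix i m assume "i \<in> {1..k}" "m \<in> {1..k}"
      show "(Xc i m)\<^sup>2 \<le> Xc i i * Xc m m" unfolding Xc_def by (rule T_Cauchy_Schwarz) simp
    qed (use k in \<open>auto intro!: lam_antimono lam_nonneg sum_nonneg\<close>)
    also have "\<dots> = lam 1 * leak\<^sup>2"
      unfolding leak_eq power2_eq_square sum_product sum_distrib_left[symmetric] ..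
    finally show ?thesis .
  qed
  moreover have "q \<le> lam 1 * leak\<^sup>2"
  proof -
    have "q \<le> (\<Sum>i=k+1..d. lam 1 * (\<Sum>m=k+1..d. X i i * X m m))"
      unfolding q_def
    proof (intro sum_mono mult_mono)
      fix i m assume "i \<in> {k+1..d}" "m \<in> {k+1..d}"
      show "(X i m)\<^sup>2 \<le> X i i * X m m" unfolding X_def by (rule T_Cauchy_Schwarz) simp
    qed (use k in \<open>auto intro!: lam_antimono lam_nonneg sum_nonneg\<close>)
    also have "\<dots> = lam 1 * leak\<^sup>2"
      unfolding leak_def power2_eq_square sum_product sum_distrib_left[symmetric] ..
    finally show ?thesis .
  qed
  ultimately show ?thesis by linarith
qed

text \<open>Read off from the fact that \<open>X\<close> and \<open>a\<close> commute.\<close>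

lemma offdiagonal_first_order:
  assumes i: "i \<in> {1..k}" and j: "j \<in> {k+1..d}"
  shows "\<bar>(lam i - lam j) * X i j - err i j\<bar> \<le> 4 * err_norm\<^sup>2 / gap"
proof -
  have ij: "i \<in> {1..d}" "j \<in> {1..d}" "i \<le> k" "\<not> j \<le> k" using i j k by auto
  have "(\<Sum>m=1..d. a i m * X m j) = T (\<lambda>l. mu l * of_bool (l \<le> k)) i j"
    unfolding X_def T_mult[symmetric] using ij by (intro sum.cong refl) (simp add: a_T)
  moreover have "(\<Sum>m=1..d. X i m * a m j) = T (\<lambda>l. of_bool (l \<le> k) * mu l) i j"
    unfolding X_def T_mult[symmetric] using ij by (intro sum.cong refl) (simp add: a_T)
  ultimately have comm: "(\<Sum>m=1..d. a i m * X m j) = (\<Sum>m=1..d. X i m * a m j)"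
    by (simp add: mult.commute)
  have "(\<Sum>m=1..d. a i m * X m j) = (\<Sum>m=1..d. of_bool (i = m) * (lam i * X m j) + err i m * Y m j)"
    using ij by (intro sum.cong refl) (auto simp: err_def Y_def algebra_simps)
  also have "\<dots> = lam i * X i j + (\<Sum>m=1..d. err i m * Y m j)"
    using ij unfolding sum.distrib by (simp add: of_bool_def if_distrib if_distribR cong: if_cong)
  finally have 1: "(\<Sum>m=1..d. a i m * X m j) = lam i * X i j + (\<Sum>m=1..d. err i m * Y m j)" .
  \<comment> \<open>Since \<open>i \<le> k\<close>, row \<open>i\<close> of \<open>X\<close>
    contains a unit entry of the old projection, whereas column \<open>j\<close> does not; this
    asymmetry leaves the single first-order term \<open>err i j\<close>, and all else is a product
    of \<open>Y\<close> and \<open>err\<close>.\<close>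
  have "(\<Sum>m=1..d. X i m * a m j) =
      (\<Sum>m=1..d. of_bool (m = j) * (lam m * X i m) + of_bool (i = m) * err m j + Y i m * err m j)"
    using ij by (intro sum.cong refl) (auto simp: err_def Y_def algebra_simps)
  also have "\<dots> = lam j * X i j + err i j + (\<Sum>m=1..d. Y i m * err m j)"
    using ij unfolding sum.distrib by (simp add: of_bool_def if_distrib if_distribR cong: if_cong)
  finally have 2: "(lam i - lam j) * X i j - err i j = (\<Sum>m=1..d. Y i m * err m j) - (\<Sum>m=1..d. err i m * Y m j)"
    using 1 comm by (simp add: algebra_simps)
  have row: "sqrt (\<Sum>m=1..d. (f i m)\<^sup>2) \<le> sqrt (\<Sum>i=1..d. \<Sum>m=1..d. (f i m)\<^sup>2)"
    if "i \<in> {1..d}" for f :: "nat \<Rightarrow> nat \<Rightarrow> real" and i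
    using that by (intro real_sqrt_le_mono member_le_sum[of i _ "\<lambda>i. \<Sum>m=1..d. (f i m)\<^sup>2"]) (auto intro: sum_nonneg)
  have col: "sqrt (\<Sum>m=1..d. (f m j)\<^sup>2) \<le> sqrt (\<Sum>i=1..d. \<Sum>m=1..d. (f i m)\<^sup>2)"
    if "j \<in> {1..d}" for f :: "nat \<Rightarrow> nat \<Rightarrow> real" and j
    using row[OF that, of "\<lambda>i j. f j i"] by (subst sum.swap)
  have en: "err_norm * (2 * err_norm / gap) = 2 * err_norm\<^sup>2 / gap" by (simp add: power2_eq_square)
  have "\<bar>\<Sum>m=1..d. Y i m * err m j\<bar> \<le> sqrt (\<Sum>m=1..d. (Y i m)\<^sup>2) * sqrt (\<Sum>m=1..d. (err m j)\<^sup>2)"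
    by (rule sum_mult_le_L2)
  also have "\<dots> \<le> (2 * err_norm / gap) * err_norm"
    using row[OF ij(1), of Y] col[OF ij(2), of err] err_norm_nonneg
    unfolding Y_norm err_norm_def[symmetric]
    by (intro mult_mono order_trans[OF _ sqrt_leak_le])
       (auto intro!: sum_nonneg divide_nonneg_pos simp: leak_nonneg gap_pos gap_def simp del: real_sqrt_le_iff)
  finally have 3: "\<bar>\<Sum>m=1..d. Y i m * err m j\<bar> \<le> 2 * err_norm\<^sup>2 / gap" unfolding mult.commute[of "2 * err_norm / gap"] en .
  have "\<bar>\<Sum>m=1..d. err i m * Y m j\<bar> \<le> sqrt (\<Sum>m=1..d. (err i m)\<^sup>2) * sqrt (\<Sum>m=1..d. (Y m j)\<^sup>2)"
    by (rule sum_mult_le_L2)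
  also have "\<dots> \<le> err_norm * (2 * err_norm / gap)"
    using row[OF ij(1), of err] col[OF ij(2), of Y] err_norm_nonneg
    unfolding Y_norm err_norm_def[symmetric]
    by (intro mult_mono order_trans[OF _ sqrt_leak_le])
       (auto intro!: sum_nonneg divide_nonneg_pos simp: leak_nonneg gap_pos gap_def simp del: real_sqrt_le_iff)
  finally have 4: "\<bar>\<Sum>m=1..d. err i m * Y m j\<bar> \<le> 2 * err_norm\<^sup>2 / gap" unfolding en .
  have "2 * err_norm\<^sup>2 / gap + 2 * err_norm\<^sup>2 / gap = 4 * err_norm\<^sup>2 / gap" by simp
  with 2 3 4 show ?thesis by linarith
qed

text \<open>Inserting the first-order value of \<open>X i j\<close> into
  \<open>loss_offdiagonal\<close> leaves a cross term of third order and a squared remainder of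
  fourth order; \<open>d\<close> squared bounds the number of index pairs, and the term with
  \<open>lam 1\<close> stems from \<open>leak_le\<close>.\<close>

lemma loss_second_order:
  "\<bar>loss - (\<Sum>i=1..k. \<Sum>j=k+1..d. (err i j)\<^sup>2 / (lam i - lam j))\<bar>
    \<le> (16 * (real d)\<^sup>2 / gap ^ 3 + 8 * lam 1 / gap ^ 4) * err_norm ^ 4
       + 8 * (real d)\<^sup>2 / gap\<^sup>2 * err_norm ^ 3"
proof -
  \<comment> \<open>Cross term and squared remainder for one pair, with remainder at most
    \<open>4 * err_norm^2 / gap\<close>, divided by an eigenvalue difference of at least
    \<open>gap\<close>.\<close>
  define B where "B = 8 * err_norm ^ 3 / gap\<^sup>2 + 16 * err_norm ^ 4 / gap ^ 3"
  have gp: "gap > 0" using gap_pos by (simp add: gap_def)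
  have B0: "0 \<le> B" unfolding B_def using gp err_norm_nonneg by auto
  have entry: "\<bar>(lam i - lam j) * (X i j)\<^sup>2 - (err i j)\<^sup>2 / (lam i - lam j)\<bar> \<le> B"
    if i: "i \<in> {1..k}" and j: "j \<in> {k+1..d}" for i j
  proof -
    define D where "D = lam i - lam j"
    have "lam k \<le> lam i" "lam j \<le> lam (k+1)" using i j k by (auto intro!: lam_antimono)
    then have D: "gap \<le> D" by (simp add: D_def gap_def)
    define \<rho> where "\<rho> = D * X i j - err i j"
    have \<rho>: "\<bar>\<rho>\<bar> \<le> 4 * err_norm\<^sup>2 / gap"
      using offdiagonal_first_order[OF i j] by (simp add: \<rho>_def D_def)
    have e: "\<bar>err i j\<bar> \<le> err_norm"
    proof -
      have "(err i j)\<^sup>2 \<le> (\<Sum>j=1..d. (err i j)\<^sup>2)"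
        using i j by (intro member_le_sum[of j _ "\<lambda>j. (err i j)\<^sup>2"]) auto
      also have "\<dots> \<le> (\<Sum>i=1..d. \<Sum>j=1..d. (err i j)\<^sup>2)"
        using i k by (intro member_le_sum[of i _ "\<lambda>i. \<Sum>j=1..d. (err i j)\<^sup>2"]) (auto intro: sum_nonneg)
      finally show ?thesis unfolding err_norm_def
        by (metis real_sqrt_abs real_sqrt_le_iff)
    qed
    have "X i j = (err i j + \<rho>) / D" using D gp by (simp add: \<rho>_def)
    then have "D * (X i j)\<^sup>2 - (err i j)\<^sup>2 / D = (err i j + \<rho>)\<^sup>2 / D - (err i j)\<^sup>2 / D"
      using D gp by (simp add: power2_eq_square)
    also have "\<dots> = (2 * err i j * \<rho> + \<rho>\<^sup>2) / D"
      by (simp add: diff_divide_distrib[symmetric] power2_sum)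
    also have "\<bar>\<dots>\<bar> \<le> (2 * err_norm * (4 * err_norm\<^sup>2 / gap) + (4 * err_norm\<^sup>2 / gap)\<^sup>2) / gap"
    proof -
      have "\<bar>2 * err i j * \<rho> + \<rho>\<^sup>2\<bar> \<le> 2 * \<bar>err i j\<bar> * \<bar>\<rho>\<bar> + \<bar>\<rho>\<bar>\<^sup>2"
        by (rule order_trans[OF abs_triangle_ineq]) (simp add: abs_mult)
      also have "\<dots> \<le> 2 * err_norm * (4 * err_norm\<^sup>2 / gap) + (4 * err_norm\<^sup>2 / gap)\<^sup>2"
        using e \<rho> err_norm_nonneg gp by (intro add_mono mult_mono power_mono) auto
      finally show ?thesis using D gp by (simp add: abs_divide frac_le)
    qed
    also have "\<dots> = B"
      using gp by (simp add: B_def field_simps power2_eq_square power3_eq_cube power4_eq_xxxx)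
    finally show ?thesis by (simp add: D_def)
  qed
  have "\<bar>(\<Sum>i=1..k. \<Sum>j=k+1..d. (lam i - lam j) * (X i j)\<^sup>2) - (\<Sum>i=1..k. \<Sum>j=k+1..d. (err i j)\<^sup>2 / (lam i - lam j))\<bar>
     \<le> (\<Sum>i=1..k. \<Sum>j=k+1..d. B)"
    unfolding sum_subtractf[symmetric]
    by (intro order_trans[OF sum_abs] sum_mono order_trans[OF sum_abs] entry)
  also have "\<dots> = real k * real (d - k) * B" by simp
  also have "\<dots> \<le> (real d)\<^sup>2 * B"
    using k B0 by (intro mult_right_mono) (auto simp: power2_eq_square intro!: mult_mono)
  finally have 1: "\<bar>(\<Sum>i=1..k. \<Sum>j=k+1..d. (lam i - lam j) * (X i j)\<^sup>2) - (\<Sum>i=1..k. \<Sum>j=k+1..d. (err i j)\<^sup>2 / (lam i - lam j))\<bar>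
     \<le> (real d)\<^sup>2 * B" .
  have "2 * lam 1 * leak\<^sup>2 \<le> 2 * lam 1 * (2 * (err_norm / gap)\<^sup>2)\<^sup>2"
    using leak_le leak_nonneg lam_nonneg[of 1] k by (intro mult_left_mono power_mono) auto
  also have "\<dots> = 8 * lam 1 / gap ^ 4 * err_norm ^ 4"
    using gp by (simp add: field_simps power2_eq_square power4_eq_xxxx)
  finally have 2: "2 * lam 1 * leak\<^sup>2 \<le> 8 * lam 1 / gap ^ 4 * err_norm ^ 4" .
  have "(real d)\<^sup>2 * B + 8 * lam 1 / gap ^ 4 * err_norm ^ 4 =
     (16 * (real d)\<^sup>2 / gap ^ 3 + 8 * lam 1 / gap ^ 4) * err_norm ^ 4 + 8 * (real d)\<^sup>2 / gap\<^sup>2 * err_norm ^ 3"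
    by (simp add: B_def algebra_simps)
  with 1 2 loss_offdiagonal show ?thesis by linarith
qed

end

subsection \<open>Right singular vectors\<close>

definition orthonormal_frame :: "(nat \<Rightarrow> real^'x) \<Rightarrow> bool" where
  "orthonormal_frame \<phi> \<longleftrightarrow>
     (\<forall>i\<in>{1..CARD('x)}. \<forall>j\<in>{1..CARD('x)}. \<phi> i \<bullet> \<phi> j = of_bool (i = j))"

lemma orthonormal_frame_expand:
  fixes \<phi> :: "nat \<Rightarrow> real^'x"
  assumes \<phi>: "orthonormal_frame \<phi>"
  shows "(\<Sum>i=1..CARD('x). (\<phi> i \<bullet> u) *\<^sub>R \<phi> i) = u"
proof -
  let ?B = "\<phi> ` {1..CARD('x)}"
  have on: "\<phi> i \<bullet> \<phi> j = of_bool (i = j)" if "i \<in> {1..CARD('x)}" "j \<in> {1..CARD('x)}" for i j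
    using \<phi> that by (auto simp: orthonormal_frame_def)
  have inj: "inj_on \<phi> {1..CARD('x)}"
  proof (rule inj_onI)
    fix i j assume ij: "i \<in> {1..CARD('x)}" "j \<in> {1..CARD('x)}" "\<phi> i = \<phi> j"
    then show "i = j" using on[OF ij(1,2)] on[OF ij(2,2)] by (auto split: if_splits)
  qed
  have orth: "pairwise orthogonal ?B"
    using on by (auto simp: pairwise_def orthogonal_def)
  have n1: "norm b = 1" if "b \<in> ?B" for b
    using that on by (auto simp: norm_eq_1)
  then have "independent ?B"
    using orth by (intro pairwise_orthogonal_independent) force+
  then have "u \<in> span ?B"
    using card_ge_dim_independent[of ?B UNIV] card_image[OF inj] by auto
  then have "(\<Sum>b\<in>?B. (u \<bullet> b) *\<^sub>R b) = u"
    using orth n1 by (intro orthonormal_basis_expand) auto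
  then show ?thesis using inj by (simp add: sum.reindex inner_commute)
qed

lemma orthonormal_frame_inner:
  fixes \<phi> :: "nat \<Rightarrow> real^'x"
  assumes "orthonormal_frame \<phi>"
  shows "(\<Sum>i=1..CARD('x). (\<phi> i \<bullet> u) * (\<phi> i \<bullet> v)) = u \<bullet> v"
proof -
  have "u \<bullet> v = (\<Sum>i=1..CARD('x). (\<phi> i \<bullet> u) *\<^sub>R \<phi> i) \<bullet> v"
    by (simp only: orthonormal_frame_expand[OF assms])
  then show ?thesis by (simp add: inner_sum_left)
qed

lemma inner_mat_mult: "(M *v u) \<bullet> (M *v v) = u \<bullet> ((transpose M ** M) *v v)"
  for M :: "real^'n^'m"
  by (metis dot_lmul_matrix matrix_vector_mul_assoc transpose_matrix_vector transpose_transpose inner_commute)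

lemma svd_frame: "right_singular_system M \<sigma> \<phi> \<Longrightarrow> orthonormal_frame \<phi>"
  by (simp add: right_singular_system_def orthonormal_frame_def)

lemma svd_inner:
  fixes M :: "real^'x^'y"
  assumes "right_singular_system M \<sigma> \<phi>" "i \<in> {1..CARD('x)}"
  shows "(M *v v) \<bullet> (M *v \<phi> i) = (\<sigma> i)\<^sup>2 * (\<phi> i \<bullet> v)"
  using assms unfolding inner_mat_mult by (simp add: right_singular_system_def inner_commute)

text \<open>Only \<open>M\<close> is assumed to have a gap; the singular system of \<open>N\<close>
  is arbitrary. The base point is the true matrix at first, but an estimated one when continuity is
  needed away from the truth.\<close>

locale two_svd =
  fixes M N :: "real^'x^'y" and \<sigma> \<tau> :: "nat \<Rightarrow> real" and \<phi> \<psi> :: "nat \<Rightarrow> real^'x" and k :: nat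
  assumes svd_M: "right_singular_system M \<sigma> \<phi>" and svd_N: "right_singular_system N \<tau> \<psi>"
    and k_pos: "1 \<le> k" and k_less: "k < CARD('x)" and svd_gap: "\<sigma> (k + 1) < \<sigma> k"
begin

text \<open>The Gram matrices of \<open>M\<close> and \<open>N\<close> are compared in the basis
  \<open>\<phi>\<close>: the first is diagonal there, and the vectors \<open>\<psi>\<close>
  diagonalise the second.\<close>

sublocale spectral_perturbation "CARD('x)" k "\<lambda>i. (\<sigma> i)\<^sup>2" "\<lambda>i. (\<tau> i)\<^sup>2"
  "\<lambda>i j. (N *v \<phi> i) \<bullet> (N *v \<phi> j)" "\<lambda>i l. \<phi> i \<bullet> \<psi> l"
proof
  let ?I = "{1..CARD('x)}"
  have fr: "orthonormal_frame \<phi>" "orthonormal_frame \<psi>" using svd_frame svd_M svd_N by auto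
  have k1: "k \<in> ?I" "k + 1 \<in> ?I" using k_pos k_less by auto
  show "(\<Sum>i=1..CARD('x). (\<phi> i \<bullet> \<psi> l) * (\<phi> i \<bullet> \<psi> m)) = of_bool (l = m)" if "l \<in> ?I" "m \<in> ?I" for l m
    using orthonormal_frame_inner[OF fr(1)] fr(2) that by (auto simp: orthonormal_frame_def)
  show "(\<Sum>l=1..CARD('x). (\<phi> i \<bullet> \<psi> l) * (\<phi> j \<bullet> \<psi> l)) = of_bool (i = j)" if "i \<in> ?I" "j \<in> ?I" for i j
    using orthonormal_frame_inner[OF fr(2), of "\<phi> i" "\<phi> j"] fr(1) that
    by (auto simp: orthonormal_frame_def inner_commute)
  show "(N *v \<phi> i) \<bullet> (N *v \<phi> j) = (\<Sum>l=1..CARD('x). (\<tau> l)\<^sup>2 * ((\<phi> i \<bullet> \<psi> l) * (\<phi> j \<bullet> \<psi> l)))" for i j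
  proof -
    have "(N *v \<phi> i) \<bullet> (N *v \<phi> j) = (N *v \<phi> i) \<bullet> (N *v (\<Sum>l=1..CARD('x). (\<psi> l \<bullet> \<phi> j) *\<^sub>R \<psi> l))"
      by (simp only: orthonormal_frame_expand[OF fr(2)])
    also have "\<dots> = (\<Sum>l=1..CARD('x). (\<psi> l \<bullet> \<phi> j) * ((N *v \<phi> i) \<bullet> (N *v \<psi> l)))"
      by (simp add: linear_sum[OF matrix_vector_mul_linear] inner_sum_right matrix_vector_mult_scaleR)
    also have "\<dots> = (\<Sum>l=1..CARD('x). (\<tau> l)\<^sup>2 * ((\<phi> i \<bullet> \<psi> l) * (\<phi> j \<bullet> \<psi> l)))"
      using svd_inner[OF svd_N] by (intro sum.cong refl) (simp add: inner_commute)
    finally show ?thesis .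
  qed
  show "(\<sigma> (k + 1))\<^sup>2 < (\<sigma> k)\<^sup>2"
    using svd_gap svd_M k1 by (intro power_strict_mono) (auto simp: right_singular_system_def)
qed (use svd_M svd_N k_pos k_less in \<open>auto simp: right_singular_system_def intro!: power_mono\<close>)

end

abbreviation gain :: "nat \<Rightarrow> real^'n^'m \<Rightarrow> (nat \<Rightarrow> real^'n) \<Rightarrow> real" where
  "gain k L \<Psi> \<equiv> (frob_norm k (mat_cols L \<Psi>))\<^sup>2"

lemma frob_norm_sq: "(frob_norm k A)\<^sup>2 = (\<Sum>j=1..k. A j \<bullet> A j)"
  by (simp add: frob_norm_def sum_nonneg inner_vec_def power2_eq_square)

context two_svd
begin

text \<open>The value is linear in the projection \<open>X\<close> and sees the singular vectors
  only through it, so sign choices and ties within the top \<open>k\<close> are harmless.\<close>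

lemma frob_coords:
  fixes L :: "real^'x^'z"
  shows "gain k L \<psi> = (\<Sum>i=1..CARD('x). \<Sum>j=1..CARD('x). ((L *v \<phi> i) \<bullet> (L *v \<phi> j)) * X i j)"
proof -
  have "gain k L \<psi> = (\<Sum>l=1..k. (L *v \<psi> l) \<bullet> (L *v \<psi> l))"
    by (simp add: frob_norm_sq mat_cols_def)
  also have "\<dots> = (\<Sum>l=1..CARD('x). of_bool (l \<le> k) * ((L *v \<psi> l) \<bullet> (L *v \<psi> l)))"
    using k_less by (subst sum_split_at[of k "CARD('x)"]) auto
  also have "\<dots> = (\<Sum>l=1..CARD('x). \<Sum>i=1..CARD('x). \<Sum>j=1..CARD('x).
       ((L *v \<phi> i) \<bullet> (L *v \<phi> j)) * (of_bool (l \<le> k) * ((\<phi> i \<bullet> \<psi> l) * (\<phi> j \<bullet> \<psi> l))))"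
  proof (intro sum.cong refl)
    fix l
    have "L *v \<psi> l = L *v (\<Sum>i=1..CARD('x). (\<phi> i \<bullet> \<psi> l) *\<^sub>R \<phi> i)"
      by (simp only: orthonormal_frame_expand[OF svd_frame[OF svd_M]])
    also have "\<dots> = (\<Sum>i=1..CARD('x). (\<phi> i \<bullet> \<psi> l) *\<^sub>R (L *v \<phi> i))"
      by (simp add: linear_sum[OF matrix_vector_mul_linear] matrix_vector_mult_scaleR)
    finally have "(L *v \<psi> l) \<bullet> (L *v \<psi> l) = (\<Sum>i=1..CARD('x). (\<phi> i \<bullet> \<psi> l) *\<^sub>R (L *v \<phi> i)) \<bullet> (\<Sum>i=1..CARD('x). (\<phi> i \<bullet> \<psi> l) *\<^sub>R (L *v \<phi> i))"
      by simp
    also have "\<dots> = (\<Sum>i=1..CARD('x). \<Sum>j=1..CARD('x). ((L *v \<phi> i) \<bullet> (L *v \<phi> j)) * ((\<phi> i \<bullet> \<psi> l) * (\<phi> j \<bullet> \<psi> l)))"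
      unfolding inner_sum_left inner_sum_right by (intro sum.cong refl) (simp add: inner_commute)
    finally show "of_bool (l \<le> k) * ((L *v \<psi> l) \<bullet> (L *v \<psi> l)) = (\<Sum>i=1..CARD('x). \<Sum>j=1..CARD('x).
       ((L *v \<phi> i) \<bullet> (L *v \<phi> j)) * (of_bool (l \<le> k) * ((\<phi> i \<bullet> \<psi> l) * (\<phi> j \<bullet> \<psi> l))))"
      by (simp add: sum_distrib_left mult_ac)
  qed
  also have "\<dots> = (\<Sum>i=1..CARD('x). \<Sum>l=1..CARD('x). \<Sum>j=1..CARD('x).
       ((L *v \<phi> i) \<bullet> (L *v \<phi> j)) * (of_bool (l \<le> k) * ((\<phi> i \<bullet> \<psi> l) * (\<phi> j \<bullet> \<psi> l))))"
    by (rule sum.swap)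
  also have "\<dots> = (\<Sum>i=1..CARD('x). \<Sum>j=1..CARD('x). \<Sum>l=1..CARD('x).
       ((L *v \<phi> i) \<bullet> (L *v \<phi> j)) * (of_bool (l \<le> k) * ((\<phi> i \<bullet> \<psi> l) * (\<phi> j \<bullet> \<psi> l))))"
    by (intro sum.cong refl sum.swap)
  finally show ?thesis unfolding X_def T_def sum_distrib_left .
qed

lemma frob_coords_frame:
  fixes L :: "real^'x^'z"
  shows "gain k L \<phi> = (\<Sum>i=1..CARD('x). \<Sum>j=1..CARD('x). ((L *v \<phi> i) \<bullet> (L *v \<phi> j)) * of_bool (i = j \<and> i \<le> k))"
  using of_bool_conj_sum[of "\<lambda>i j. (L *v \<phi> i) \<bullet> (L *v \<phi> j)"]
  by (simp add: frob_norm_sq mat_cols_def mult.commute)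

lemma loss_frob: "loss = gain k M \<phi> - gain k M \<psi>"
proof -
  have on: "\<phi> i \<bullet> \<phi> j = of_bool (i = j)" if "i \<in> {1..CARD('x)}" "j \<in> {1..CARD('x)}" for i j
    using svd_frame[OF svd_M] that by (auto simp: orthonormal_frame_def)
  have "(\<Sum>i=1..CARD('x). \<Sum>j=1..CARD('x). ((M *v \<phi> i) \<bullet> (M *v \<phi> j)) * X i j)
      = (\<Sum>i=1..CARD('x). \<Sum>j=1..CARD('x). of_bool (i = j) * ((\<sigma> j)\<^sup>2 * X i j))"
    using on by (intro sum.cong refl) (simp add: svd_inner[OF svd_M])
  also have "\<dots> = (\<Sum>i=1..CARD('x). (\<sigma> i)\<^sup>2 * X i i)"
    by (intro sum.cong refl) (auto simp: of_bool_def if_distrib if_distribR cong: if_cong)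
  finally have "gain k M \<psi> = (\<Sum>i=1..CARD('x). (\<sigma> i)\<^sup>2 * X i i)"
    by (simp add: frob_coords)
  moreover have "gain k M \<phi> = (\<Sum>i=1..k. (\<sigma> i)\<^sup>2)"
    unfolding frob_norm_sq mat_cols_def using on k_less
    by (intro sum.cong refl) (simp add: svd_inner[OF svd_M])
  ultimately show ?thesis by (simp add: loss_def)
qed

text \<open>\<open>L\<close> is independent of \<open>M\<close> and \<open>N\<close> because the
  gain is always measured with the true matrix, also when two estimates are compared with each
  other.\<close>

lemma frob_diff_le:
  fixes L :: "real^'x^'z"
  shows "\<bar>gain k L \<psi> - gain k L \<phi>\<bar>
    \<le> sqrt (\<Sum>i=1..CARD('x). \<Sum>j=1..CARD('x). ((L *v \<phi> i) \<bullet> (L *v \<phi> j))\<^sup>2) * (2 * err_norm / gap)"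
proof -
  have "gain k L \<psi> - gain k L \<phi>
     = (\<Sum>i=1..CARD('x). \<Sum>j=1..CARD('x). ((L *v \<phi> i) \<bullet> (L *v \<phi> j)) * Y i j)"
    unfolding frob_coords frob_coords_frame sum_subtractf[symmetric]
    by (intro sum.cong refl) (simp add: Y_def right_diff_distrib)
  also have "\<bar>\<dots>\<bar> \<le> sqrt (\<Sum>i=1..CARD('x). \<Sum>j=1..CARD('x). ((L *v \<phi> i) \<bullet> (L *v \<phi> j))\<^sup>2) * sqrt (2 * leak)"
    unfolding Y_norm[symmetric] by (rule sum2_mult_le_L2)
  also have "\<dots> \<le> sqrt (\<Sum>i=1..CARD('x). \<Sum>j=1..CARD('x). ((L *v \<phi> i) \<bullet> (L *v \<phi> j))\<^sup>2) * (2 * err_norm / gap)"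
    by (intro mult_left_mono sqrt_leak_le real_sqrt_ge_zero sum_nonneg) auto
  finally show ?thesis .
qed

end

text \<open>This is \<open>err_norm\<close> as a function of the matrix alone: no singular system of
  \<open>N\<close> occurs, so continuity in \<open>N\<close> can be stated without choosing
  one.\<close>

definition gram_err :: "(nat \<Rightarrow> real) \<Rightarrow> (nat \<Rightarrow> real^'x) \<Rightarrow> real^'x^'y \<Rightarrow> real" where
  "gram_err \<sigma> \<phi> N = sqrt (\<Sum>i=1..CARD('x). \<Sum>j=1..CARD('x).
     ((N *v \<phi> i) \<bullet> (N *v \<phi> j) - of_bool (i = j) * (\<sigma> i)\<^sup>2)\<^sup>2)"

lemma continuous_on_matrix_vector_mult:
  fixes v :: "real^'n"
  assumes "continuous_on S (f :: 'a::topological_space \<Rightarrow> real^'n^'m)"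
  shows "continuous_on S (\<lambda>x. f x *v v)"
  unfolding matrix_vector_mult_def
  by (intro continuous_on_vec_lambda continuous_intros assms)

lemma continuous_on_gram_err: "continuous_on UNIV (gram_err \<sigma> \<phi>)"
  unfolding gram_err_def
  by (intro continuous_intros continuous_on_matrix_vector_mult)

lemma gram_err_self:
  assumes "right_singular_system M \<sigma> \<phi>"
  shows "gram_err \<sigma> \<phi> M = 0"
proof -
  have "(M *v \<phi> i) \<bullet> (M *v \<phi> j) - of_bool (i = j) * (\<sigma> i)\<^sup>2 = 0" if "i \<in> {1..CARD('a)}" "j \<in> {1..CARD('a)}" for i j
    using svd_inner[OF assms that(2)] svd_frame[OF assms] that by (auto simp: orthonormal_frame_def)
  then show ?thesis by (simp add: gram_err_def)
qed

lemma (in two_svd) err_norm_gram: "err_norm = gram_err \<sigma> \<phi> N"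
  by (simp add: err_norm_def err_def gram_err_def)

text \<open>The lower bound of \<open>mu_gap\<close>, with \<open>leak_le\<close> inserted, is
  continuous in \<open>N\<close> and positive at \<open>M\<close>; it serves every singular system
  of \<open>N\<close> at once.\<close>

lemma svd_gap_near:
  fixes M :: "real^'x^'y"
  assumes svd: "right_singular_system M \<sigma> \<phi>" and k: "1 \<le> k" "k < CARD('x)" and gap: "\<sigma> (k + 1) < \<sigma> k"
  shows "\<exists>\<delta>>0. \<forall>N \<tau> \<psi>. dist N M < \<delta> \<longrightarrow> right_singular_system N \<tau> \<psi> \<longrightarrow> \<tau> (k + 1) < \<tau> k"
proof -
  \<comment> \<open>Comparing \<open>M\<close> with itself only names the constant
    \<open>gap\<close>, which depends on \<open>\<sigma>\<close> and \<open>k\<close> alone.\<close>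
  interpret base: two_svd M M \<sigma> \<sigma> \<phi> \<phi> k by unfold_locales (use assms in auto)
  define f where "f N = base.gap - 2 * (\<sigma> 1)\<^sup>2 * (2 * (gram_err \<sigma> \<phi> N / base.gap)\<^sup>2) - 2 * gram_err \<sigma> \<phi> N" for N :: "real^'x^'y"
  have "continuous_on UNIV f"
    unfolding f_def divide_inverse by (intro continuous_intros continuous_on_gram_err)
  then have "isCont f M" by (simp add: continuous_on_eq_continuous_at)
  moreover have "f M > 0"
    using base.gap_pos by (simp add: f_def gram_err_self[OF svd] base.gap_def)
  ultimately obtain \<delta> where \<delta>: "0 < \<delta>" "\<And>N. dist N M < \<delta> \<Longrightarrow> dist (f N) (f M) < f M"
    unfolding continuous_at_eps_delta by blast
  have "\<tau> (k + 1) < \<tau> k" if N: "dist N M < \<delta>" "right_singular_system N \<tau> \<psi>" for N \<tau> \<psi>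
  proof -
    interpret two_svd M N \<sigma> \<tau> \<phi> \<psi> k by unfold_locales (use assms N in auto)
    have "0 < f N" using \<delta>(2)[OF N(1)] by (simp add: dist_real_def)
    also have "f N \<le> gap - 2 * (\<sigma> 1)\<^sup>2 * leak - 2 * err_norm"
    proof -
      have "2 * (\<sigma> 1)\<^sup>2 * leak \<le> 2 * (\<sigma> 1)\<^sup>2 * (2 * (err_norm / gap)\<^sup>2)"
        using leak_le by (intro mult_left_mono) auto
      then show ?thesis by (simp add: f_def err_norm_gram gap_def base.gap_def)
    qed
    also have "\<dots> \<le> (\<tau> k)\<^sup>2 - (\<tau> (k + 1))\<^sup>2" by (rule mu_gap)
    finally have "(\<tau> (k + 1))\<^sup>2 < (\<tau> k)\<^sup>2" by simp
    moreover have "0 \<le> \<tau> k"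
      using N(2) k unfolding right_singular_system_def by simp
    ultimately show "\<tau> (k + 1) < \<tau> k" by (rule power2_less_imp_less)
  qed
  with \<delta>(1) show ?thesis by blast
qed

text \<open>The bound of \<open>frob_diff_le\<close> is continuous in the perturbed matrix and
  vanishes at the base point, so the choice of singular vectors on either side does not
  matter.\<close>

lemma frob_near:
  fixes N :: "real^'x^'y" and L :: "real^'x^'z"
  assumes svd: "right_singular_system N \<tau> \<psi>" and k: "1 \<le> k" "k < CARD('x)" and gap: "\<tau> (k + 1) < \<tau> k"
    and e: "0 < e"
  shows "\<exists>\<delta>>0. \<forall>N' \<tau>' \<psi>'. dist N' N < \<delta> \<longrightarrow> right_singular_system N' \<tau>' \<psi>' \<longrightarrow>
    \<bar>gain k L \<psi>' - gain k L \<psi>\<bar> < e"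
proof -
  interpret base: two_svd N N \<tau> \<tau> \<psi> \<psi> k by unfold_locales (use assms in auto)
  define f where "f N' = sqrt (\<Sum>i=1..CARD('x). \<Sum>j=1..CARD('x). ((L *v \<psi> i) \<bullet> (L *v \<psi> j))\<^sup>2) * (2 * gram_err \<tau> \<psi> N' / base.gap)" for N' :: "real^'x^'y"
  have "continuous_on UNIV f"
    unfolding f_def divide_inverse by (intro continuous_intros continuous_on_gram_err)
  then have "isCont f N" by (simp add: continuous_on_eq_continuous_at)
  then obtain \<delta> where \<delta>: "0 < \<delta>" "\<And>N'. dist N' N < \<delta> \<Longrightarrow> dist (f N') (f N) < e"
    using e unfolding continuous_at_eps_delta by blast
  have "\<bar>gain k L \<psi>' - gain k L \<psi>\<bar> < e"
    if N: "dist N' N < \<delta>" "right_singular_system N' \<tau>' \<psi>'" for N' \<tau>' \<psi>'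
  proof -
    interpret two_svd N N' \<tau> \<tau>' \<psi> \<psi>' k by unfold_locales (use assms N in auto)
    have "\<bar>gain k L \<psi>' - gain k L \<psi>\<bar> \<le> f N'"
      using frob_diff_le[of L] by (simp add: f_def err_norm_gram gap_def base.gap_def)
    moreover have "f N = 0" by (simp add: f_def gram_err_self[OF svd])
    ultimately show ?thesis using \<delta>(2)[OF N(1)] by (simp add: dist_real_def)
  qed
  with \<delta>(1) show ?thesis by blast
qed

text \<open>The classical second-order perturbation sum, in the exact Gram entries rather than their
  derivatives; linearisation at the true distribution is a separate, later step.\<close>

definition loss_quad :: "(nat \<Rightarrow> real) \<Rightarrow> (nat \<Rightarrow> real^'x) \<Rightarrow> nat \<Rightarrow> real^'x^'y \<Rightarrow> real" where
  "loss_quad \<sigma> \<phi> k N = (\<Sum>i=1..k. \<Sum>j=k+1..CARD('x). ((N *v \<phi> i) \<bullet> (N *v \<phi> j))\<^sup>2 / ((\<sigma> i)\<^sup>2 - (\<sigma> j)\<^sup>2))"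

lemma loss_quad_bound:
  fixes M :: "real^'x^'y"
  assumes svd: "right_singular_system M \<sigma> \<phi>" and k: "1 \<le> k" "k < CARD('x)" and gap: "\<sigma> (k + 1) < \<sigma> k"
  shows "\<exists>C\<ge>0. \<forall>(N :: real^'x^'y) \<tau> \<psi>. right_singular_system N \<tau> \<psi> \<longrightarrow>
    \<bar>gain k M \<phi> - gain k M \<psi> - loss_quad \<sigma> \<phi> k N\<bar>
      \<le> C * (gram_err \<sigma> \<phi> N ^ 3 + gram_err \<sigma> \<phi> N ^ 4)"
proof -
  interpret base: two_svd M M \<sigma> \<sigma> \<phi> \<phi> k by unfold_locales (use assms in auto)
  define C3 where "C3 = 8 * (real CARD('x))\<^sup>2 / base.gap\<^sup>2"
  define C4 where "C4 = 16 * (real CARD('x))\<^sup>2 / base.gap ^ 3 + 8 * (\<sigma> 1)\<^sup>2 / base.gap ^ 4"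
  have gp: "0 < base.gap" using base.gap_pos by (simp add: base.gap_def)
  have C: "0 \<le> C3" "0 \<le> C4" using gp by (auto simp: C3_def C4_def)
  have "\<bar>gain k M \<phi> - gain k M \<psi> - loss_quad \<sigma> \<phi> k N\<bar>
      \<le> (C3 + C4) * (gram_err \<sigma> \<phi> N ^ 3 + gram_err \<sigma> \<phi> N ^ 4)"
    if N: "right_singular_system N \<tau> \<psi>" for N :: "real^'x^'y" and \<tau> \<psi>
  proof -
    interpret two_svd M N \<sigma> \<tau> \<phi> \<psi> k by unfold_locales (use assms N in auto)
    have "loss_quad \<sigma> \<phi> k N = (\<Sum>i=1..k. \<Sum>j=k+1..CARD('x). (err i j)\<^sup>2 / ((\<sigma> i)\<^sup>2 - (\<sigma> j)\<^sup>2))"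
      unfolding loss_quad_def by (intro sum.cong refl) (auto simp: err_def)
    then have "\<bar>gain k M \<phi> - gain k M \<psi> - loss_quad \<sigma> \<phi> k N\<bar>
       \<le> C4 * err_norm ^ 4 + C3 * err_norm ^ 3"
      using loss_second_order by (simp add: loss_frob C3_def C4_def gap_def base.gap_def)
    also have "\<dots> \<le> (C3 + C4) * (err_norm ^ 3 + err_norm ^ 4)"
      using C err_norm_nonneg by (simp add: algebra_simps)
    finally show ?thesis by (simp add: err_norm_gram)
  qed
  moreover have "0 \<le> C3 + C4" using C by simp
  ultimately show ?thesis by blast
qed

subsection \<open>The method of types for a pair of independent samples\<close>

text \<open>By the conventions for \<open>ln 0\<close> and division by 0 the terms with
  \<open>t x = 0\<close> vanish, as they should, but so do those with \<open>p x = 0 < t x\<close>,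
  where the divergence is infinite. The support conditions of \<open>rate_domain\<close> exclude the
  latter.\<close>

definition KL :: "('a::finite \<Rightarrow> real) \<Rightarrow> ('a \<Rightarrow> real) \<Rightarrow> real" where
  "KL t p = (\<Sum>x\<in>UNIV. t x * ln (t x / p x))"

definition prob_vec :: "('a::finite \<Rightarrow> real) \<Rightarrow> bool" where
  "prob_vec t \<longleftrightarrow> (\<forall>x. 0 \<le> t x) \<and> sum t UNIV = 1"

definition word_weight :: "('a \<Rightarrow> real) \<Rightarrow> 'a list \<Rightarrow> real" where
  "word_weight p zs = prod_list (map p zs)"

lemma word_weight_nonneg: "(\<And>x. 0 \<le> p x) \<Longrightarrow> 0 \<le> word_weight p zs"
  by (induction zs) (auto simp: word_weight_def)

lemma word_weight_zero: "z \<in> set zs \<Longrightarrow> p z = 0 \<Longrightarrow> word_weight p zs = 0"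
  by (induction zs) (auto simp: word_weight_def)

lemma finite_words: "finite {zs :: 'a::finite list. length zs = n}"
  using finite_lists_length_eq[of "UNIV :: 'a set" n] by simp

lemma sum_word_weight:
  fixes p :: "'a::finite \<Rightarrow> real"
  shows "(\<Sum>zs | length zs = n. word_weight p zs) = (sum p UNIV) ^ n"
proof (induction n)
  case 0
  have "{zs :: 'a list. length zs = 0} = {[]}" by auto
  then show ?case by (simp add: word_weight_def)
next
  case (Suc n)
  have "{zs :: 'a list. length zs = Suc n} = (\<lambda>(x, xs). x # xs) ` (UNIV \<times> {zs. length zs = n})"
    by (auto simp: image_iff length_Suc_conv)
  moreover have "inj_on (\<lambda>(x, xs). x # xs) (UNIV \<times> {zs :: 'a list. length zs = n})"
    by (auto simp: inj_on_def)
  ultimately have "(\<Sum>zs :: 'a list | length zs = Suc n. word_weight p zs)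
      = (\<Sum>z\<in>UNIV \<times> {zs. length zs = n}. word_weight p (case z of (x, xs) \<Rightarrow> x # xs))"
    by (simp only: sum.reindex o_def)
  also have "\<dots> = (\<Sum>(x, xs)\<in>UNIV \<times> {zs. length zs = n}. p x * word_weight p xs)"
    by (intro sum.cong refl) (auto simp: word_weight_def)
  also have "\<dots> = sum p UNIV * (\<Sum>zs | length zs = n. word_weight p zs)"
    by (simp add: sum.cartesian_product[symmetric] sum_product)
  finally show ?case using Suc by simp
qed

lemma pmf_replicate_pmf:
  "pmf (replicate_pmf n P) zs = (if length zs = n then word_weight (pmf P) zs else 0)"
proof (induction n arbitrary: zs)
  case 0
  then show ?case by (auto simp: word_weight_def pmf_return)
next
  case (Suc n)
  have eq: "replicate_pmf (Suc n) P = map_pmf (\<lambda>(x, xs). x # xs) (pair_pmf P (replicate_pmf n P))"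
    by (simp add: pair_pmf_def map_bind_pmf bind_return_pmf)
  show ?case
  proof (cases zs)
    case Nil
    then have "zs \<notin> set_pmf (replicate_pmf (Suc n) P)" unfolding eq by auto
    then show ?thesis using Nil by (simp add: set_pmf_iff word_weight_def del: replicate_pmf.simps)
  next
    case (Cons z xs)
    have "pmf (replicate_pmf (Suc n) P) zs = pmf (pair_pmf P (replicate_pmf n P)) (z, xs)"
      unfolding eq Cons by (rule pmf_map_inj'[of "\<lambda>(x, xs). x # xs" _ "(z, xs)", simplified])
        (auto simp: inj_on_def)
    then show ?thesis using Cons by (simp add: pmf_pair Suc word_weight_def)
  qed
qed

lemma emp_nonneg: "0 \<le> emp zs x"
  by (simp add: emp_def)

lemma sum_emp: "zs \<noteq> [] \<Longrightarrow> (\<Sum>x\<in>UNIV. emp zs x) = 1" for zs :: "'a::finite list"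
  using sum_count_set[of zs UNIV] by (simp add: emp_def sum_divide_distrib[symmetric] flip: of_nat_sum)

lemma emp_zero_iff: "zs \<noteq> [] \<Longrightarrow> emp zs x = 0 \<longleftrightarrow> x \<notin> set zs"
  by (simp add: emp_def count_list_0_iff)

lemma emp_pos: "x \<in> set zs \<Longrightarrow> 0 < emp zs x"
  using emp_nonneg[of zs x] emp_zero_iff[of zs x] by (cases "zs = []") (auto simp: order_le_less)

lemma word_weight_eq_prod_count:
  fixes zs :: "'a::finite list"
  shows "word_weight p zs = (\<Prod>x\<in>UNIV. p x ^ count_list zs x)"
proof (induction zs)
  case (Cons z zs)
  have "(\<Prod>x\<in>UNIV. p x ^ count_list (z # zs) x) = (\<Prod>x\<in>UNIV. (if x = z then p x else 1) * p x ^ count_list zs x)"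
    by (intro prod.cong refl) (auto simp: power_add)
  then show ?case using Cons by (simp add: word_weight_def prod.distrib)
qed (simp add: word_weight_def)

text \<open>Change of measure: the likelihood ratio of two product laws at a word depends only on
  the type of the word. With \<open>t\<close> the type itself it yields the upper bound on
  probabilities, with \<open>t\<close> a target point the lower bound.\<close>

lemma word_weight_tilt:
  fixes zs :: "'a::finite list"
  assumes "\<And>x. x \<in> set zs \<Longrightarrow> 0 < p x \<and> 0 < t x"
  shows "word_weight p zs = word_weight t zs * exp (- real (length zs) * (\<Sum>x\<in>UNIV. emp zs x * ln (t x / p x)))"
proof -
  have "real (length zs) * (\<Sum>x\<in>UNIV. emp zs x * ln (t x / p x)) = (\<Sum>x\<in>UNIV. real (count_list zs x) * ln (t x / p x))"
    unfolding sum_distrib_left by (intro sum.cong refl) (auto simp: emp_def)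
  then have "word_weight t zs * exp (- real (length zs) * (\<Sum>x\<in>UNIV. emp zs x * ln (t x / p x)))
     = (\<Prod>x\<in>UNIV. t x ^ count_list zs x * exp (- (real (count_list zs x) * ln (t x / p x))))"
    by (simp add: word_weight_eq_prod_count prod.distrib exp_sum sum_negf[symmetric])
  also have "\<dots> = (\<Prod>x\<in>UNIV. p x ^ count_list zs x)"
  proof (intro prod.cong refl)
    fix x
    show "t x ^ count_list zs x * exp (- (real (count_list zs x) * ln (t x / p x))) = p x ^ count_list zs x"
    proof (cases "x \<in> set zs")
      case True
      then have pos: "0 < p x" "0 < t x" using assms by auto
      have "exp (- (real (count_list zs x) * ln (t x / p x))) = exp (- ln (t x / p x)) ^ count_list zs x"
        by (simp add: exp_of_nat_mult[symmetric])
      also have "exp (- ln (t x / p x)) = p x / t x" using pos by (simp add: exp_minus)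
      finally show ?thesis using pos by (simp add: power_divide)
    next
      case False
      then show ?thesis by (simp add: count_list_0_iff)
    qed
  qed
  finally show ?thesis by (simp add: word_weight_eq_prod_count)
qed

text \<open>Under the product of its own type a type class has mass at most 1, so the sum is at most
  the number of types, and a type is determined by counts between 0 and \<open>n\<close>.\<close>

lemma sum_word_weight_emp_le:
  "(\<Sum>zs :: 'a::finite list | length zs = n. word_weight (emp zs) zs) \<le> (real n + 1) ^ CARD('a)"
proof -
  let ?L = "{zs :: 'a list. length zs = n}"
  have "(\<Sum>zs\<in>?L. word_weight (emp zs) zs) = (\<Sum>T\<in>emp ` ?L. \<Sum>zs | zs \<in> ?L \<and> emp zs = T. word_weight (emp zs) zs)"
    by (rule sum.image_gen[OF finite_words])
  also have "\<dots> \<le> (\<Sum>T\<in>emp ` ?L. 1)"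
  proof (intro sum_mono)
    fix T assume "T \<in> emp ` ?L"
    then obtain ys :: "'a list" where ys: "length ys = n" "T = emp ys" by auto
    have T0: "\<And>x. 0 \<le> T x" using ys emp_nonneg by auto
    have "(\<Sum>zs | zs \<in> ?L \<and> emp zs = T. word_weight (emp zs) zs) = (\<Sum>zs | zs \<in> ?L \<and> emp zs = T. word_weight T zs)"
      by (intro sum.cong refl) auto
    also have "\<dots> \<le> (\<Sum>zs\<in>?L. word_weight T zs)"
      by (intro sum_mono2 finite_words word_weight_nonneg T0) auto
    also have "\<dots> = sum T UNIV ^ n" by (rule sum_word_weight)
    \<comment> \<open>For \<open>n = 0\<close> the vector \<open>T\<close> is zero and not a
      probability vector, but its total is then raised to the power 0.\<close>
    also have "\<dots> = 1" using ys sum_emp[of ys] by (cases "n = 0") auto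
    finally show "(\<Sum>zs | zs \<in> ?L \<and> emp zs = T. word_weight (emp zs) zs) \<le> 1" .
  qed
  also have "\<dots> = real (card (emp ` ?L))" by simp
  also have "card (emp ` ?L) \<le> card (count_list ` ?L)"
  proof -
    have "emp ` ?L = (\<lambda>f x. real (f x) / real n) ` count_list ` ?L"
      by (auto simp: emp_def image_iff fun_eq_iff)
    then show ?thesis using card_image_le[OF finite_imageI[OF finite_words]] by metis
  qed
  also have "card (count_list ` ?L) \<le> card (PiE (UNIV :: 'a set) (\<lambda>_. {..n}))"
    by (intro card_mono finite_PiE) (auto simp: PiE_def Pi_def count_le_length)
  also have "card (PiE (UNIV :: 'a set) (\<lambda>_. {..n})) = (n + 1) ^ CARD('a)"
    by (simp add: card_PiE flip: Suc_eq_plus1)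
  finally show ?thesis by (simp add: algebra_simps)
qed

text \<open>Pinsker by way of the Hellinger distance: \<open>ln s \<le> s - 1\<close> at the ratio
  of the square roots \<open>v\<close> and \<open>u\<close> bounds each term, corrected by
  \<open>- t x + p x\<close>, below by \<open>(u - v)^2\<close>; the factor 4 is the bound on
  \<open>(u + v)^2\<close>.\<close>

lemma KL_ge_square:
  fixes t p :: "'a::finite \<Rightarrow> real"
  assumes t: "prob_vec t" and p: "prob_vec p" and ac: "\<And>x. p x = 0 \<Longrightarrow> t x = 0"
  shows "(\<Sum>x\<in>UNIV. (t x - p x)\<^sup>2) \<le> 4 * KL t p"
proof -
  have le1: "f x \<le> 1" if "prob_vec f" for f :: "'a \<Rightarrow> real" and x
    using that member_le_sum[of x UNIV f] by (auto simp: prob_vec_def)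
  have "(t x - p x)\<^sup>2 \<le> 4 * (t x * ln (t x / p x) - t x + p x)" for x
  proof (cases "t x = 0")
    case True
    have "0 \<le> p x" "p x \<le> 1" using p le1[OF p] by (auto simp: prob_vec_def)
    then have "(p x)\<^sup>2 \<le> p x" by (simp add: power2_eq_square mult_left_le_one_le)
    then show ?thesis using True \<open>0 \<le> p x\<close> by simp
  next
    case False
    then have pos: "0 < t x" "0 < p x" using t p ac[of x] by (auto simp: prob_vec_def order_le_less)
    define u where "u = sqrt (t x)" define v where "v = sqrt (p x)"
    have uv: "0 < u" "0 < v" "t x = u\<^sup>2" "p x = v\<^sup>2" using pos by (auto simp: u_def v_def)
    have "u \<le> 1" "v \<le> 1" using le1[OF t, of x] le1[OF p, of x] by (auto simp: u_def v_def)
    have "ln (v / u) \<le> v / u - 1" using uv by (intro ln_le_minus_one) auto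
    then have "ln (t x / p x) \<ge> 2 * (1 - v / u)"
      using uv by (simp add: ln_div ln_realpow)
    then have "u\<^sup>2 * ln (t x / p x) \<ge> u\<^sup>2 * (2 * (1 - v / u))"
      by (intro mult_left_mono) auto
    moreover have "u\<^sup>2 * (2 * (1 - v / u)) = 2 * u\<^sup>2 - 2 * u * v"
      using uv by (simp add: power2_eq_square field_simps)
    ultimately have "2 * u\<^sup>2 - 2 * u * v \<le> t x * ln (t x / p x)"
      by (metis uv(3))
    then have 1: "t x * ln (t x / p x) - t x + p x \<ge> (u - v)\<^sup>2"
      unfolding power2_diff using uv(3,4) by linarith
    have "(t x - p x)\<^sup>2 = (u - v)\<^sup>2 * (u + v)\<^sup>2"
      using uv by (simp add: power2_eq_square algebra_simps)
    also have "\<dots> \<le> (u - v)\<^sup>2 * 2\<^sup>2"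
      using \<open>u \<le> 1\<close> \<open>v \<le> 1\<close> uv by (intro mult_left_mono power_mono) auto
    finally show ?thesis using 1 by simp
  qed
  then have "(\<Sum>x\<in>UNIV. (t x - p x)\<^sup>2) \<le> (\<Sum>x\<in>UNIV. 4 * (t x * ln (t x / p x) - t x + p x))"
    by (rule sum_mono)
  also have "\<dots> = 4 * KL t p"
    using t p by (simp add: sum_distrib_left[symmetric] sum.distrib sum_subtractf KL_def prob_vec_def)
  finally show ?thesis .
qed

type_synonym ('a, 'b) type_pair = "(real^'a) \<times> (real^'b)"

definition rate :: "real \<Rightarrow> ('a::finite \<Rightarrow> real) \<Rightarrow> ('b::finite \<Rightarrow> real) \<Rightarrow> ('a, 'b) type_pair \<Rightarrow> real" where
  "rate r p q w = KL (($) (fst w)) p + r * KL (($) (snd w)) q"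

text \<open>The last conjunct fixes the component that carries no information when there are no
  samples of the second kind.\<close>

definition rate_domain :: "real \<Rightarrow> ('a::finite \<Rightarrow> real) \<Rightarrow> ('b::finite \<Rightarrow> real) \<Rightarrow> ('a, 'b) type_pair set" where
  "rate_domain r p q = {w. prob_vec (($) (fst w)) \<and> prob_vec (($) (snd w)) \<and>
     (\<forall>x. p x = 0 \<longrightarrow> fst w $ x = 0) \<and> (\<forall>x. q x = 0 \<longrightarrow> snd w $ x = 0) \<and>
     (r = 0 \<longrightarrow> (\<forall>x. snd w $ x = q x))}"

text \<open>The empty word has \<open>emp us = 0\<close>, which is no probability vector;
  \<open>q\<close> takes its place, in accordance with \<open>rate_domain\<close> for
  \<open>r = 0\<close>, and contributes nothing to the rate.\<close>

definition types :: "('b::finite \<Rightarrow> real) \<Rightarrow> 'a::finite list \<Rightarrow> 'b list \<Rightarrow> ('a, 'b) type_pair" where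
  "types q zs us = (vec_lambda (emp zs), if us = [] then vec_lambda q else vec_lambda (emp us))"

definition sample_pair :: "real \<Rightarrow> 'a list \<Rightarrow> 'b list \<Rightarrow> bool" where
  "sample_pair r zs us \<longleftrightarrow> zs \<noteq> [] \<and> real (length us) = real (length zs) * r"

lemma vec_nth_vec_lambda [simp]: "($) (vec_lambda f) = f"
  by (simp add: fun_eq_iff)

lemma prob_vec_emp: "ys \<noteq> [] \<Longrightarrow> prob_vec (emp ys)"
  by (simp add: prob_vec_def emp_nonneg sum_emp)

lemma types_in_rate_domain:
  fixes zs :: "'a::finite list" and us :: "'b::finite list"
  assumes "sample_pair r zs us" "prob_vec q"
    and "\<And>x. x \<in> set zs \<Longrightarrow> p x \<noteq> 0" "\<And>x. x \<in> set us \<Longrightarrow> q x \<noteq> 0"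
  shows "types q zs us \<in> rate_domain r p q"
  using assms emp_zero_iff[of zs] emp_zero_iff[of us]
  by (auto simp: rate_domain_def types_def sample_pair_def prob_vec_emp)

lemma weight_types:
  fixes zs :: "'a::finite list" and us :: "'b::finite list"
  assumes s: "sample_pair r zs us"
    and p: "\<And>x. x \<in> set zs \<Longrightarrow> 0 < p x" and q: "\<And>x. x \<in> set us \<Longrightarrow> 0 < q x"
  shows "word_weight p zs * word_weight q us =
    word_weight (emp zs) zs * word_weight (emp us) us * exp (- real (length zs) * rate r p q (types q zs us))"
proof -
  have "real (length zs) * rate r p q (types q zs us) =
      real (length zs) * (\<Sum>x\<in>UNIV. emp zs x * ln (emp zs x / p x))
      + real (length us) * (\<Sum>x\<in>UNIV. emp us x * ln (emp us x / q x))"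
  proof (cases "us = []")
    case True
    then have "r = 0" using s by (auto simp: sample_pair_def)
    then show ?thesis using True by (simp add: rate_def types_def KL_def)
  next
    case False
    then show ?thesis using s by (simp add: rate_def types_def KL_def sample_pair_def algebra_simps)
  qed
  moreover have "word_weight p zs = word_weight (emp zs) zs * exp (- real (length zs) * (\<Sum>x\<in>UNIV. emp zs x * ln (emp zs x / p x)))"
    using p emp_pos by (intro word_weight_tilt) auto
  moreover have "word_weight q us = word_weight (emp us) us * exp (- real (length us) * (\<Sum>x\<in>UNIV. emp us x * ln (emp us x / q x)))"
    using q emp_pos by (intro word_weight_tilt) auto
  moreover have "exp (- (a + b)) = exp (- a) * exp (- b)" for a b :: real
    by (simp add: exp_add[symmetric])
  ultimately show ?thesis by (simp add: mult_ac)
qed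

text \<open>A finite sum over arbitrary weight vectors rather than a probability, so that it also
  applies to the tilted laws of the lower bound, which are given as vectors and not as a
  \<open>pmf\<close>.\<close>

definition pair_mass :: "('a::finite \<Rightarrow> real) \<Rightarrow> ('b::finite \<Rightarrow> real) \<Rightarrow> nat \<Rightarrow> nat \<Rightarrow> ('a list \<times> 'b list) set \<Rightarrow> real" where
  "pair_mass p q n m S = (\<Sum>(zs, us)\<in>{zs. length zs = n} \<times> {us. length us = m}.
      of_bool ((zs, us) \<in> S) * (word_weight p zs * word_weight q us))"

lemma pair_mass_UNIV:
  assumes "prob_vec p" "prob_vec q"
  shows "pair_mass p q n m UNIV = 1"
  using assms sum_word_weight[of p n] sum_word_weight[of q m]
  by (simp add: pair_mass_def sum.cartesian_product[symmetric] sum_product[symmetric] prob_vec_def)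

lemma pair_mass_Compl:
  "pair_mass p q n m S + pair_mass p q n m (- S) = pair_mass p q n m UNIV"
  unfolding pair_mass_def sum.distrib[symmetric] by (intro sum.cong refl) auto

lemma prob_eq_pair_mass:
  fixes P :: "'a::finite pmf" and Q :: "'b::finite pmf"
  shows "measure_pmf.prob (pair_pmf (replicate_pmf n P) (replicate_pmf m Q)) S = pair_mass (pmf P) (pmf Q) n m S"
proof -
  let ?M = "pair_pmf (replicate_pmf n P) (replicate_pmf m Q)"
  let ?L = "{zs :: 'a list. length zs = n} \<times> {us :: 'b list. length us = m}"
  have fin: "finite ?L" by (intro finite_cartesian_product finite_words)
  have sub: "set_pmf ?M \<subseteq> ?L" by (auto simp: set_replicate_pmf)
  have "measure_pmf.prob ?M S = measure_pmf.prob ?M (S \<inter> ?L)"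
    using sub by (intro measure_pmf.finite_measure_eq_AE) (auto simp: AE_measure_pmf_iff)
  also have "\<dots> = (\<Sum>z\<in>S \<inter> ?L. pmf ?M z)"
    using fin by (intro measure_measure_pmf_finite) auto
  also have "\<dots> = (\<Sum>z\<in>?L. of_bool (z \<in> S) * pmf ?M z)"
    using fin by (intro sum.mono_neutral_cong_left) auto
  also have "\<dots> = pair_mass (pmf P) (pmf Q) n m S"
    unfolding pair_mass_def
    by (intro sum.cong refl) (auto simp: pmf_pair pmf_replicate_pmf)
  finally show ?thesis .
qed

definition type_bound :: "'a::finite itself \<Rightarrow> 'b::finite itself \<Rightarrow> nat \<Rightarrow> nat \<Rightarrow> real" where
  "type_bound A B n m = (real n + 1) ^ CARD('a) * (real m + 1) ^ CARD('b)"

text \<open>Once each word is tilted to its own type, only the rate is left in the exponent and the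
  remaining weights sum to at most the number of pairs of types. Words with a letter of probability
  0 weigh nothing, so the hypothesis on \<open>S\<close> may exclude them.\<close>

lemma pair_mass_upper:
  fixes p :: "'a::finite \<Rightarrow> real" and q :: "'b::finite \<Rightarrow> real"
  assumes n: "0 < n" "real m = real n * r" and p: "\<And>x. 0 \<le> p x" and q: "\<And>x. 0 \<le> q x"
    and S: "\<And>zs us. (zs, us) \<in> S \<Longrightarrow> sample_pair r zs us \<Longrightarrow> (\<And>x. x \<in> set zs \<Longrightarrow> p x \<noteq> 0) \<Longrightarrow>
       (\<And>x. x \<in> set us \<Longrightarrow> q x \<noteq> 0) \<Longrightarrow> I \<le> rate r p q (types q zs us)"
  shows "pair_mass p q n m S \<le> type_bound TYPE('a) TYPE('b) n m * exp (- real n * I)"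
proof -
  let ?L = "{zs :: 'a list. length zs = n} \<times> {us :: 'b list. length us = m}"
  have "pair_mass p q n m S \<le> (\<Sum>(zs, us)\<in>?L. word_weight (emp zs) zs * word_weight (emp us) us * exp (- real n * I))"
    unfolding pair_mass_def
  proof (intro sum_mono, clarify)
    fix zs :: "'a list" and us :: "'b list" assume l: "n = length zs" "m = length us"
    have nn: "0 \<le> word_weight (emp zs) zs * word_weight (emp us) us"
      by (intro mult_nonneg_nonneg word_weight_nonneg emp_nonneg)
    show "of_bool ((zs, us) \<in> S) * (word_weight p zs * word_weight q us)
        \<le> word_weight (emp zs) zs * word_weight (emp us) us * exp (- real (length zs) * I)"
    proof (cases "(zs, us) \<in> S \<and> (\<forall>x\<in>set zs. p x \<noteq> 0) \<and> (\<forall>x\<in>set us. q x \<noteq> 0)")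
      case True
      then have s: "sample_pair r zs us" using n l by (auto simp: sample_pair_def)
      have "I \<le> rate r p q (types q zs us)" using S s True by blast
      moreover have "word_weight p zs * word_weight q us =
        word_weight (emp zs) zs * word_weight (emp us) us * exp (- real (length zs) * rate r p q (types q zs us))"
        using True p q by (intro weight_types s) (metis order_le_less)+
      ultimately show ?thesis using True nn
        by (auto intro!: mult_left_mono)
    next
      case False
      then have "of_bool ((zs, us) \<in> S) * (word_weight p zs * word_weight q us) = 0"
        using word_weight_zero[of _ zs p] word_weight_zero[of _ us q] by auto
      then show ?thesis using nn by (metis mult_nonneg_nonneg exp_ge_zero)
    qed
  qed
  also have "\<dots> = (\<Sum>zs :: 'a list | length zs = n. word_weight (emp zs) zs) * (\<Sum>us :: 'b list | length us = m. word_weight (emp us) us) * exp (- real n * I)"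
    by (simp add: sum.cartesian_product[symmetric] sum_distrib_left[symmetric] sum_distrib_right[symmetric] mult.assoc)
  also have "\<dots> \<le> type_bound TYPE('a) TYPE('b) n m * exp (- real n * I)"
    unfolding type_bound_def
    by (intro mult_right_mono mult_mono sum_word_weight_emp_le sum_nonneg word_weight_nonneg emp_nonneg) auto
  finally show ?thesis .
qed

text \<open>Coercivity of the rate, from \<open>KL_ge_square\<close>. For \<open>r = 0\<close> the
  second divergence has no weight, but the domain then pins that component to \<open>q\<close>, so
  the constant stays positive.\<close>

lemma rate_ge_square:
  assumes p: "prob_vec p" and q: "prob_vec q" and r: "0 \<le> r" and w: "w \<in> rate_domain r p q"
  shows "(if r = 0 then 1/4 else min 1 r / 4) * (dist w (vec_lambda p, vec_lambda q))\<^sup>2 \<le> rate r p q w"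
proof -
  define A where "A = (\<Sum>x\<in>UNIV. (fst w $ x - p x)\<^sup>2)"
  define B where "B = (\<Sum>x\<in>UNIV. (snd w $ x - q x)\<^sup>2)"
  have "(dist w (vec_lambda p, vec_lambda q))\<^sup>2 = A + B"
    by (simp add: dist_prod_def dist_vec_def L2_set_def dist_real_def sum_nonneg A_def B_def)
  moreover have "A \<le> 4 * KL (($) (fst w)) p" "B \<le> 4 * KL (($) (snd w)) q"
    unfolding A_def B_def using w p q by (auto intro!: KL_ge_square simp: rate_domain_def)
  moreover have "0 \<le> A" "0 \<le> B" by (auto simp: A_def B_def intro: sum_nonneg)
  moreover have "r = 0 \<Longrightarrow> B = 0" using w by (auto simp: rate_domain_def B_def)
  moreover have "min 1 r * A \<le> A" "min 1 r * B \<le> r * B" if "r \<noteq> 0"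
    using \<open>0 \<le> A\<close> \<open>0 \<le> B\<close> r mult_right_mono[of "min 1 r" 1 A] mult_right_mono[of "min 1 r" r B] by auto
  moreover have "r * B \<le> r * (4 * KL (($) (snd w)) q)" using r calculation by (intro mult_left_mono)
  ultimately show ?thesis
    by (auto simp: rate_def algebra_simps)
qed

lemma sum_mult_perturb:
  fixes f g h :: "'c::finite \<Rightarrow> real"
  assumes "\<And>x. \<bar>f x - h x\<bar> \<le> \<delta>"
  shows "(\<Sum>x\<in>UNIV. f x * g x) \<le> (\<Sum>x\<in>UNIV. h x * g x) + \<delta> * (\<Sum>x\<in>UNIV. \<bar>g x\<bar>)"
proof -
  have "(\<Sum>x\<in>UNIV. f x * g x) = (\<Sum>x\<in>UNIV. h x * g x + (f x - h x) * g x)"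
    by (intro sum.cong refl) (simp add: algebra_simps)
  also have "\<dots> \<le> (\<Sum>x\<in>UNIV. h x * g x + \<delta> * \<bar>g x\<bar>)"
  proof (intro sum_mono add_left_mono)
    fix x have "(f x - h x) * g x \<le> \<bar>f x - h x\<bar> * \<bar>g x\<bar>" by (metis abs_ge_self abs_mult)
    also have "\<dots> \<le> \<delta> * \<bar>g x\<bar>" using assms by (intro mult_right_mono) auto
    finally show "(f x - h x) * g x \<le> \<delta> * \<bar>g x\<bar>" .
  qed
  finally show ?thesis by (simp add: sum.distrib sum_distrib_left)
qed

text \<open>Under the product laws given by \<open>w\<close> the types concentrate at
  \<open>w\<close>, by \<open>pair_mass_upper\<close> for the complement with the rate relative to
  \<open>w\<close> itself; on the ball of radius \<open>\<delta>\<close> the exponent of the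
  likelihood ratio changes by at most \<open>\<delta>\<close> times the sums of logarithms. Thus
  \<open>w\<close> need not be a pair of types.\<close>

lemma pair_mass_lower:
  fixes p :: "'a::finite \<Rightarrow> real" and q :: "'b::finite \<Rightarrow> real"
  assumes n: "0 < n" "real m = real n * r" and r: "0 \<le> r" and p: "prob_vec p" and q: "prob_vec q"
    and w: "w \<in> rate_domain r p q" and \<delta>: "0 < \<delta>"
    and S: "\<And>zs us. sample_pair r zs us \<Longrightarrow> dist (types q zs us) w < \<delta> \<Longrightarrow> (zs, us) \<in> S"
  shows "exp (- real n * (rate r p q w + \<delta> * ((\<Sum>x\<in>UNIV. \<bar>ln (fst w $ x / p x)\<bar>) + r * (\<Sum>x\<in>UNIV. \<bar>ln (snd w $ x / q x)\<bar>))))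
      * (1 - type_bound TYPE('a) TYPE('b) n m * exp (- real n * ((if r = 0 then 1/4 else min 1 r / 4) * \<delta>\<^sup>2)))
    \<le> pair_mass p q n m S"
proof -
  define t where "t = ($) (fst w)"
  define s where "s = ($) (snd w)"
  define Kt where "Kt = (\<Sum>x\<in>UNIV. \<bar>ln (t x / p x)\<bar>)"
  define Ks where "Ks = (\<Sum>x\<in>UNIV. \<bar>ln (s x / q x)\<bar>)"
  define \<kappa> where "\<kappa> = (if r = 0 then 1/4 else min 1 r / 4)"
  \<comment> \<open>The support conditions make \<open>word_weight_tilt\<close> applicable; words
    that violate them have no weight under the tilted laws.\<close>
  define G where "G = {(zs, us). (\<forall>x\<in>set zs. t x \<noteq> 0) \<and> (\<forall>x\<in>set us. s x \<noteq> 0) \<and> dist (types q zs us) w < \<delta>}"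
  have ts: "prob_vec t" "prob_vec s" and tp: "\<And>x. p x = 0 \<Longrightarrow> t x = 0" and sq: "\<And>x. q x = 0 \<Longrightarrow> s x = 0"
    and s0: "r = 0 \<Longrightarrow> s = q"
    using w by (auto simp: rate_domain_def t_def s_def)
  have w_eq: "w = (vec_lambda t, vec_lambda s)"
    by (simp add: t_def s_def prod_eq_iff)
  have \<kappa>: "0 \<le> \<kappa>" using r by (simp add: \<kappa>_def)
  have "pair_mass t s n m (- G) \<le> type_bound TYPE('a) TYPE('b) n m * exp (- real n * (\<kappa> * \<delta>\<^sup>2))"
  proof (rule pair_mass_upper[OF n])
    fix zs :: "'a list" and us :: "'b list"
    assume zu: "(zs, us) \<in> - G" "sample_pair r zs us" "\<And>x. x \<in> set zs \<Longrightarrow> t x \<noteq> 0" "\<And>x. x \<in> set us \<Longrightarrow> s x \<noteq> 0"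
    have same: "types s zs us = types q zs us"
      using zu(2) s0 by (auto simp: types_def sample_pair_def)
    have "\<kappa> * \<delta>\<^sup>2 \<le> \<kappa> * (dist (types s zs us) w)\<^sup>2"
      using zu \<delta> same \<kappa> by (intro mult_left_mono power_mono) (auto simp: G_def)
    also have "\<dots> \<le> rate r t s (types s zs us)"
      unfolding w_eq \<kappa>_def using zu ts r by (intro rate_ge_square types_in_rate_domain) auto
    finally show "\<kappa> * \<delta>\<^sup>2 \<le> rate r t s (types s zs us)" .
  qed (use ts in \<open>auto simp: prob_vec_def\<close>)
  then have 1: "1 - type_bound TYPE('a) TYPE('b) n m * exp (- real n * (\<kappa> * \<delta>\<^sup>2)) \<le> pair_mass t s n m G"
    using pair_mass_Compl[of t s n m G] pair_mass_UNIV[OF ts] by simp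
  have "exp (- real n * (rate r p q w + \<delta> * (Kt + r * Ks))) * pair_mass t s n m G \<le> pair_mass p q n m S"
    unfolding pair_mass_def sum_distrib_left
  proof (intro sum_mono, clarify)
    fix zs :: "'a list" and us :: "'b list" assume l: "n = length zs" "m = length us"
    have nn: "0 \<le> word_weight p zs * word_weight q us" "0 \<le> word_weight t zs * word_weight s us"
      using p q ts by (auto intro!: mult_nonneg_nonneg word_weight_nonneg simp: prob_vec_def)
    have sp: "sample_pair r zs us" using n l by (auto simp: sample_pair_def)
    show "exp (- real (length zs) * (rate r p q w + \<delta> * (Kt + r * Ks))) *
        (of_bool ((zs, us) \<in> G) * (word_weight t zs * word_weight s us))
        \<le> of_bool ((zs, us) \<in> S) * (word_weight p zs * word_weight q us)"
    proof (cases "(zs, us) \<in> G")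
      case True
      then have inS: "(zs, us) \<in> S" using S[OF sp] by (auto simp: G_def)
      have d: "dist (types q zs us) w < \<delta>" using True by (simp add: G_def)
      have dz: "\<bar>emp zs x - t x\<bar> \<le> \<delta>" for x
      proof -
        have "\<bar>emp zs x - t x\<bar> \<le> norm (fst (types q zs us) - fst w)"
          using component_le_norm_cart[of "fst (types q zs us) - fst w" x] by (simp add: types_def t_def)
        also have "\<dots> \<le> dist (types q zs us) w" using dist_fst_le[of "types q zs us" w] by (simp only: dist_norm)
        finally show ?thesis using d by simp
      qed
      have du: "\<bar>emp us x - s x\<bar> \<le> \<delta>" if "us \<noteq> []" for x
      proof -
        have "\<bar>emp us x - s x\<bar> \<le> norm (snd (types q zs us) - snd w)"
          using component_le_norm_cart[of "snd (types q zs us) - snd w" x] that by (simp add: types_def s_def)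
        also have "\<dots> \<le> dist (types q zs us) w" using dist_snd_le[of "types q zs us" w] by (simp only: dist_norm)
        finally show ?thesis using d by simp
      qed
      define Dz where "Dz = (\<Sum>x\<in>UNIV. emp zs x * ln (t x / p x))"
      define Du where "Du = (\<Sum>x\<in>UNIV. emp us x * ln (s x / q x))"
      have "real (length zs) * Dz + real (length us) * Du \<le> real (length zs) * (rate r p q w + \<delta> * (Kt + r * Ks))"
      proof -
        have "Dz \<le> KL t p + \<delta> * Kt" unfolding Dz_def KL_def Kt_def by (rule sum_mult_perturb[OF dz])
        then have a: "real (length zs) * Dz \<le> real (length zs) * (KL t p + \<delta> * Kt)" by (intro mult_left_mono) auto
        have b: "real (length us) * Du \<le> real (length us) * (KL s q + \<delta> * Ks)"
        proof (cases "us = []")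
          case False
          then have "Du \<le> KL s q + \<delta> * Ks" unfolding Du_def KL_def Ks_def by (intro sum_mult_perturb du)
          then show ?thesis by (intro mult_left_mono) auto
        qed simp
        have "real (length us) = real (length zs) * r" using sp by (simp add: sample_pair_def)
        with a b show ?thesis by (simp add: rate_def t_def[symmetric] s_def[symmetric] algebra_simps)
      qed
      then have "exp (- real (length zs) * (rate r p q w + \<delta> * (Kt + r * Ks)))
        \<le> exp (- real (length zs) * Dz) * exp (- real (length us) * Du)"
        by (simp add: exp_add[symmetric])
      then have "exp (- real (length zs) * (rate r p q w + \<delta> * (Kt + r * Ks))) * (word_weight t zs * word_weight s us)
         \<le> exp (- real (length zs) * Dz) * exp (- real (length us) * Du) * (word_weight t zs * word_weight s us)"
        using nn(2) by (rule mult_right_mono)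
      also have "\<dots> = word_weight p zs * word_weight q us"
      proof -
        have "0 < p x \<and> 0 < t x" if "x \<in> set zs" for x
          using True that tp[of x] p ts by (auto simp: G_def prob_vec_def order_le_less)
        moreover have "0 < q x \<and> 0 < s x" if "x \<in> set us" for x
          using True that sq[of x] q ts by (auto simp: G_def prob_vec_def order_le_less)
        ultimately show ?thesis
          using word_weight_tilt[of zs p t] word_weight_tilt[of us q s] by (simp add: Dz_def Du_def)
      qed
      finally show ?thesis using True inS by simp
    next
      case False
      then show ?thesis using nn by simp
    qed
  qed
  moreover have "exp (- real n * (rate r p q w + \<delta> * (Kt + r * Ks))) *
        (1 - type_bound TYPE('a) TYPE('b) n m * exp (- real n * (\<kappa> * \<delta>\<^sup>2)))
      \<le> exp (- real n * (rate r p q w + \<delta> * (Kt + r * Ks))) * pair_mass t s n m G"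
    using 1 by (intro mult_left_mono) auto
  ultimately show ?thesis unfolding Kt_def Ks_def t_def s_def \<kappa>_def by (rule order_trans[rotated])
qed

text \<open>The hypotheses compare the event with sublevel sets of the rate only at pairs of types, so
  no closure or interior enters and the limit exists without a regularity condition on \<open>S\<close>.\<close>

lemma pair_Sanov:
  fixes P :: "'a::finite pmf" and Q :: "'b::finite pmf"
  assumes r: "0 \<le> r"
    and upper: "\<And>zs us. (zs, us) \<in> S \<Longrightarrow> sample_pair r zs us \<Longrightarrow>
      types (pmf Q) zs us \<in> rate_domain r (pmf P) (pmf Q) \<Longrightarrow> I \<le> rate r (pmf P) (pmf Q) (types (pmf Q) zs us)"
    and lower: "\<And>\<eta>. 0 < \<eta> \<Longrightarrow> \<exists>w\<in>rate_domain r (pmf P) (pmf Q). rate r (pmf P) (pmf Q) w < I + \<eta> \<and>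
      (\<exists>\<delta>>0. \<forall>zs us. sample_pair r zs us \<longrightarrow> dist (types (pmf Q) zs us) w < \<delta> \<longrightarrow> (zs, us) \<in> S)"
  shows "((\<lambda>n. log_prob (measure_pmf.prob (pair_pmf (replicate_pmf n P) (replicate_pmf (nat \<lfloor>real n * r\<rfloor>) Q)) S) / ereal (real n))
    \<longlongrightarrow> ereal (- I)) (admissible_at_top r)"
proof -
  define prb where "prb n = measure_pmf.prob (pair_pmf (replicate_pmf n P) (replicate_pmf (nat \<lfloor>real n * r\<rfloor>) Q)) S" for n
  \<comment> \<open>The exponent per sample of the polynomial factor \<open>type_bound\<close>,
    using \<open>m + 1 \<le> (r + 1) * (n + 1)\<close>.\<close>
  define g where "g n = (real CARD('a) + real CARD('b)) * (ln (real n + 1) / real n) + real CARD('b) * ln (r + 1) / real n" for n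
  have pP: "prob_vec (pmf P)" and pQ: "prob_vec (pmf Q)"
    by (auto simp: prob_vec_def sum_pmf_eq_1)
  have g0: "g \<longlonglongrightarrow> 0"
  proof -
    have "(\<lambda>n. ln (real n + 1) / real n) \<longlonglongrightarrow> 0" by real_asymp
    moreover have "(\<lambda>n. real CARD('b) * ln (r + 1) / real n) \<longlonglongrightarrow> 0" by real_asymp
    ultimately have "g \<longlonglongrightarrow> (real CARD('a) + real CARD('b)) * 0 + 0"
      unfolding g_def by (intro tendsto_intros)
    then show ?thesis by simp
  qed
  have adm: "eventually R (admissible_at_top r)" if "eventually R sequentially" for R
    using that unfolding admissible_at_top_def by (rule filter_leD[OF inf_le1])
  have "eventually (\<lambda>n. real n * r \<in> \<nat>) (admissible_at_top r)"
    unfolding admissible_at_top_def by (rule filter_leD[OF inf_le2]) (simp add: eventually_principal)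
  with adm[OF eventually_gt_at_top[of 0]]
  have good: "eventually (\<lambda>n. 0 < n \<and> real (nat \<lfloor>real n * r\<rfloor>) = real n * r) (admissible_at_top r)"
    by eventually_elim (auto simp: Nats_def)
  have prb: "prb n = pair_mass (pmf P) (pmf Q) n (nat \<lfloor>real n * r\<rfloor>) S" for n
    by (simp add: prb_def prob_eq_pair_mass)
  have tb: "type_bound TYPE('a) TYPE('b) n m \<le> exp (real n * g n)" if n: "0 < n" "real m = real n * r" for n m
  proof -
    have "real m + 1 \<le> (r + 1) * (real n + 1)" using n r by (simp add: algebra_simps)
    then have "type_bound TYPE('a) TYPE('b) n m \<le> (real n + 1) ^ CARD('a) * ((r + 1) * (real n + 1)) ^ CARD('b)"
      unfolding type_bound_def using r by (intro mult_left_mono power_mono) auto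
    also have "\<dots> = exp (ln ((real n + 1) ^ CARD('a) * ((r + 1) * (real n + 1)) ^ CARD('b)))"
      using r by (subst exp_ln) auto
    also have "ln ((real n + 1) ^ CARD('a) * ((r + 1) * (real n + 1)) ^ CARD('b)) = real n * g n"
    proof -
      have "ln (u ^ i * (v * u) ^ j) = real i * ln u + real j * (ln v + ln u)" if "0 < u" "0 < v" for u v :: real and i j
        using that by (simp add: ln_mult ln_realpow)
      from this[of "real n + 1" "r + 1"] show ?thesis
        using r n by (simp add: g_def field_simps)
    qed
    finally show ?thesis .
  qed
  have up: "prb n \<le> exp (- real n * (I - g n))" if n: "0 < n" "real (nat \<lfloor>real n * r\<rfloor>) = real n * r" for n
  proof -
    have "prb n \<le> type_bound TYPE('a) TYPE('b) n (nat \<lfloor>real n * r\<rfloor>) * exp (- real n * I)"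
      unfolding prb
    proof (rule pair_mass_upper[OF n])
      fix zs :: "'a list" and us :: "'b list"
      assume "(zs, us) \<in> S" "sample_pair r zs us" "\<And>x. x \<in> set zs \<Longrightarrow> pmf P x \<noteq> 0" "\<And>x. x \<in> set us \<Longrightarrow> pmf Q x \<noteq> 0"
      then show "I \<le> rate r (pmf P) (pmf Q) (types (pmf Q) zs us)"
        using pQ by (intro upper types_in_rate_domain) auto
    qed auto
    also have "\<dots> \<le> exp (real n * g n) * exp (- real n * I)"
      using tb[OF n] by (intro mult_right_mono) auto
    finally show ?thesis by (simp add: exp_add[symmetric] algebra_simps)
  qed
  have low: "eventually (\<lambda>n. exp (- real n * (I + 2 * \<eta>)) / 2 \<le> prb n) (admissible_at_top r)" if \<eta>: "0 < \<eta>" for \<eta>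
  proof -
    obtain w \<delta>0 where w: "w \<in> rate_domain r (pmf P) (pmf Q)" "rate r (pmf P) (pmf Q) w < I + \<eta>" and \<delta>0: "0 < \<delta>0"
      and wS: "\<And>zs us. sample_pair r zs us \<Longrightarrow> dist (types (pmf Q) zs us) w < \<delta>0 \<Longrightarrow> (zs, us) \<in> S"
      using lower[OF \<eta>] by blast
    define K where "K = (\<Sum>x\<in>UNIV. \<bar>ln (fst w $ x / pmf P x)\<bar>) + r * (\<Sum>x\<in>UNIV. \<bar>ln (snd w $ x / pmf Q x)\<bar>)"
    have K: "0 \<le> K" unfolding K_def using r by (intro add_nonneg_nonneg mult_nonneg_nonneg sum_nonneg) auto
    \<comment> \<open>With this radius the logarithmic terms cost at most \<open>\<eta>\<close> in
      the exponent.\<close>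
    define \<delta> where "\<delta> = min \<delta>0 (\<eta> / (K + 1))"
    have \<delta>: "0 < \<delta>" "\<delta> \<le> \<delta>0" "\<delta> * K \<le> \<eta>"
    proof -
      have "\<delta> * K \<le> (\<eta> / (K + 1)) * K" using K by (intro mult_right_mono) (auto simp: \<delta>_def)
      also have "\<dots> \<le> \<eta>" using K \<eta> by (simp add: field_simps)
      finally show "\<delta> * K \<le> \<eta>" .
    qed (use \<delta>0 \<eta> K in \<open>auto simp: \<delta>_def\<close>)
    define \<kappa> where "\<kappa> = (if r = 0 then 1/4 else min 1 r / 4) * \<delta>\<^sup>2"
    have \<kappa>: "0 < \<kappa>" using r \<delta> by (auto simp: \<kappa>_def)
    \<comment> \<open>One half of \<open>\<kappa>\<close> absorbs the polynomial factor and the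
      other half beats \<open>ln 2\<close>, so at least half of the tilted mass lies in the
      ball.\<close>
    have "eventually (\<lambda>n. g n < \<kappa> / 2) sequentially" using g0 \<kappa> by (intro order_tendstoD(2)) auto
    moreover have "eventually (\<lambda>n. ln 2 \<le> real n * (\<kappa> / 2)) sequentially" using \<kappa> by real_asymp
    ultimately have "eventually (\<lambda>n. g n < \<kappa> / 2 \<and> ln 2 \<le> real n * (\<kappa> / 2)) sequentially"
      by eventually_elim auto
    from adm[OF this] good show ?thesis
    proof eventually_elim
      fix n assume a: "g n < \<kappa> / 2 \<and> ln 2 \<le> real n * (\<kappa> / 2)"
        and n: "0 < n \<and> real (nat \<lfloor>real n * r\<rfloor>) = real n * r"
      let ?m = "nat \<lfloor>real n * r\<rfloor>"
      have "type_bound TYPE('a) TYPE('b) n ?m * exp (- real n * \<kappa>) \<le> exp (real n * g n) * exp (- real n * \<kappa>)"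
        using tb n by (intro mult_right_mono) auto
      also have "\<dots> = exp (real n * (g n - \<kappa>))" by (simp add: exp_add[symmetric] algebra_simps)
      also have "\<dots> \<le> exp (- ln 2)"
      proof -
        have "real n * (g n - \<kappa>) \<le> real n * (- (\<kappa> / 2))" using a by (intro mult_left_mono) auto
        then show ?thesis using a by simp
      qed
      also have "\<dots> = 1 / 2" by (simp add: exp_minus)
      finally have half: "1 / 2 \<le> 1 - type_bound TYPE('a) TYPE('b) n ?m * exp (- real n * \<kappa>)" by simp
      have "exp (- real n * (I + 2 * \<eta>)) / 2 \<le> exp (- real n * (rate r (pmf P) (pmf Q) w + \<delta> * K)) * (1 / 2)"
        using w \<delta> n by (auto intro!: mult_left_mono)
      also have "\<dots> \<le> exp (- real n * (rate r (pmf P) (pmf Q) w + \<delta> * K)) * (1 - type_bound TYPE('a) TYPE('b) n ?m * exp (- real n * \<kappa>))"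
        using half by (intro mult_left_mono) auto
      also have "\<dots> \<le> prb n"
        unfolding prb K_def \<kappa>_def using n wS \<delta> by (intro pair_mass_lower r pP pQ w) auto
      finally show "exp (- real n * (I + 2 * \<eta>)) / 2 \<le> prb n" .
    qed
  qed
  have pos: "eventually (\<lambda>n. 0 < prb n) (admissible_at_top r)"
    using low[OF zero_less_one] by (rule eventually_mono) (metis exp_gt_zero half_gt_zero less_le_trans)
  have "((\<lambda>n. ln (prb n) / real n) \<longlongrightarrow> - I) (admissible_at_top r)"
  proof (rule tendstoI)
    fix e :: real assume e: "0 < e"
    then have e4: "0 < e / 4" by simp
    have "eventually (\<lambda>n. ln 2 / real n < e / 4) sequentially" using e by real_asymp
    moreover have "eventually (\<lambda>n. g n < e) sequentially" using g0 e by (intro order_tendstoD(2)) auto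
    ultimately have "eventually (\<lambda>n. ln 2 / real n < e / 4 \<and> g n < e) sequentially" by eventually_elim auto
    from adm[OF this] good low[OF e4] pos
    show "eventually (\<lambda>n. dist (ln (prb n) / real n) (- I) < e) (admissible_at_top r)"
    proof eventually_elim
      case (elim n)
      then have n: "0 < n" by simp
      have "ln (prb n) \<le> ln (exp (- real n * (I - g n)))"
        using up[of n] elim by (subst ln_le_cancel_iff) auto
      then have "ln (prb n) \<le> - real n * (I - g n)" by simp
      then have 1: "ln (prb n) / real n \<le> - I + g n" using n by (simp add: field_simps)
      have "ln (exp (- real n * (I + 2 * (e / 4))) / 2) \<le> ln (prb n)"
        using elim e by (subst ln_le_cancel_iff) auto
      then have "- real n * (I + e / 2) - ln 2 \<le> ln (prb n)" by (simp add: ln_div)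
      then have "(- real n * (I + e / 2) - ln 2) / real n \<le> ln (prb n) / real n" by (intro divide_right_mono) auto
      moreover have "(- real n * (I + e / 2) - ln 2) / real n = - (I + e / 2) - ln 2 / real n"
        using n by (simp add: diff_divide_distrib)
      ultimately have 2: "- (I + e / 2) - ln 2 / real n \<le> ln (prb n) / real n" by simp
      show ?case using 1 2 elim e by (auto simp: dist_real_def abs_less_iff)
    qed
  qed
  then have "((\<lambda>n. ereal (ln (prb n) / real n)) \<longlongrightarrow> ereal (- I)) (admissible_at_top r)"
    by (rule tendsto_ereal)
  moreover have "eventually (\<lambda>n. ereal (ln (prb n) / real n) = log_prob (prb n) / ereal (real n)) (admissible_at_top r)"
    using pos good by eventually_elim (auto simp: log_prob_def)
  ultimately have "((\<lambda>n. log_prob (prb n) / ereal (real n)) \<longlongrightarrow> ereal (- I)) (admissible_at_top r)"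
    by (rule Lim_transform_eventually)
  then show ?thesis unfolding prb_def .
qed

section \<open>Second-order expansion of the rate\<close>

lemma entropy_quadratic:
  fixes p \<eta> :: real
  assumes p: "0 < p" and \<eta>: "0 < \<eta>"
  shows "\<exists>\<delta>>0. \<forall>t. \<bar>t - p\<bar> < \<delta> \<longrightarrow> \<bar>t * ln (t / p) - t + p - (t - p)\<^sup>2 / (2 * p)\<bar> \<le> \<eta> * (t - p)\<^sup>2"
proof -
  have "((\<lambda>s. (s * ln s - s + 1 - (s - 1)\<^sup>2 / 2) / (s - 1)\<^sup>2) \<longlongrightarrow> 0) (at (1::real))"
    by real_asymp
  then have "eventually (\<lambda>s :: real. dist ((s * ln s - s + 1 - (s - 1)\<^sup>2 / 2) / (s - 1)\<^sup>2) 0 < \<eta> * p) (at 1)"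
    using p \<eta> by (intro tendstoD) auto
  then obtain \<delta> where \<delta>: "0 < \<delta>" "\<And>s :: real. s \<noteq> 1 \<Longrightarrow> dist s 1 < \<delta> \<Longrightarrow> \<bar>(s * ln s - s + 1 - (s - 1)\<^sup>2 / 2) / (s - 1)\<^sup>2\<bar> < \<eta> * p"
    unfolding eventually_at by (auto simp: dist_real_def)
  show ?thesis
  proof (intro exI conjI allI impI)
    show "0 < \<delta> * p" using \<delta> p by simp
    fix t assume t: "\<bar>t - p\<bar> < \<delta> * p"
    define s where "s = t / p"
    have t_eq: "t = p * s" using p by (simp add: s_def)
    have "\<bar>s - 1\<bar> * p < \<delta> * p" using t p unfolding t_eq
      by (metis abs_mult abs_of_pos mult.commute mult.right_neutral right_diff_distrib)
    then have "dist s 1 < \<delta>" using p by (simp add: dist_real_def)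
    then have "\<bar>s * ln s - s + 1 - (s - 1)\<^sup>2 / 2\<bar> \<le> \<eta> * p * (s - 1)\<^sup>2"
      using \<delta>(2)[of s] by (cases "s = 1") (auto simp: abs_divide field_simps)
    then have "p * \<bar>s * ln s - s + 1 - (s - 1)\<^sup>2 / 2\<bar> \<le> p * (\<eta> * p * (s - 1)\<^sup>2)"
      using p by (intro mult_left_mono) auto
    moreover have "t * ln (t / p) - t + p - (t - p)\<^sup>2 / (2 * p) = p * (s * ln s - s + 1 - (s - 1)\<^sup>2 / 2)"
      using p by (simp add: t_eq power2_eq_square field_simps)
    moreover have "(t - p)\<^sup>2 = p\<^sup>2 * (s - 1)\<^sup>2" by (simp add: t_eq power2_eq_square algebra_simps)
    ultimately show "\<bar>t * ln (t / p) - t + p - (t - p)\<^sup>2 / (2 * p)\<bar> \<le> \<eta> * (t - p)\<^sup>2"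
      using p by (simp add: abs_mult power2_eq_square mult_ac)
  qed
qed

text \<open>The correction \<open>- t + p\<close> in \<open>entropy_quadratic\<close> removes the
  linear part of each term and sums to zero over probability vectors, so the expansion can be made
  termwise; where \<open>p x = 0\<close> every term is zero.\<close>

lemma KL_quadratic:
  fixes p :: "'a::finite \<Rightarrow> real"
  assumes p: "prob_vec p" and \<eta>: "0 < \<eta>"
  shows "\<exists>\<delta>>0. \<forall>t. prob_vec t \<longrightarrow> (\<forall>x. p x = 0 \<longrightarrow> t x = 0) \<longrightarrow> (\<forall>x. \<bar>t x - p x\<bar> < \<delta>) \<longrightarrow>
    \<bar>KL t p - (\<Sum>x\<in>UNIV. (t x - p x)\<^sup>2 / p x) / 2\<bar> \<le> \<eta> * (\<Sum>x\<in>UNIV. (t x - p x)\<^sup>2)"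
proof -
  have "\<exists>\<delta>>0. \<forall>t. (p x = 0 \<longrightarrow> t = 0) \<longrightarrow> \<bar>t - p x\<bar> < \<delta> \<longrightarrow>
      \<bar>t * ln (t / p x) - t + p x - (t - p x)\<^sup>2 / (2 * p x)\<bar> \<le> \<eta> * (t - p x)\<^sup>2" for x
  proof (cases "p x = 0")
    case False
    then have "0 < p x" using p by (auto simp: prob_vec_def order_le_less)
    from entropy_quadratic[OF this \<eta>] show ?thesis by blast
  qed (auto intro: exI[of _ 1])
  then obtain \<delta> where \<delta>: "\<And>x. 0 < \<delta> x" "\<And>x t. (p x = 0 \<longrightarrow> t = 0) \<Longrightarrow> \<bar>t - p x\<bar> < \<delta> x \<Longrightarrow>
      \<bar>t * ln (t / p x) - t + p x - (t - p x)\<^sup>2 / (2 * p x)\<bar> \<le> \<eta> * (t - p x)\<^sup>2"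
    by metis
  show ?thesis
  proof (intro exI conjI allI impI)
    show "0 < Min (range \<delta>)" using \<delta>(1) by (subst Min_gr_iff) auto
    fix t assume t: "prob_vec t" "\<forall>x. p x = 0 \<longrightarrow> t x = 0" "\<forall>x. \<bar>t x - p x\<bar> < Min (range \<delta>)"
    have "\<bar>t x - p x\<bar> < \<delta> x" for x
      using t(3) by (meson Min_le finite finite_imageI less_le_trans rangeI)
    with \<delta>(2) t(2) have *: "\<bar>t x * ln (t x / p x) - t x + p x - (t x - p x)\<^sup>2 / (2 * p x)\<bar> \<le> \<eta> * (t x - p x)\<^sup>2" for x
      by blast
    have "KL t p - (\<Sum>x\<in>UNIV. (t x - p x)\<^sup>2 / p x) / 2
        = (\<Sum>x\<in>UNIV. t x * ln (t x / p x) - t x + p x - (t x - p x)\<^sup>2 / (2 * p x))"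
      using p t by (simp add: KL_def sum.distrib sum_subtractf prob_vec_def sum_divide_distrib mult.commute)
    also have "\<bar>\<dots>\<bar> \<le> (\<Sum>x\<in>UNIV. \<eta> * (t x - p x)\<^sup>2)"
      by (intro order_trans[OF sum_abs] sum_mono *)
    finally show "\<bar>KL t p - (\<Sum>x\<in>UNIV. (t x - p x)\<^sup>2 / p x) / 2\<bar> \<le> \<eta> * (\<Sum>x\<in>UNIV. (t x - p x)\<^sup>2)"
      by (simp add: sum_distrib_left)
  qed
qed

definition chi_square :: "real \<Rightarrow> ('a::finite \<Rightarrow> real) \<Rightarrow> ('b::finite \<Rightarrow> real) \<Rightarrow> ('a, 'b) type_pair \<Rightarrow> real" where
  "chi_square r p q h = (\<Sum>x\<in>UNIV. (fst h $ x)\<^sup>2 / p x) + r * (\<Sum>x\<in>UNIV. (snd h $ x)\<^sup>2 / q x)"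

lemma norm_type_pair:
  "(norm (h :: ('a::finite, 'b::finite) type_pair))\<^sup>2 = (\<Sum>x\<in>UNIV. (fst h $ x)\<^sup>2) + (\<Sum>x\<in>UNIV. (snd h $ x)\<^sup>2)"
  by (simp add: norm_prod_def norm_vec_def L2_set_def sum_nonneg)

lemma rate_quadratic:
  fixes p :: "'a::finite \<Rightarrow> real" and q :: "'b::finite \<Rightarrow> real"
  assumes r: "0 \<le> r" and p: "prob_vec p" and q: "prob_vec q" and \<eta>: "0 < \<eta>"
  shows "\<exists>\<delta>>0. \<forall>w\<in>rate_domain r p q. dist w (vec_lambda p, vec_lambda q) < \<delta> \<longrightarrow>
    \<bar>rate r p q w - chi_square r p q (w - (vec_lambda p, vec_lambda q)) / 2\<bar> \<le> \<eta> * (dist w (vec_lambda p, vec_lambda q))\<^sup>2"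
proof -
  define \<eta>' where "\<eta>' = \<eta> / (1 + r)"
  have \<eta>': "0 < \<eta>'" "\<eta>' \<le> \<eta>" "r * \<eta>' \<le> \<eta>" using r \<eta> by (auto simp: \<eta>'_def field_simps)
  obtain \<delta>1 where \<delta>1: "0 < \<delta>1" "\<And>t. prob_vec t \<Longrightarrow> (\<forall>x. p x = 0 \<longrightarrow> t x = 0) \<Longrightarrow> (\<forall>x. \<bar>t x - p x\<bar> < \<delta>1) \<Longrightarrow>
    \<bar>KL t p - (\<Sum>x\<in>UNIV. (t x - p x)\<^sup>2 / p x) / 2\<bar> \<le> \<eta>' * (\<Sum>x\<in>UNIV. (t x - p x)\<^sup>2)"
    using KL_quadratic[OF p \<eta>'(1)] by blast
  obtain \<delta>2 where \<delta>2: "0 < \<delta>2" "\<And>t. prob_vec t \<Longrightarrow> (\<forall>x. q x = 0 \<longrightarrow> t x = 0) \<Longrightarrow> (\<forall>x. \<bar>t x - q x\<bar> < \<delta>2) \<Longrightarrow>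
    \<bar>KL t q - (\<Sum>x\<in>UNIV. (t x - q x)\<^sup>2 / q x) / 2\<bar> \<le> \<eta>' * (\<Sum>x\<in>UNIV. (t x - q x)\<^sup>2)"
    using KL_quadratic[OF q \<eta>'(1)] by blast
  show ?thesis
  proof (intro exI conjI ballI impI)
    show "0 < min \<delta>1 \<delta>2" using \<delta>1 \<delta>2 by simp
    fix w assume w: "w \<in> rate_domain r p q" and d: "dist w (vec_lambda p, vec_lambda q) < min \<delta>1 \<delta>2"
    let ?h = "w - (vec_lambda p, vec_lambda q)"
    define A where "A = (\<Sum>x\<in>UNIV. (fst w $ x - p x)\<^sup>2)"
    define B where "B = (\<Sum>x\<in>UNIV. (snd w $ x - q x)\<^sup>2)"
    have "\<bar>fst w $ x - p x\<bar> < \<delta>1" for x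
    proof -
      have "\<bar>fst w $ x - p x\<bar> \<le> norm (fst ?h)" using component_le_norm_cart[of "fst ?h" x] by simp
      also have "\<dots> = dist (fst w) (fst (vec_lambda p, vec_lambda q))" by (simp add: dist_norm)
      also have "\<dots> \<le> dist w (vec_lambda p, vec_lambda q)" by (rule dist_fst_le)
      finally show ?thesis using d by simp
    qed
    then have 1: "\<bar>KL (($) (fst w)) p - (\<Sum>x\<in>UNIV. (fst w $ x - p x)\<^sup>2 / p x) / 2\<bar> \<le> \<eta>' * A"
      unfolding A_def using w by (intro \<delta>1) (auto simp: rate_domain_def)
    have "\<bar>snd w $ x - q x\<bar> < \<delta>2" for x
    proof -
      have "\<bar>snd w $ x - q x\<bar> \<le> norm (snd ?h)" using component_le_norm_cart[of "snd ?h" x] by simp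
      also have "\<dots> = dist (snd w) (snd (vec_lambda p, vec_lambda q))" by (simp add: dist_norm)
      also have "\<dots> \<le> dist w (vec_lambda p, vec_lambda q)" by (rule dist_snd_le)
      finally show ?thesis using d by simp
    qed
    then have 2: "\<bar>KL (($) (snd w)) q - (\<Sum>x\<in>UNIV. (snd w $ x - q x)\<^sup>2 / q x) / 2\<bar> \<le> \<eta>' * B"
      unfolding B_def using w by (intro \<delta>2) (auto simp: rate_domain_def)
    have "rate r p q w - chi_square r p q ?h / 2
       = (KL (($) (fst w)) p - (\<Sum>x\<in>UNIV. (fst w $ x - p x)\<^sup>2 / p x) / 2)
         + r * (KL (($) (snd w)) q - (\<Sum>x\<in>UNIV. (snd w $ x - q x)\<^sup>2 / q x) / 2)"
      by (simp add: rate_def chi_square_def algebra_simps add_divide_distrib)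
    also have "\<bar>\<dots>\<bar> \<le> \<eta>' * A + r * (\<eta>' * B)"
      using 1 2 r by (intro order_trans[OF abs_triangle_ineq] add_mono) (auto simp: abs_mult mult_left_mono)
    also have "\<dots> \<le> \<eta> * A + \<eta> * B"
      unfolding mult.assoc[symmetric] using \<eta>' by (intro add_mono mult_right_mono) (auto simp: A_def B_def sum_nonneg)
    also have "\<dots> = \<eta> * (dist w (vec_lambda p, vec_lambda q))\<^sup>2"
      by (simp add: dist_norm norm_type_pair A_def B_def distrib_left)
    finally show "\<bar>rate r p q w - chi_square r p q ?h / 2\<bar> \<le> \<eta> * (dist w (vec_lambda p, vec_lambda q))\<^sup>2" .
  qed
qed

subsection \<open>The estimated matrix as a function of the pair of types\<close>

type_synonym ('x, 'y) xy_pair = "('x \<times> 'y, 'x) type_pair"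

text \<open>From here on samples are replaced by a real pair \<open>w\<close>, so that the estimated
  matrix can be differentiated; at pairs of types with positive divisors these are the
  \<open>bar\<close> quantities of the samples.\<close>

definition typ_X :: "('x::finite, 'y::finite) xy_pair \<Rightarrow> 'x \<Rightarrow> real" where
  "typ_X w x = (\<Sum>y\<in>UNIV. fst w $ (x, y))"

definition mix_X :: "real \<Rightarrow> ('x::finite, 'y::finite) xy_pair \<Rightarrow> 'x \<Rightarrow> real" where
  "mix_X r w x = 1 / (1 + r) * typ_X w x + r / (1 + r) * snd w $ x"

definition mix_XY :: "real \<Rightarrow> ('x::finite, 'y::finite) xy_pair \<Rightarrow> 'x \<Rightarrow> 'y \<Rightarrow> real" where
  "mix_XY r w x y = fst w $ (x, y) / typ_X w x * mix_X r w x"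

definition mix_Y :: "real \<Rightarrow> ('x::finite, 'y::finite) xy_pair \<Rightarrow> 'y \<Rightarrow> real" where
  "mix_Y r w y = (\<Sum>x\<in>UNIV. mix_XY r w x y)"

definition mix_B :: "real \<Rightarrow> ('x::finite, 'y::finite) xy_pair \<Rightarrow> real^'x^'y" where
  "mix_B r w = (\<chi> y x. mix_XY r w x y / sqrt (mix_X r w x * mix_Y r w y) - sqrt (mix_X r w x * mix_Y r w y))"

text \<open>All divisors in \<open>mix_B\<close> are positive, so it is continuous there and agrees
  with \<open>bar_B\<close> under every convention for vanishing denominators.\<close>

definition positive_pair :: "real \<Rightarrow> ('x::finite, 'y::finite) xy_pair \<Rightarrow> bool" where
  "positive_pair r w \<longleftrightarrow> (\<forall>x. 0 < typ_X w x \<and> 0 < mix_X r w x) \<and> (\<forall>y. 0 < mix_Y r w y)"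

lemma emp_X_eq: "emp_X zs x = (\<Sum>y\<in>UNIV. emp zs (x, y))" for zs :: "('x::finite \<times> 'y::finite) list"
proof -
  have "count_list (map fst zs) x = (\<Sum>y\<in>UNIV. count_list zs (x, y))"
  proof (induction zs)
    case (Cons z zs)
    have "(\<Sum>y\<in>UNIV. count_list (z # zs) (x, y)) = (\<Sum>y\<in>UNIV. (if z = (x, y) then 1 else 0) + count_list zs (x, y))"
      by (intro sum.cong refl) auto
    also have "\<dots> = (if fst z = x then 1 else 0) + (\<Sum>y\<in>UNIV. count_list zs (x, y))"
      by (cases z) (auto simp: sum.distrib)
    finally show ?case using Cons by simp
  qed simp
  then show ?thesis by (simp add: emp_X_def emp_def sum_divide_distrib)
qed

text \<open>The defaults \<open>c\<close> and \<open>b\<close> are never consulted. When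
  \<open>r = 0\<close> the second type is the substitute \<open>q\<close>, but it enters the mixture
  with weight 0.\<close>

lemma bar_B_types:
  fixes zs :: "('x::finite \<times> 'y::finite) list"
  assumes s: "sample_pair r zs us" and pos: "positive_pair r (types q zs us)"
  shows "bar_B r c b zs us = mix_B r (types q zs us)"
proof -
  let ?w = "types q zs us"
  have 1: "emp_X zs x = typ_X ?w x" for x by (simp add: emp_X_eq typ_X_def types_def)
  have 2: "bar_PX r zs us x = mix_X r ?w x" for x
    using s by (auto simp: bar_PX_def mix_X_def 1 types_def sample_pair_def)
  have tX: "typ_X ?w x \<noteq> 0" for x using pos by (simp add: positive_pair_def less_imp_neq[symmetric])
  have 3: "bar_PXY r c zs us x y = mix_XY r ?w x y" for x y
    using tX[of x] by (simp add: bar_PXY_def mix_XY_def emp_cond_def 1 2) (simp add: types_def)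
  have 4: "bar_PY r c zs us y = mix_Y r ?w y" for y by (simp add: bar_PY_def mix_Y_def 3)
  have "mix_X r ?w x * mix_Y r ?w y \<noteq> 0" for x y
    using pos by (simp add: positive_pair_def less_imp_neq[symmetric])
  then show ?thesis by (simp add: bar_B_def mix_B_def 2 3 4)
qed

definition true_pair :: "('x::finite \<times> 'y::finite) pmf \<Rightarrow> ('x, 'y) xy_pair" where
  "true_pair P = (vec_lambda (pmf P), vec_lambda (PX P))"

lemma PX_eq: "PX P x = (\<Sum>y\<in>UNIV. pmf P (x, y))" for P :: "('x::finite \<times> 'y::finite) pmf"
proof -
  have "PX P x = measure_pmf.prob P {z. fst z = x}"
    unfolding PX_def pmf_map by (intro arg_cong[of _ _ "measure_pmf.prob P"]) auto
  also have "{z. fst z = x} = Pair x ` (UNIV :: 'y set)" by force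
  finally show ?thesis by (simp add: measure_measure_pmf_finite sum.reindex inj_on_def)
qed

lemma PY_eq: "PY P y = (\<Sum>x\<in>UNIV. pmf P (x, y))" for P :: "('x::finite \<times> 'y::finite) pmf"
proof -
  have "PY P y = measure_pmf.prob P {z. snd z = y}"
    unfolding PY_def pmf_map by (intro arg_cong[of _ _ "measure_pmf.prob P"]) auto
  also have "{z. snd z = y} = (\<lambda>x. (x, y)) ` (UNIV :: 'x set)" by force
  finally show ?thesis by (simp add: measure_measure_pmf_finite sum.reindex inj_on_def)
qed

lemma sum_PX: "sum (PX P) UNIV = 1" and sum_PY: "sum (PY P) UNIV = 1"
  for P :: "('x::finite \<times> 'y::finite) pmf"
  unfolding PX_def PY_def by (simp_all add: sum_pmf_eq_1)

text \<open>\<open>mix_dXY\<close> and \<open>dB\<close> are the derivatives at the true distribution of the maps from a pair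
  of types to the mixed joint distribution, and from the latter to the matrix.\<close>

definition mix_dXY :: "real \<Rightarrow> ('x::finite \<times> 'y::finite) pmf \<Rightarrow> ('x, 'y) xy_pair \<Rightarrow> real^('x \<times> 'y)" where
  "mix_dXY r P h = (\<chi> z. fst h $ z + r / (1 + r) * PYX P (snd z) (fst z) * (snd h $ fst z - typ_X h (fst z)))"

definition dB :: "('x::finite \<times> 'y::finite) pmf \<Rightarrow> real^('x \<times> 'y) \<Rightarrow> real^'x^'y" where
  "dB P v = (\<chi> y x. (v $ (x, y) - 1/2 * ((\<Sum>y'\<in>UNIV. v $ (x, y')) / PX P x + (\<Sum>x'\<in>UNIV. v $ (x', y)) / PY P y)
      * (pmf P (x, y) + PX P x * PY P y)) / sqrt (PX P x * PY P y))"

locale positive_marginals =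
  fixes P :: "('x::finite \<times> 'y::finite) pmf" and r :: real
  assumes PX_pos: "\<And>x. 0 < PX P x" and PY_pos: "\<And>y. 0 < PY P y" and r_nonneg: "0 \<le> r"
begin

abbreviation w0 :: "('x, 'y) xy_pair" where
  "w0 \<equiv> true_pair P"

lemma typ_X_true: "typ_X w0 x = PX P x"
  by (simp add: typ_X_def true_pair_def PX_eq)

lemma mix_weights: "1 / (1 + r) + r / (1 + r) = 1"
  using r_nonneg by (simp add: add_divide_distrib[symmetric])

lemma mix_X_true: "mix_X r w0 x = PX P x"
proof -
  have "mix_X r w0 x = (1 / (1 + r) + r / (1 + r)) * PX P x"
    unfolding mix_X_def typ_X_true by (simp add: true_pair_def distrib_right)
  then show ?thesis unfolding mix_weights by simp
qed

lemma mix_XY_true: "mix_XY r w0 x y = pmf P (x, y)"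
  using PX_pos[of x] by (simp add: mix_XY_def mix_X_true typ_X_true) (simp add: true_pair_def)

lemma mix_Y_true: "mix_Y r w0 y = PY P y"
  by (simp add: mix_Y_def mix_XY_true PY_eq)

lemma mix_B_true: "mix_B r w0 = Bt P"
proof -
  have "pmf P (x, y) / sqrt (PX P x * PY P y) - sqrt (PX P x * PY P y) = (pmf P (x, y) - PX P x * PY P y) / sqrt (PX P x * PY P y)" for x y
  proof -
    have "0 < PX P x * PY P y" using PX_pos PY_pos by simp
    then show ?thesis by (simp add: diff_divide_distrib real_div_sqrt)
  qed
  then show ?thesis
    by (simp add: mix_B_def Bt_def mix_X_true mix_Y_true mix_XY_true vec_eq_iff)
qed

lemma isCont_typ_X: "isCont (\<lambda>w. typ_X w x) (w :: ('x, 'y) xy_pair)"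
  unfolding typ_X_def by (intro continuous_intros)

lemma isCont_mix_X: "isCont (\<lambda>w. mix_X r w x) (w :: ('x, 'y) xy_pair)"
  unfolding mix_X_def by (intro continuous_intros isCont_typ_X)

lemma isCont_mix_XY: "typ_X w x \<noteq> 0 \<Longrightarrow> isCont (\<lambda>w. mix_XY r w x y) (w :: ('x, 'y) xy_pair)"
  unfolding mix_XY_def by (intro continuous_intros isCont_typ_X isCont_mix_X) auto

lemma isCont_mix_Y: "(\<And>x. typ_X w x \<noteq> 0) \<Longrightarrow> isCont (\<lambda>w. mix_Y r w y) (w :: ('x, 'y) xy_pair)"
  unfolding mix_Y_def by (intro continuous_intros isCont_mix_XY) auto

lemma isCont_mix_B:
  assumes "positive_pair r w"
  shows "isCont (mix_B r) (w :: ('x, 'y) xy_pair)"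
proof -
  have nz: "typ_X w x \<noteq> 0" "mix_X r w x * mix_Y r w y \<noteq> 0" for x y
    using assms by (auto simp: positive_pair_def less_imp_neq[symmetric])
  have "isCont (\<lambda>w. mix_B r w $ y $ x) w" for x y
    unfolding mix_B_def using nz
    by (simp, intro continuous_intros isCont_mix_XY isCont_mix_X isCont_mix_Y) auto
  then show ?thesis unfolding isCont_def by (intro vec_tendstoI)
qed

lemma eventually_positive_pair: "eventually (positive_pair r) (nhds w0)"
proof -
  have t: "typ_X w0 x \<noteq> 0" for x using PX_pos[of x] by (simp add: typ_X_true)
  have pos: "eventually (\<lambda>w. 0 < f w) (nhds w0)" if "isCont f w0" "0 < f w0" for f :: "('x, 'y) xy_pair \<Rightarrow> real"
    using that unfolding isCont_def by (intro order_tendstoD(1)[of f "f w0"]) (auto simp: tendsto_at_iff_tendsto_nhds)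
  have "eventually (\<lambda>w. (\<forall>x. 0 < typ_X w x \<and> 0 < mix_X r w x) \<and> (\<forall>y. 0 < mix_Y r w y)) (nhds w0)"
    by (intro eventually_conj eventually_all_finite pos isCont_typ_X isCont_mix_X isCont_mix_Y t)
       (auto simp: typ_X_true mix_X_true mix_Y_true PX_pos PY_pos)
  then show ?thesis by (rule eventually_mono) (simp add: positive_pair_def)
qed

text \<open>The logarithmic derivative of the root is half of
  \<open>A' h / A w + Y' h / Y w\<close>, and the root occurs both as divisor and as subtrahend;
  hence the factor \<open>T w + A w * Y w\<close>, which reappears in \<open>L_mat\<close>.\<close>

lemma B_entry_has_derivative:
  fixes T A Y :: "'w::real_normed_vector \<Rightarrow> real"
  assumes T: "(T has_derivative T') (at w)" and A: "(A has_derivative A') (at w)" and Y: "(Y has_derivative Y') (at w)"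
    and pos: "0 < A w" "0 < Y w"
  shows "((\<lambda>w. T w / sqrt (A w * Y w) - sqrt (A w * Y w)) has_derivative
     (\<lambda>h. (T' h - 1/2 * (A' h / A w + Y' h / Y w) * (T w + A w * Y w)) / sqrt (A w * Y w))) (at w)"
proof -
  define s where "s = sqrt (A w * Y w)"
  have ps: "0 < A w * Y w" using pos by simp
  have s: "0 < s" "A w * Y w = s * s" using ps by (auto simp: s_def)
  have nz: "sqrt (A w * Y w) \<noteq> 0" using pos by simp
  have AY: "((\<lambda>w. A w * Y w) has_derivative (\<lambda>h. A w * Y' h + A' h * Y w)) (at w)"
    by (rule has_derivative_mult[OF A Y])
  have S: "((\<lambda>w. sqrt (A w * Y w)) has_derivative (\<lambda>h. (A w * Y' h + A' h * Y w) * (inverse s / 2))) (at w)"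
    using has_derivative_compose[OF AY DERIV_real_sqrt[OF ps, unfolded has_field_derivative_def]]
    by (simp add: s_def mult.commute)
  have "((\<lambda>w. T w / sqrt (A w * Y w) - sqrt (A w * Y w)) has_derivative
     (\<lambda>h. (T' h * s - T w * ((A w * Y' h + A' h * Y w) * (inverse s / 2))) / (s * s) - (A w * Y' h + A' h * Y w) * (inverse s / 2))) (at w)"
    using has_derivative_diff[OF has_derivative_divide'[OF T S nz] S] unfolding s_def[symmetric] .
  moreover have "(T' h * s - T w * ((A w * Y' h + A' h * Y w) * (inverse s / 2))) / (s * s) - (A w * Y' h + A' h * Y w) * (inverse s / 2)
     = (T' h - 1/2 * (A' h / A w + Y' h / Y w) * (T w + A w * Y w)) / s" for h
  proof -
    have e: "1/2 * (A' h / A w + Y' h / Y w) = (A w * Y' h + A' h * Y w) / (2 * (s * s))"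
      unfolding s(2)[symmetric] using pos by (simp add: field_simps)
    have alg: "(t' * s - t * (z * (inverse s / 2))) / (s * s) - z * (inverse s / 2) = (t' - z / (2 * (s * s)) * (t + s * s)) / s" for t t' z
      using s(1) by (simp add: field_simps)
    show ?thesis unfolding e s(2) alg ..
  qed
  ultimately show ?thesis by (simp add: s_def)
qed

lemma typ_X_has_derivative: "((\<lambda>w. typ_X w x) has_derivative (\<lambda>h. typ_X h x)) (at (w :: ('x, 'y) xy_pair))"
  unfolding typ_X_def
  by (intro has_derivative_sum bounded_linear_imp_has_derivative
      bounded_linear_compose[OF bounded_linear_vec_nth bounded_linear_fst])

lemma mix_X_has_derivative: "((\<lambda>w. mix_X r w x) has_derivative (\<lambda>h. mix_X r h x)) (at (w :: ('x, 'y) xy_pair))"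
  unfolding mix_X_def
  by (intro has_derivative_add has_derivative_mult_right typ_X_has_derivative bounded_linear_imp_has_derivative
      bounded_linear_compose[OF bounded_linear_vec_nth bounded_linear_snd])

text \<open>The conditional distributions sum to 1, so the mixed joint distribution has
  \<open>mix_X\<close> as its marginal to first order; this is what lets \<open>dB\<close> take a
  single vector as argument.\<close>

lemma mix_dXY_row_sum: "(\<Sum>y\<in>UNIV. mix_dXY r P h $ (x, y)) = mix_X r h x"
proof -
  have "(\<Sum>y\<in>UNIV. PYX P y x) = 1"
    using PX_pos[of x] by (simp add: PYX_def sum_divide_distrib[symmetric] PX_eq[symmetric])
  moreover have "(\<Sum>y\<in>UNIV. mix_dXY r P h $ (x, y))
      = typ_X h x + r / (1 + r) * (\<Sum>y\<in>UNIV. PYX P y x) * (snd h $ x - typ_X h x)"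
    unfolding sum_distrib_left sum_distrib_right by (simp add: mix_dXY_def sum.distrib) (simp add: typ_X_def)
  ultimately have "(\<Sum>y\<in>UNIV. mix_dXY r P h $ (x, y)) = typ_X h x + r / (1 + r) * (snd h $ x - typ_X h x)"
    by simp
  also have "\<dots> = (1 / (1 + r) + r / (1 + r)) * typ_X h x + r / (1 + r) * (snd h $ x - typ_X h x)"
    unfolding mix_weights by simp
  finally show ?thesis by (simp add: mix_X_def algebra_simps)
qed

lemma mix_XY_has_derivative: "((\<lambda>w. mix_XY r w x y) has_derivative (\<lambda>h. mix_dXY r P h $ (x, y))) (at w0)"
proof -
  have t: "typ_X w0 x \<noteq> 0" using PX_pos[of x] by (simp add: typ_X_true)
  have 1: "((\<lambda>w :: ('x, 'y) xy_pair. fst w $ (x, y)) has_derivative (\<lambda>h. fst h $ (x, y))) (at w0)"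
    by (intro bounded_linear_imp_has_derivative bounded_linear_compose[OF bounded_linear_vec_nth bounded_linear_fst])
  have "((\<lambda>w. fst w $ (x, y) / typ_X w x * mix_X r w x) has_derivative
    (\<lambda>h. fst w0 $ (x, y) / typ_X w0 x * mix_X r h x +
       (fst h $ (x, y) * typ_X w0 x - fst w0 $ (x, y) * typ_X h x) / (typ_X w0 x * typ_X w0 x) * mix_X r w0 x)) (at w0)"
    by (intro has_derivative_mult mix_X_has_derivative has_derivative_divide' 1 typ_X_has_derivative t)
  moreover have "fst w0 $ (x, y) / typ_X w0 x * mix_X r h x +
       (fst h $ (x, y) * typ_X w0 x - fst w0 $ (x, y) * typ_X h x) / (typ_X w0 x * typ_X w0 x) * mix_X r w0 x
      = mix_dXY r P h $ (x, y)" for h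
  proof -
    have pp: "0 < PX P x" "fst w0 $ (x, y) = pmf P (x, y)" using PX_pos by (auto simp: true_pair_def)
    have mX: "mix_X r h x = typ_X h x + r / (1 + r) * (snd h $ x - typ_X h x)"
    proof -
      have "typ_X h x = (1 / (1 + r) + r / (1 + r)) * typ_X h x" unfolding mix_weights by simp
      then show ?thesis by (simp add: mix_X_def algebra_simps)
    qed
    have alg: "p / q * (t + c * (s - t)) + (g * q - p * t) / (q * q) * q = g + c * (p / q) * (s - t)"
      if "q \<noteq> 0" for p q t c s g :: real
      using that by (simp add: field_simps)
    show ?thesis
      using alg[of "PX P x" "pmf P (x, y)" "typ_X h x" "r / (1 + r)" "snd h $ x" "fst h $ (x, y)"] pp mX
      by (simp only: typ_X_true mix_X_true mix_dXY_def PYX_def vec_lambda_beta fst_conv snd_conv less_irrefl)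
  qed
  ultimately show ?thesis unfolding mix_XY_def by simp
qed

lemma mix_Y_has_derivative: "((\<lambda>w. mix_Y r w y) has_derivative (\<lambda>h. \<Sum>x\<in>UNIV. mix_dXY r P h $ (x, y))) (at w0)"
  unfolding mix_Y_def by (intro has_derivative_sum mix_XY_has_derivative)

lemma mix_B_has_derivative: "((\<lambda>w. mix_B r w $ y $ x) has_derivative (\<lambda>h. dB P (mix_dXY r P h) $ y $ x)) (at w0)"
  using B_entry_has_derivative[OF mix_XY_has_derivative[of x y] mix_X_has_derivative[of x] mix_Y_has_derivative[of y]] PX_pos[of x] PY_pos[of y]
  by (simp add: mix_B_def dB_def mix_X_true mix_Y_true mix_XY_true mix_dXY_row_sum)

text \<open>The derivative of the Gram entry of \<open>a\<close> and \<open>b\<close> by the product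
  rule; \<open>theta\<close> is the vector that represents it.\<close>

definition bilin :: "real^'x \<Rightarrow> real^'x \<Rightarrow> real^('x \<times> 'y) \<Rightarrow> real" where
  "bilin a b v = (Bt P *v a) \<bullet> (dB P v *v b) + (Bt P *v b) \<bullet> (dB P v *v a)"

lemma gram_has_derivative:
  "((\<lambda>w. (mix_B r w *v a) \<bullet> (mix_B r w *v b)) has_derivative (\<lambda>h. bilin a b (mix_dXY r P h))) (at w0)"
proof -
  have 1: "((\<lambda>w. \<Sum>x\<in>UNIV. mix_B r w $ y $ x * a $ x) has_derivative (\<lambda>h. \<Sum>x\<in>UNIV. dB P (mix_dXY r P h) $ y $ x * a $ x)) (at w0)" for a y
    by (intro has_derivative_sum has_derivative_mult_left mix_B_has_derivative)
  have "((\<lambda>w. \<Sum>y\<in>UNIV. (\<Sum>x\<in>UNIV. mix_B r w $ y $ x * a $ x) * (\<Sum>x\<in>UNIV. mix_B r w $ y $ x * b $ x)) has_derivative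
    (\<lambda>h. \<Sum>y\<in>UNIV. (\<Sum>x\<in>UNIV. mix_B r w0 $ y $ x * a $ x) * (\<Sum>x\<in>UNIV. dB P (mix_dXY r P h) $ y $ x * b $ x)
        + (\<Sum>x\<in>UNIV. dB P (mix_dXY r P h) $ y $ x * a $ x) * (\<Sum>x\<in>UNIV. mix_B r w0 $ y $ x * b $ x))) (at w0)"
    by (intro has_derivative_sum has_derivative_mult 1)
  then show ?thesis
    by (simp add: inner_vec_def matrix_vector_mult_def mix_B_true bilin_def sum.distrib mult.commute)
qed

end

subsection \<open>Second-order expansions\<close>

text \<open>Little o of the squared distance; as \<open>nhds\<close> includes the point itself,
  \<open>e x = 0\<close> is implied.\<close>

definition negligible2 :: "('w::real_normed_vector \<Rightarrow> real) \<Rightarrow> 'w \<Rightarrow> bool" where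
  "negligible2 e x \<longleftrightarrow> (\<forall>\<eta>>0. eventually (\<lambda>y. \<bar>e y\<bar> \<le> \<eta> * (dist y x)\<^sup>2) (nhds x))"

lemma negligible2_add:
  assumes "negligible2 e x" "negligible2 f x"
  shows "negligible2 (\<lambda>y. e y + f y) x"
  unfolding negligible2_def
proof (intro allI impI)
  fix \<eta> :: real assume "0 < \<eta>"
  then have "eventually (\<lambda>y. \<bar>e y\<bar> \<le> \<eta>/2 * (dist y x)\<^sup>2) (nhds x)" "eventually (\<lambda>y. \<bar>f y\<bar> \<le> \<eta>/2 * (dist y x)\<^sup>2) (nhds x)"
    using assms unfolding negligible2_def by (meson half_gt_zero)+
  then show "eventually (\<lambda>y. \<bar>e y + f y\<bar> \<le> \<eta> * (dist y x)\<^sup>2) (nhds x)"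
    by eventually_elim linarith
qed

lemma negligible2_cmult:
  assumes "negligible2 e x"
  shows "negligible2 (\<lambda>y. c * e y) x"
  unfolding negligible2_def
proof (intro allI impI)
  fix \<eta> :: real assume \<eta>: "0 < \<eta>"
  then have "0 < \<eta> / (\<bar>c\<bar> + 1)" by simp
  then have "eventually (\<lambda>y. \<bar>e y\<bar> \<le> \<eta> / (\<bar>c\<bar> + 1) * (dist y x)\<^sup>2) (nhds x)"
    using assms unfolding negligible2_def by blast
  then show "eventually (\<lambda>y. \<bar>c * e y\<bar> \<le> \<eta> * (dist y x)\<^sup>2) (nhds x)"
  proof eventually_elim
    case (elim y)
    have "\<bar>c * e y\<bar> \<le> (\<bar>c\<bar> + 1) * \<bar>e y\<bar>" by (simp add: abs_mult algebra_simps)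
    also have "\<dots> \<le> (\<bar>c\<bar> + 1) * (\<eta> / (\<bar>c\<bar> + 1) * (dist y x)\<^sup>2)"
      using elim by (intro mult_left_mono) auto
    also have "\<dots> = \<eta> * (dist y x)\<^sup>2" by simp
    finally show ?case .
  qed
qed

lemma negligible2_sum:
  assumes "\<And>i. i \<in> I \<Longrightarrow> negligible2 (e i) x"
  shows "negligible2 (\<lambda>y. \<Sum>i\<in>I. e i y) x"
  using assms
proof (induction I rule: infinite_finite_induct)
  case (insert i I)
  then show ?case by (simp add: negligible2_add)
qed (auto simp: negligible2_def)

lemma has_derivative_linear_bound:
  fixes f :: "'w::real_normed_vector \<Rightarrow> real"
  assumes f: "(f has_derivative D) (at x)" and f0: "f x = 0"
  shows "\<exists>K>0. eventually (\<lambda>y. \<bar>f y\<bar> \<le> K * dist y x) (nhds x)"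
proof -
  obtain K where K: "0 < K" "\<And>h. norm (D h) \<le> norm h * K"
    using has_derivative_bounded_linear[OF f] bounded_linear.pos_bounded by blast
  obtain d where d: "0 < d" "\<And>y. norm (y - x) < d \<Longrightarrow> norm (f y - f x - D (y - x)) \<le> 1 * norm (y - x)"
    using f unfolding has_derivative_at_alt by (meson zero_less_one)
  have "\<bar>f y\<bar> \<le> (K + 1) * dist y x" if "dist y x < d" for y
    using d(2)[of y] K(2)[of "y - x"] that f0 by (simp add: dist_norm algebra_simps)
  then have "eventually (\<lambda>y. \<bar>f y\<bar> \<le> (K + 1) * dist y x) (nhds x)"
    unfolding eventually_nhds_metric using d(1) by blast
  then show ?thesis using K(1) by (intro exI[of _ "K + 1"]) auto
qed

text \<open>A difference of squares: \<open>f - D\<close> is little o of the distance and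
  \<open>f + D\<close> is at most linear in it.\<close>

lemma has_derivative_square:
  fixes f :: "'w::real_normed_vector \<Rightarrow> real"
  assumes f: "(f has_derivative D) (at x)" and f0: "f x = 0"
  shows "negligible2 (\<lambda>y. (f y)\<^sup>2 - (D (y - x))\<^sup>2) x"
  unfolding negligible2_def
proof (intro allI impI)
  fix \<eta> :: real assume \<eta>: "0 < \<eta>"
  obtain K where K: "0 < K" "\<And>h. norm (D h) \<le> norm h * K"
    using has_derivative_bounded_linear[OF f] bounded_linear.pos_bounded by blast
  define e where "e = min 1 (\<eta> / (1 + 2 * K))"
  have e: "0 < e" "e \<le> 1" "e * (1 + 2 * K) \<le> \<eta>"
  proof -
    show "0 < e" "e \<le> 1" using \<eta> K by (auto simp: e_def)
    have "e * (1 + 2 * K) \<le> \<eta> / (1 + 2 * K) * (1 + 2 * K)"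
      using K by (intro mult_right_mono) (auto simp: e_def)
    then show "e * (1 + 2 * K) \<le> \<eta>" using K by simp
  qed
  obtain d where d: "0 < d" "\<And>y. norm (y - x) < d \<Longrightarrow> norm (f y - f x - D (y - x)) \<le> e * norm (y - x)"
    using f e(1) unfolding has_derivative_at_alt by meson
  have "\<bar>(f y)\<^sup>2 - (D (y - x))\<^sup>2\<bar> \<le> \<eta> * (dist y x)\<^sup>2" if "dist y x < d" for y
  proof -
    define m where "m = dist y x"
    have m: "0 \<le> m" by (simp add: m_def)
    have 1: "\<bar>f y - D (y - x)\<bar> \<le> e * m" using d(2)[of y] that f0 by (simp add: m_def dist_norm)
    have 2: "\<bar>D (y - x)\<bar> \<le> K * m" using K(2)[of "y - x"] by (simp add: m_def dist_norm mult.commute)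
    have "e * m \<le> m" using e m by (simp add: mult_left_le_one_le)
    then have 3: "\<bar>f y + D (y - x)\<bar> \<le> (1 + 2 * K) * m" using 1 2 by (simp add: algebra_simps)
    have "\<bar>(f y)\<^sup>2 - (D (y - x))\<^sup>2\<bar> = \<bar>f y - D (y - x)\<bar> * \<bar>f y + D (y - x)\<bar>"
      by (simp add: abs_mult[symmetric] power2_eq_square algebra_simps)
    also have "\<dots> \<le> (e * m) * ((1 + 2 * K) * m)" using 1 3 e m by (intro mult_mono) auto
    also have "\<dots> = (e * (1 + 2 * K)) * m\<^sup>2" by (simp add: power2_eq_square)
    also have "\<dots> \<le> \<eta> * m\<^sup>2" using e by (intro mult_right_mono) auto
    finally show ?thesis by (simp add: m_def)
  qed
  then show "eventually (\<lambda>y. \<bar>(f y)\<^sup>2 - (D (y - x))\<^sup>2\<bar> \<le> \<eta> * (dist y x)\<^sup>2) (nhds x)"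
    unfolding eventually_nhds_metric using d(1) by blast
qed

lemma negligible2_cubic:
  assumes K: "0 < K" "eventually (\<lambda>y. e y \<le> K * dist y x) (nhds x)" and nn: "\<And>y. 0 \<le> e y"
  shows "negligible2 (\<lambda>y. e y ^ 3 + e y ^ 4) x"
  unfolding negligible2_def
proof (intro allI impI)
  fix \<eta> :: real assume \<eta>: "0 < \<eta>"
  define d where "d = min (1 / K) (\<eta> / (2 * K ^ 3))"
  have "0 < d" using K \<eta> by (simp add: d_def)
  then have "eventually (\<lambda>y. dist y x < d) (nhds x)" unfolding eventually_nhds_metric by blast
  with K(2) show "eventually (\<lambda>y. \<bar>e y ^ 3 + e y ^ 4\<bar> \<le> \<eta> * (dist y x)\<^sup>2) (nhds x)"
  proof eventually_elim
    case (elim y)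
    have "K * dist y x < K * (1 / K)" using elim K by (intro mult_strict_left_mono) (auto simp: d_def)
    then have "e y \<le> 1" using elim(1) K by simp
    then have "e y ^ 4 \<le> e y ^ 3" using nn by (intro power_decreasing) auto
    moreover have "e y ^ 3 \<le> (K * dist y x) ^ 3" using elim nn by (intro power_mono) auto
    ultimately have "e y ^ 3 + e y ^ 4 \<le> 2 * (K * dist y x) ^ 3" by simp
    also have "\<dots> = (2 * K ^ 3 * dist y x) * (dist y x)\<^sup>2" by (simp add: power_mult_distrib power2_eq_square power3_eq_cube)
    also have "\<dots> \<le> \<eta> * (dist y x)\<^sup>2"
    proof (intro mult_right_mono)
      have "2 * K ^ 3 * dist y x \<le> 2 * K ^ 3 * (\<eta> / (2 * K ^ 3))"
        using elim K by (intro mult_left_mono) (auto simp: d_def)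
      then show "2 * K ^ 3 * dist y x \<le> \<eta>" using K by simp
    qed simp
    finally show ?case using nn[of y] by simp
  qed
qed

text \<open>A substitute for diagonalisation: Cauchy-Schwarz for the form, at \<open>A *v v\<close>
  and \<open>v\<close>, bounds the norm of \<open>A *v v\<close> by the maximum of the form on the
  sphere, so this maximum is the operator norm.\<close>

lemma psd_onorm_attained:
  fixes A :: "real^'n^'n"
  assumes CS: "\<And>u v. (u \<bullet> (A *v v))\<^sup>2 \<le> (u \<bullet> (A *v u)) * (v \<bullet> (A *v v))"
    and psd: "\<And>u. 0 \<le> u \<bullet> (A *v u)"
  shows "\<exists>u. norm u = 1 \<and> u \<bullet> (A *v u) = onorm ((*v) A)"
proof -
  have bl: "bounded_linear ((*v) A)" by (rule matrix_vector_mul_bounded_linear)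
  have ne: "sphere (0 :: real^'n) 1 \<noteq> {}" by simp
  have cont: "continuous_on (sphere 0 1) (\<lambda>u. u \<bullet> (A *v u))"
    by (intro continuous_intros linear_continuous_on bl)
  obtain u where u: "norm u = 1" and umax: "\<And>v. norm v = 1 \<Longrightarrow> v \<bullet> (A *v v) \<le> u \<bullet> (A *v u)"
    using continuous_attains_sup[OF compact_sphere ne cont] by auto
  define \<beta> where "\<beta> = u \<bullet> (A *v u)"
  have \<beta>: "0 \<le> \<beta>" using psd by (simp add: \<beta>_def)
  have qb: "v \<bullet> (A *v v) \<le> \<beta> * (norm v)\<^sup>2" for v
  proof (cases "v = 0")
    case False
    define e where "e = v /\<^sub>R norm v"
    have "norm e = 1" using False by (simp add: e_def)
    then have "e \<bullet> (A *v e) \<le> \<beta>" unfolding \<beta>_def by (rule umax)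
    moreover have "v = norm v *\<^sub>R e" using False by (simp add: e_def)
    then have "v \<bullet> (A *v v) = (norm v)\<^sup>2 * (e \<bullet> (A *v e))"
      by (metis (no_types, lifting) inner_scaleR_left inner_scaleR_right matrix_vector_mult_scaleR mult.assoc power2_eq_square)
    ultimately show ?thesis
      using mult_right_mono[of "e \<bullet> (A *v e)" \<beta> "(norm v)\<^sup>2"] by (simp add: mult.commute)
  qed simp
  have "norm (A *v v) \<le> \<beta> * norm v" for v
  proof (cases "A *v v = 0")
    case False
    define w where "w = A *v v"
    have "(norm w)\<^sup>2 * (norm w)\<^sup>2 = (w \<bullet> (A *v v))\<^sup>2"
    proof -
      have "w \<bullet> (A *v v) = (norm w)\<^sup>2" unfolding w_def power2_norm_eq_inner ..
      then show ?thesis by (simp only: power2_eq_square[of "(norm w)\<^sup>2"])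
    qed
    also have "\<dots> \<le> (w \<bullet> (A *v w)) * (v \<bullet> (A *v v))" by (rule CS)
    also have "\<dots> \<le> (\<beta> * (norm w)\<^sup>2) * (\<beta> * (norm v)\<^sup>2)"
      by (intro mult_mono qb psd mult_nonneg_nonneg \<beta>) auto
    finally have "(norm w)\<^sup>2 * (norm w)\<^sup>2 \<le> (norm w)\<^sup>2 * (\<beta> * norm v)\<^sup>2"
      by (simp add: power_mult_distrib power2_eq_square mult_ac)
    then have "(norm w)\<^sup>2 \<le> (\<beta> * norm v)\<^sup>2"
      by (rule mult_left_le_imp_le) (use False in \<open>simp add: w_def\<close>)
    then have "norm w \<le> \<beta> * norm v" by (rule power2_le_imp_le) (use \<beta> in simp)
    then show ?thesis by (simp only: w_def)
  qed (use \<beta> in simp)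
  then have "onorm ((*v) A) \<le> \<beta>" by (rule onorm_le)
  moreover have "\<beta> \<le> onorm ((*v) A)"
  proof -
    have "\<beta> \<le> norm u * norm (A *v u)" unfolding \<beta>_def by (rule norm_cauchy_schwarz)
    also have "\<dots> \<le> onorm ((*v) A)" using onorm[OF bl, of u] u by simp
    finally show ?thesis .
  qed
  ultimately show ?thesis using u by (auto simp: \<beta>_def)
qed

lemma inner_transpose_sandwich:
  fixes A :: "real^'n^'m" and G :: "real^'m^'m"
  shows "u \<bullet> ((transpose A ** G ** A) *v v) = (A *v u) \<bullet> (G *v (A *v v))"
  by (metis dot_lmul_matrix matrix_vector_mul_assoc transpose_matrix_vector transpose_transpose inner_commute)

lemma sum_matrix_vector_mult: "(\<Sum>i\<in>I. f i) *v x = (\<Sum>i\<in>I. f i *v x)" for f :: "'i \<Rightarrow> real^'n^'m"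
  by (induction I rule: infinite_finite_induct) (auto simp: matrix_vector_mult_add_rdistrib)

lemma outer_mult: "outer t s *v x = (s \<bullet> x) *\<^sub>R t"
  by (simp add: vec_eq_iff outer_def matrix_vector_mult_def inner_vec_def sum_distrib_left sum_distrib_right mult_ac)

lemma sum_UNIV_pair: "(\<Sum>z\<in>UNIV. f z) = (\<Sum>x\<in>UNIV. \<Sum>y\<in>UNIV. f (x, y))"
  for f :: "'x::finite \<times> 'y::finite \<Rightarrow> real"
  by (simp add: sum.cartesian_product UNIV_Times_UNIV[symmetric] del: UNIV_Times_UNIV)

lemma sum_of_bool_row: "(\<Sum>x'\<in>UNIV. \<Sum>y'\<in>UNIV. of_bool (x = x') * f x' y') = (\<Sum>y'\<in>UNIV. f x y')"
  for f :: "'x::finite \<Rightarrow> 'y::finite \<Rightarrow> real"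
  by (simp add: sum_distrib_left[symmetric])

section \<open>The matrices of the statement as derivatives in normalised coordinates\<close>

context positive_marginals
begin

definition scale_P :: "real^('x \<times> 'y) \<Rightarrow> real^('x \<times> 'y)" where
  "scale_P v = (\<chi> z. sqrt (pmf P z) * v $ z)"

text \<open>The root of the joint probability in each column of \<open>L_mat\<close> is the
  rescaling \<open>scale_P\<close>; what remains is the derivative \<open>dB\<close>.\<close>

lemma L_mat_mult: "(L_mat P *v v) $ (x, y) = dB P (scale_P v) $ y $ x"
proof -
  define m where "m = pmf P (x, y) + PX P x * PY P y"
  define s where "s = sqrt (PX P x * PY P y)"
  define g where "g x' y' = scale_P v $ (x', y') / s" for x' y'
  have "(L_mat P *v v) $ (x, y) = (\<Sum>x'\<in>UNIV. \<Sum>y'\<in>UNIV. g x' y' *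
      (of_bool (x = x') * of_bool (y = y') - 1/2 * (of_bool (x = x') / PX P x + of_bool (y = y') / PY P y) * m))"
    unfolding matrix_vector_mult_def L_mat_def
    by (simp add: sum_UNIV_pair Let_def g_def scale_P_def m_def s_def real_sqrt_divide mult_ac)
  also have "\<dots> = (\<Sum>x'\<in>UNIV. \<Sum>y'\<in>UNIV. of_bool (x = x') * (of_bool (y = y') * g x' y')
      - m / (2 * PX P x) * (of_bool (x = x') * g x' y') - m / (2 * PY P y) * (of_bool (y = y') * g x' y'))"
    by (intro sum.cong refl) (simp add: algebra_simps)
  also have "\<dots> = (\<Sum>x'\<in>UNIV. \<Sum>y'\<in>UNIV. of_bool (x = x') * (of_bool (y = y') * g x' y'))
      - m / (2 * PX P x) * (\<Sum>x'\<in>UNIV. \<Sum>y'\<in>UNIV. of_bool (x = x') * g x' y')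
      - m / (2 * PY P y) * (\<Sum>x'\<in>UNIV. \<Sum>y'\<in>UNIV. of_bool (y = y') * g x' y')"
    by (simp only: sum_subtractf sum_distrib_left)
  also have "\<dots> = g x y - 1/2 * ((\<Sum>y'\<in>UNIV. g x y') / PX P x + (\<Sum>x'\<in>UNIV. g x' y) / PY P y) * m"
    unfolding sum_of_bool_row by (simp add: of_bool_def if_distrib if_distribR algebra_simps cong: if_cong)
  also have "\<dots> = dB P (scale_P v) $ y $ x"
  proof -
    have alg: "a / t - 1/2 * (b / t / p + c / t / q) * n = (a - 1/2 * (b / p + c / q) * n) / t" for a b c p q t n :: real
      by (simp add: diff_divide_distrib add_divide_distrib distrib_right distrib_left mult_ac)
    show ?thesis
      unfolding g_def sum_divide_distrib[symmetric] alg by (simp add: dB_def m_def s_def)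
  qed
  finally show ?thesis .
qed

lemma inner_kron_L: "kron a b \<bullet> (L_mat P *v v) = b \<bullet> (dB P (scale_P v) *v a)"
proof -
  have "kron a b \<bullet> (L_mat P *v v) = (\<Sum>x\<in>UNIV. \<Sum>y\<in>UNIV. b $ y * (dB P (scale_P v) $ y $ x * a $ x))"
    by (simp add: inner_vec_def kron_def sum_UNIV_pair L_mat_mult mult_ac)
  also have "\<dots> = (\<Sum>y\<in>UNIV. \<Sum>x\<in>UNIV. b $ y * (dB P (scale_P v) $ y $ x * a $ x))"
    by (rule sum.swap)
  finally show ?thesis by (simp add: inner_vec_def matrix_vector_mult_def sum_distrib_left)
qed

text \<open>Each of the two Kronecker products in \<open>theta\<close> picks out one of the two
  terms of the product rule.\<close>

lemma inner_theta_L: "theta P \<phi> i j \<bullet> (L_mat P *v v) = bilin (\<phi> i) (\<phi> j) (scale_P v)"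
  by (simp add: theta_def inner_add_left inner_kron_L bilin_def)

text \<open>Normalised coordinates, in which the second-order expansion of the rate is half the
  squared Euclidean norm; for \<open>r = 0\<close> the division by \<open>sqrt r\<close> returns 0, as it should.\<close>

definition denormalise :: "real^(('x \<times> 'y) + 'x) \<Rightarrow> ('x, 'y) xy_pair" where
  "denormalise u = (\<chi> z. sqrt (pmf P z) * u $ Inl z, \<chi> x. sqrt (PX P x) * u $ Inr x / sqrt r)"

definition normalise :: "('x, 'y) xy_pair \<Rightarrow> real^(('x \<times> 'y) + 'x)" where
  "normalise h = (\<chi> s. case s of Inl z \<Rightarrow> fst h $ z / sqrt (pmf P z) | Inr x \<Rightarrow> sqrt r * snd h $ x / sqrt (PX P x))"

lemma sum_UNIV_Plus: "(\<Sum>s\<in>UNIV. f s) = (\<Sum>z\<in>UNIV. f (Inl z)) + (\<Sum>x\<in>UNIV. f (Inr x))"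
  for f :: "'a::finite + 'b::finite \<Rightarrow> real"
  by (simp add: UNIV_Plus_UNIV[symmetric] sum.Plus del: UNIV_Plus_UNIV)

text \<open>\<open>bar_L\<close> is the mixing step in normalised coordinates: along the conditional
  distribution it removes the fraction \<open>r / (1 + r)\<close> of the labelled marginal and puts
  the unlabelled one in its place.\<close>

lemma scale_bar_L: "scale_P (bar_L P r *v u) = mix_dXY r P (denormalise u)"
proof -
  have "scale_P (bar_L P r *v u) $ (x, y) = mix_dXY r P (denormalise u) $ (x, y)" for x y
  proof -
    define p where "p = pmf P (x, y)"
    define q where "q = PX P x"
    define c where "c = r / (1 + r)"
    have q: "0 < q" "0 \<le> p" using PX_pos by (auto simp: q_def p_def)
    have yx: "sqrt (PYX P y x) = sqrt p / sqrt q" by (simp add: PYX_def p_def q_def real_sqrt_divide)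
    have sx: "sqrt (PYX P y' x) = sqrt (pmf P (x, y')) / sqrt q" for y' by (simp add: PYX_def q_def real_sqrt_divide)
    define M where "M = (\<Sum>y'\<in>UNIV. sqrt (pmf P (x, y')) * u $ Inl (x, y'))"
    have e1: "bar_L P r $ (x, y) $ Inl (x', y') = of_bool (x = x') * of_bool (y = y') - c * sqrt (PYX P y x * PYX P y' x') * of_bool (x = x')" for x' y'
      by (simp add: bar_L_def c_def)
    have e2: "bar_L P r $ (x, y) $ Inr x' = sqrt r / (1 + r) * sqrt (PYX P y x) * of_bool (x = x')" for x'
      by (simp add: bar_L_def)
    have "(bar_L P r *v u) $ (x, y) = (\<Sum>x'\<in>UNIV. \<Sum>y'\<in>UNIV. bar_L P r $ (x, y) $ Inl (x', y') * u $ Inl (x', y'))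
        + (\<Sum>x'\<in>UNIV. bar_L P r $ (x, y) $ Inr x' * u $ Inr x')"
      by (simp only: matrix_vector_mult_def vec_lambda_beta sum_UNIV_Plus sum_UNIV_pair)
    also have "(\<Sum>x'\<in>UNIV. bar_L P r $ (x, y) $ Inr x' * u $ Inr x') = sqrt r / (1 + r) * sqrt (PYX P y x) * u $ Inr x"
      unfolding e2 by (simp add: of_bool_def if_distrib if_distribR cong: if_cong)
    also have "(\<Sum>x'\<in>UNIV. \<Sum>y'\<in>UNIV. bar_L P r $ (x, y) $ Inl (x', y') * u $ Inl (x', y'))
      = (\<Sum>x'\<in>UNIV. \<Sum>y'\<in>UNIV. of_bool (x = x') * (of_bool (y = y') * u $ Inl (x', y')))
        - (\<Sum>x'\<in>UNIV. \<Sum>y'\<in>UNIV. of_bool (x = x') * (c * sqrt (PYX P y x * PYX P y' x') * u $ Inl (x', y')))"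
      unfolding e1 sum_subtractf[symmetric] by (intro sum.cong refl) (simp add: algebra_simps)
    also have "(\<Sum>x'\<in>UNIV. \<Sum>y'\<in>UNIV. of_bool (x = x') * (of_bool (y = y') * u $ Inl (x', y')))
        - (\<Sum>x'\<in>UNIV. \<Sum>y'\<in>UNIV. of_bool (x = x') * (c * sqrt (PYX P y x * PYX P y' x') * u $ Inl (x', y')))
        + sqrt r / (1 + r) * sqrt (PYX P y x) * u $ Inr x
      = u $ Inl (x, y) - c * (sqrt p / q) * M + sqrt r / (1 + r) * (sqrt p / sqrt q) * u $ Inr x"
    proof -
      have "(\<Sum>y'\<in>UNIV. c * sqrt (PYX P y x * PYX P y' x) * u $ Inl (x, y')) = c * (sqrt p / q) * M"
        unfolding M_def sum_distrib_left
        using q by (intro sum.cong refl) (simp add: real_sqrt_mult sx p_def)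
      then show ?thesis unfolding sum_of_bool_row yx by (simp add: of_bool_def if_distrib if_distribR cong: if_cong)
    qed
    finally have E: "(bar_L P r *v u) $ (x, y) = u $ Inl (x, y) - c * (sqrt p / q) * M + sqrt r / (1 + r) * (sqrt p / sqrt q) * u $ Inr x" .
    have L: "scale_P (bar_L P r *v u) $ (x, y) =
        sqrt p * u $ Inl (x, y) - c * (p / q) * M + sqrt r / (1 + r) * (p / sqrt q) * u $ Inr x"
    proof -
      have alg: "s * (a - c * (s / q) * M + K * (s / t) * z) = s * a - c * ((s * s) / q) * M + K * ((s * s) / t) * z" for s a K t z :: real
        by (simp add: algebra_simps)
      have "scale_P (bar_L P r *v u) $ (x, y) = sqrt p * (bar_L P r *v u) $ (x, y)"
        by (simp add: scale_P_def p_def)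
      also have "sqrt p * sqrt p = p" using q by simp
      then have "sqrt p * (bar_L P r *v u) $ (x, y) = sqrt p * u $ Inl (x, y) - c * (p / q) * M + sqrt r / (1 + r) * (p / sqrt q) * u $ Inr x"
        unfolding E alg by (simp only:)
      finally show ?thesis .
    qed
    \<comment> \<open>The entry \<open>sqrt r / (1 + r)\<close> is the mixing weight
      \<open>r / (1 + r)\<close> divided by the \<open>sqrt r\<close> of the normalisation; for
      \<open>r = 0\<close> both sides are 0.\<close>
    have "sqrt r / (1 + r) * (p / sqrt q) = c * (p / q) * (sqrt q / sqrt r)"
    proof (cases "r = 0")
      case False
      then have "0 < r" using r_nonneg by simp
      then have "r = sqrt r * sqrt r" "q = sqrt q * sqrt q" "sqrt r \<noteq> 0" "sqrt q \<noteq> 0" using q by auto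
      then show ?thesis unfolding c_def by (simp add: divide_simps)
    qed (simp add: c_def)
    then have "scale_P (bar_L P r *v u) $ (x, y) =
        sqrt p * u $ Inl (x, y) + c * (p / q) * (sqrt q * u $ Inr x / sqrt r - M)"
      unfolding L by (simp add: algebra_simps)
    then show ?thesis
      by (simp add: mix_dXY_def denormalise_def typ_X_def PYX_def M_def c_def p_def q_def)
  qed
  then show ?thesis by (simp add: vec_eq_iff)
qed

end

section \<open>Invariance under change of mass, and the chi-square norm\<close>

context positive_marginals
begin

text \<open>Linearity comes for free, because the map is a derivative.\<close>

lemma linear_bilin_mix: "linear (\<lambda>h. bilin a b (mix_dXY r P h))"
  using gram_has_derivative[THEN has_derivative_bounded_linear] bounded_linear.linear by blast

definition root_X :: "real^'x" where
  "root_X = (\<chi> x. sqrt (PX P x))"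

definition root_Y :: "real^'y" where
  "root_Y = (\<chi> y. sqrt (PY P y))"

text \<open>The roots of the two marginals form the singular pair of value 1 that the subtraction in
  \<open>Bt\<close> has removed.\<close>

lemma Bt_root_X: "Bt P *v root_X = 0"
proof -
  have "(\<Sum>x\<in>UNIV. (pmf P (x, y) - PX P x * PY P y) / sqrt (PX P x * PY P y) * sqrt (PX P x)) = 0" for y
  proof -
    have "(\<Sum>x\<in>UNIV. (pmf P (x, y) - PX P x * PY P y) / sqrt (PX P x * PY P y) * sqrt (PX P x))
        = (\<Sum>x\<in>UNIV. (pmf P (x, y) - PX P x * PY P y) / sqrt (PY P y))"
      using PX_pos by (intro sum.cong refl) (simp add: real_sqrt_mult less_imp_neq[symmetric])
    also have "\<dots> = (PY P y - 1 * PY P y) / sqrt (PY P y)"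
      by (simp add: sum_divide_distrib[symmetric] sum_subtractf PY_eq[symmetric] sum_distrib_right[symmetric] sum_PX)
    finally show ?thesis by simp
  qed
  then show ?thesis by (simp add: vec_eq_iff matrix_vector_mult_def Bt_def root_X_def)
qed

lemma root_Y_Bt: "(Bt P *v a) \<bullet> root_Y = 0"
proof -
  have "(Bt P *v a) \<bullet> root_Y = (\<Sum>y\<in>UNIV. \<Sum>x\<in>UNIV. (pmf P (x, y) - PX P x * PY P y) / sqrt (PX P x * PY P y) * a $ x * sqrt (PY P y))"
    by (simp add: inner_vec_def matrix_vector_mult_def Bt_def root_Y_def sum_distrib_right)
  also have "\<dots> = (\<Sum>x\<in>UNIV. \<Sum>y\<in>UNIV. (pmf P (x, y) - PX P x * PY P y) / sqrt (PX P x * PY P y) * a $ x * sqrt (PY P y))"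
    by (rule sum.swap)
  also have "\<dots> = (\<Sum>x\<in>UNIV. a $ x / sqrt (PX P x) * (\<Sum>y\<in>UNIV. pmf P (x, y) - PX P x * PY P y))"
    unfolding sum_distrib_left using PY_pos
    by (intro sum.cong refl) (simp add: real_sqrt_mult less_imp_neq[symmetric])
  also have "\<dots> = (\<Sum>x\<in>UNIV. a $ x / sqrt (PX P x) * (PX P x - PX P x * 1))"
    by (simp add: sum_subtractf PX_eq[symmetric] sum_distrib_left[symmetric] sum_PY)
  finally show ?thesis by simp
qed

text \<open>A multiple of the true distribution only changes the total mass: its image under
  \<open>dB\<close> has rank one with columns along \<open>root_Y\<close>, which is orthogonal to
  the range of \<open>Bt P\<close>.\<close>

lemma bilin_true: "bilin a b (c *\<^sub>R vec_lambda (pmf P)) = 0"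
proof -
  have "dB P (c *\<^sub>R vec_lambda (pmf P)) *v a = (- c * (root_X \<bullet> a)) *\<^sub>R root_Y" for a
  proof -
    have e: "dB P (c *\<^sub>R vec_lambda (pmf P)) $ y $ x = - c * (sqrt (PX P x) * sqrt (PY P y))" for x y
    proof -
      have pq: "0 < PX P x" "0 < PY P y" using PX_pos PY_pos by auto
      have "dB P (c *\<^sub>R vec_lambda (pmf P)) $ y $ x
          = (c * pmf P (x, y) - 1/2 * (c * PX P x / PX P x + c * PY P y / PY P y) * (pmf P (x, y) + PX P x * PY P y)) / sqrt (PX P x * PY P y)"
        by (simp add: dB_def PX_eq PY_eq sum_distrib_left)
      also have "\<dots> = - c * ((PX P x * PY P y) / sqrt (PX P x * PY P y))"
        using pq by (simp add: algebra_simps)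
      also have "(PX P x * PY P y) / sqrt (PX P x * PY P y) = sqrt (PX P x) * sqrt (PY P y)"
        unfolding real_sqrt_mult[symmetric] by (rule real_div_sqrt) (use pq in simp)
      finally show ?thesis .
    qed
    show ?thesis
      unfolding vec_eq_iff matrix_vector_mult_def
      by (simp add: e root_X_def root_Y_def inner_vec_def sum_distrib_left sum_distrib_right mult_ac sum_negf)
  qed
  then show ?thesis by (simp add: bilin_def root_Y_Bt)
qed

lemma PYX_mult: "PYX P y x * PX P x = pmf P (x, y)"
  using PX_pos[of x] by (simp add: PYX_def)

lemma mix_dXY_true:
  "mix_dXY r P (vec_lambda (pmf P), 0) = (1 / (1 + r)) *\<^sub>R vec_lambda (pmf P)"
  "mix_dXY r P (0, vec_lambda (PX P)) = (r / (1 + r)) *\<^sub>R vec_lambda (pmf P)"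
proof -
  have "pmf P (x, y) - r / (1 + r) * PYX P y x * PX P x = 1 / (1 + r) * pmf P (x, y)" for x y
    using r_nonneg unfolding mult.assoc PYX_mult by (simp add: field_simps)
  then show "mix_dXY r P (vec_lambda (pmf P), 0) = (1 / (1 + r)) *\<^sub>R vec_lambda (pmf P)"
    by (simp add: vec_eq_iff mix_dXY_def typ_X_def PX_eq[symmetric])
  show "mix_dXY r P (0, vec_lambda (PX P)) = (r / (1 + r)) *\<^sub>R vec_lambda (pmf P)"
    by (simp add: vec_eq_iff mix_dXY_def typ_X_def PYX_mult)
qed

text \<open>The form does not see the total mass of either component, so a direction may be centred
  afterwards without changing its value.\<close>

lemma bilin_mix_shift:
  "bilin a b (mix_dXY r P (h - (s *\<^sub>R vec_lambda (pmf P), t *\<^sub>R vec_lambda (PX P)))) = bilin a b (mix_dXY r P h)"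
proof -
  interpret linear "\<lambda>h. bilin a b (mix_dXY r P h)" by (rule linear_bilin_mix)
  have "(s *\<^sub>R vec_lambda (pmf P), t *\<^sub>R vec_lambda (PX P)) = s *\<^sub>R (vec_lambda (pmf P), 0) + t *\<^sub>R (0, vec_lambda (PX P))"
    by simp
  then show ?thesis
    by (simp only: diff add scale mix_dXY_true bilin_true) simp
qed

text \<open>Only the support constraints on \<open>w - w0\<close>; zero total mass is not among them
  because \<open>denormalise\<close> does not respect it, and centring restores it later.\<close>

definition admissible_dir :: "('x, 'y) xy_pair \<Rightarrow> bool" where
  "admissible_dir h \<longleftrightarrow> (\<forall>z. pmf P z = 0 \<longrightarrow> fst h $ z = 0) \<and> (r = 0 \<longrightarrow> snd h = 0)"

lemma denormalise_admissible: "admissible_dir (denormalise u)"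
  by (simp add: admissible_dir_def denormalise_def vec_eq_iff)

lemma denormalise_normalise: "admissible_dir h \<Longrightarrow> denormalise (normalise h) = h"
  using PX_pos r_nonneg
  by (auto simp: admissible_dir_def denormalise_def normalise_def prod_eq_iff vec_eq_iff less_imp_neq[symmetric])

abbreviation chi2 :: "('x, 'y) xy_pair \<Rightarrow> real" where
  "chi2 \<equiv> chi_square r (pmf P) (PX P)"

lemma norm_normalise: "(norm (normalise h))\<^sup>2 = chi2 h"
proof -
  have "(norm (normalise h))\<^sup>2 = (\<Sum>z\<in>UNIV. (fst h $ z / sqrt (pmf P z))\<^sup>2) + (\<Sum>x\<in>UNIV. (sqrt r * snd h $ x / sqrt (PX P x))\<^sup>2)"
    by (simp add: norm_vec_def L2_set_def sum_nonneg sum_UNIV_Plus normalise_def)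
  also have "\<dots> = chi2 h"
    using r_nonneg PX_pos
    by (simp add: chi_square_def power_divide power_mult_distrib sum_distrib_left less_imp_le)
  finally show ?thesis .
qed

text \<open>Only an inequality, because \<open>denormalise\<close> discards the coordinates of
  \<open>u\<close> at cells of probability 0 and, for \<open>r = 0\<close>, the whole second
  block.\<close>

lemma chi_square_denormalise: "chi2 (denormalise u) \<le> (norm u)\<^sup>2"
proof -
  have "(norm u)\<^sup>2 = (\<Sum>z\<in>UNIV. (u $ Inl z)\<^sup>2) + (\<Sum>x\<in>UNIV. (u $ Inr x)\<^sup>2)"
    by (simp add: norm_vec_def L2_set_def sum_nonneg sum_UNIV_Plus)
  moreover have "(\<Sum>z\<in>UNIV. (fst (denormalise u) $ z)\<^sup>2 / pmf P z) \<le> (\<Sum>z\<in>UNIV. (u $ Inl z)\<^sup>2)"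
    by (intro sum_mono) (simp add: denormalise_def power_mult_distrib)
  moreover have "r * (\<Sum>x\<in>UNIV. (snd (denormalise u) $ x)\<^sup>2 / PX P x) \<le> (\<Sum>x\<in>UNIV. (u $ Inr x)\<^sup>2)"
    unfolding sum_distrib_left
  proof (intro sum_mono)
    fix x
    show "r * ((snd (denormalise u) $ x)\<^sup>2 / PX P x) \<le> (u $ Inr x)\<^sup>2"
      using r_nonneg PX_pos[of x]
      by (cases "r = 0") (auto simp: denormalise_def power_mult_distrib power_divide less_imp_le)
  qed
  ultimately show ?thesis by (simp add: chi_square_def)
qed

text \<open>Centring is an orthogonal projection in the weighted inner product: a component of total
  \<open>s\<close> loses exactly \<open>s\<close> squared.\<close>

lemma chi_square_center:
  assumes "admissible_dir h"
  shows "chi2 (h - ((\<Sum>z\<in>UNIV. fst h $ z) *\<^sub>R vec_lambda (pmf P), (\<Sum>x\<in>UNIV. snd h $ x) *\<^sub>R vec_lambda (PX P)))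
    \<le> chi2 h"
proof -
  have center: "(\<Sum>x\<in>UNIV. (f x - (\<Sum>x\<in>UNIV. f x) * p x)\<^sup>2 / p x) \<le> (\<Sum>x\<in>UNIV. (f x)\<^sup>2 / p x)"
    if p: "\<And>x. p x = 0 \<Longrightarrow> f x = 0" "sum p UNIV = 1" for f p :: "'c::finite \<Rightarrow> real"
  proof -
    define s where "s = (\<Sum>x\<in>UNIV. f x)"
    have "(f x - s * p x)\<^sup>2 / p x = (f x)\<^sup>2 / p x - 2 * s * f x + s\<^sup>2 * p x" for x
      using p(1)[of x] by (cases "p x = 0") (auto simp: power2_eq_square field_simps)
    then have "(\<Sum>x\<in>UNIV. (f x - s * p x)\<^sup>2 / p x) = (\<Sum>x\<in>UNIV. (f x)\<^sup>2 / p x) - 2 * s * s + s\<^sup>2 * 1"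
      by (simp add: sum.distrib sum_subtractf sum_distrib_left[symmetric] s_def[symmetric] p(2))
    then show ?thesis by (simp add: s_def[symmetric] power2_eq_square)
  qed
  have "sum (pmf P) UNIV = 1" by (simp add: sum_pmf_eq_1)
  then have 1: "(\<Sum>z\<in>UNIV. (fst h $ z - (\<Sum>z\<in>UNIV. fst h $ z) * pmf P z)\<^sup>2 / pmf P z) \<le> (\<Sum>z\<in>UNIV. (fst h $ z)\<^sup>2 / pmf P z)"
    using assms by (intro center) (auto simp: admissible_dir_def)
  have 2: "(\<Sum>x\<in>UNIV. (snd h $ x - (\<Sum>x\<in>UNIV. snd h $ x) * PX P x)\<^sup>2 / PX P x) \<le> (\<Sum>x\<in>UNIV. (snd h $ x)\<^sup>2 / PX P x)"
    using PX_pos sum_PX[of P] by (intro center) (auto simp: less_imp_neq[symmetric])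
  show ?thesis
    unfolding chi_square_def using r_nonneg 1 2 by (intro add_mono mult_left_mono) auto
qed

end

section \<open>The quadratic form of the loss and its largest eigenvalue\<close>

locale estimation = positive_marginals P r
  for P :: "('x::finite \<times> 'y::finite) pmf" and r :: real +
  fixes \<sigma> :: "nat \<Rightarrow> real" and \<phi> :: "nat \<Rightarrow> real^'x" and k :: nat
  assumes svd: "right_singular_system (Bt P) \<sigma> \<phi>"
    and k_pos: "1 \<le> k" and k_less: "k < CARD('x)" and gap: "\<sigma> (k + 1) < \<sigma> k"
begin

abbreviation shift :: "nat \<Rightarrow> nat \<Rightarrow> ('x, 'y) xy_pair \<Rightarrow> real" where
  "shift i j h \<equiv> bilin (\<phi> i) (\<phi> j) (mix_dXY r P h)"

abbreviation Gbar :: "real^(('x \<times> 'y) + 'x)^(('x \<times> 'y) + 'x)" where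
  "Gbar \<equiv> bar_G P \<sigma> \<phi> k r"

abbreviation \<gamma> :: "nat \<Rightarrow> nat \<Rightarrow> real" where
  "\<gamma> i j \<equiv> (\<sigma> i)\<^sup>2 - (\<sigma> j)\<^sup>2"

definition loss_form :: "('x, 'y) xy_pair \<Rightarrow> real" where
  "loss_form h = (\<Sum>i=1..k. \<Sum>j=k+1..CARD('x). (shift i j h)\<^sup>2 / \<gamma> i j)"

abbreviation \<alpha> :: real where
  "\<alpha> \<equiv> bar_alpha P \<sigma> \<phi> k r"

lemma sigma_nonneg: "i \<in> {1..CARD('x)} \<Longrightarrow> 0 \<le> \<sigma> i"
  using svd by (simp add: right_singular_system_def)

lemma sigma_gap:
  assumes "i \<in> {1..k}" "j \<in> {k+1..CARD('x)}"
  shows "\<sigma> j < \<sigma> i" "(\<sigma> j)\<^sup>2 < (\<sigma> i)\<^sup>2"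
proof -
  have mono: "\<sigma> j \<le> \<sigma> i" if "i \<in> {1..CARD('x)}" "j \<in> {1..CARD('x)}" "i \<le> j" for i j
    using svd that by (simp add: right_singular_system_def)
  have "\<sigma> j \<le> \<sigma> (k + 1)" "\<sigma> k \<le> \<sigma> i" using assms k_less k_pos by (auto intro!: mono)
  then show "\<sigma> j < \<sigma> i" using gap by simp
  then show "(\<sigma> j)\<^sup>2 < (\<sigma> i)\<^sup>2" using sigma_nonneg[of j] assms k_pos by (intro power_strict_mono) auto
qed

lemma phi_orthonormal: "i \<in> {1..CARD('x)} \<Longrightarrow> j \<in> {1..CARD('x)} \<Longrightarrow> \<phi> i \<bullet> \<phi> j = of_bool (i = j)"
  using svd by (simp add: right_singular_system_def)

text \<open>A sum of rank-one forms with weights that are positive by the gap; semidefiniteness and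
  Cauchy-Schwarz are read off from it.\<close>

lemma inner_bar_G:
  "u \<bullet> (Gbar *v v) = (\<Sum>i=1..k. \<Sum>j=k+1..CARD('x). (1 / \<gamma> i j) *
     (shift i j (denormalise u) * shift i j (denormalise v)))"
proof -
  have "u \<bullet> (Gbar *v v) = (L_mat P *v (bar_L P r *v u)) \<bullet>
    ((\<Sum>i=1..k. \<Sum>j=k+1..CARD('x). (1 / \<gamma> i j) *\<^sub>R outer (theta P \<phi> i j) (theta P \<phi> i j)) *v (L_mat P *v (bar_L P r *v v)))"
    unfolding bar_G_def inner_transpose_sandwich G_mat_def ..
  also have "\<dots> = (\<Sum>i=1..k. \<Sum>j=k+1..CARD('x). (1 / \<gamma> i j) *
      ((theta P \<phi> i j \<bullet> (L_mat P *v (bar_L P r *v u))) * (theta P \<phi> i j \<bullet> (L_mat P *v (bar_L P r *v v)))))"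
    unfolding sum_matrix_vector_mult inner_sum_right scaleR_matrix_vector_assoc[symmetric] outer_mult
    by (intro sum.cong refl) (simp add: inner_commute)
  finally show ?thesis unfolding inner_theta_L scale_bar_L .
qed

lemma loss_form_denormalise: "loss_form (denormalise u) = u \<bullet> (Gbar *v u)"
  unfolding inner_bar_G loss_form_def by (simp add: power2_eq_square)

lemma bar_G_psd: "0 \<le> u \<bullet> (Gbar *v u)"
  unfolding loss_form_denormalise[symmetric] loss_form_def
  by (intro sum_nonneg divide_nonneg_nonneg) (auto simp: less_imp_le sigma_gap(2))

lemma bar_G_Cauchy_Schwarz:
  "(u \<bullet> (Gbar *v v))\<^sup>2 \<le> (u \<bullet> (Gbar *v u)) * (v \<bullet> (Gbar *v v))"
proof -
  define J where "J = {1..k} \<times> {k+1..CARD('x)}"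
  define f where "f u = (\<lambda>(i, j). sqrt (1 / \<gamma> i j) * shift i j (denormalise u))" for u
  have "u \<bullet> (Gbar *v v) = (\<Sum>p\<in>J. f u p * f v p)" for u v
    unfolding inner_bar_G J_def f_def sum.cartesian_product
  proof (intro sum.cong refl, clarify)
    fix i j assume "i \<in> {1..k}" "j \<in> {k+1..CARD('x)}"
    then have "0 \<le> 1 / \<gamma> i j" using sigma_gap(2) by (simp add: less_imp_le)
    moreover have "c * (a * b) = (sqrt c * a) * (sqrt c * b)" if "0 \<le> c" for a b c :: real
    proof -
      have "(sqrt c * a) * (sqrt c * b) = (sqrt c * sqrt c) * (a * b)" by (simp only: mult_ac)
      then show ?thesis using that by simp
    qed
    ultimately show "1 / \<gamma> i j * (shift i j (denormalise u) * shift i j (denormalise v)) =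
       (sqrt (1 / \<gamma> i j) * shift i j (denormalise u)) *
       (sqrt (1 / \<gamma> i j) * shift i j (denormalise v))"
      by blast
  qed
  then show ?thesis
    using Cauchy_Schwarz_ineq_sum[of "f u" "f v" J] by (simp add: power2_eq_square)
qed

text \<open>In normalised coordinates this is the bound of a form by its operator norm;
  admissibility makes \<open>h\<close> recoverable from \<open>normalise h\<close>.\<close>

lemma loss_form_le:
  assumes "admissible_dir h"
  shows "loss_form h \<le> \<alpha> * chi2 h"
proof -
  define u where "u = normalise h"
  have "loss_form h = u \<bullet> (Gbar *v u)"
    unfolding loss_form_denormalise[symmetric] u_def denormalise_normalise[OF assms] ..
  also have "\<dots> \<le> norm u * norm (Gbar *v u)" by (rule norm_cauchy_schwarz)
  also have "\<dots> \<le> norm u * (\<alpha> * norm u)"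
    unfolding bar_alpha_def spectral_norm_def by (intro mult_left_mono onorm matrix_vector_mul_bounded_linear) auto
  also have "\<dots> = \<alpha> * (norm u)\<^sup>2" by (simp add: power2_eq_square)
  finally show ?thesis unfolding u_def norm_normalise .
qed

text \<open>The top \<open>k\<close> right singular vectors of the perturbed matrix are orthogonal to the square
  root of its \<open>X\<close>-marginal, so moving the latter in the direction of \<open>\<phi> 1\<close> has to rotate them to
  first order.\<close>

lemma alpha_pos: "0 < \<alpha>"
proof -
  \<comment> \<open>This direction keeps the conditional distribution of the second letter and moves
    the \<open>X\<close>-marginal, rooted by \<open>sqrt\<close>, along
    \<open>\<phi> 1\<close>.\<close>
  define v where "v = (\<chi> z. PYX P (snd z) (fst z) * (sqrt (PX P (fst z)) * \<phi> 1 $ fst z))"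
  define h :: "('x, 'y) xy_pair" where "h = (v, 0)"
  have adm: "admissible_dir h" by (auto simp: admissible_dir_def h_def v_def PYX_def)
  have i1: "1 \<in> {1..k}" "1 \<in> {1..CARD('x)}" using k_pos k_less by auto
  have s1: "0 < \<sigma> i" if "i \<in> {1..k}" for i
    using sigma_gap(1)[OF that, of "k + 1"] sigma_nonneg[of "k + 1"] k_less k_pos by simp
  \<comment> \<open>Right singular vectors with positive singular value are orthogonal to the kernel
    of \<open>Bt P\<close>, which contains \<open>root_X\<close>.\<close>
  have orth: "\<phi> i \<bullet> root_X = 0" if "i \<in> {1..k}" for i
    using svd_inner[OF svd, of i root_X] s1[OF that] that k_less by (simp add: Bt_root_X)
  have PYX_sum: "(\<Sum>y\<in>UNIV. PYX P y x) = 1" for x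
    using PX_pos[of x] by (simp add: PYX_def sum_divide_distrib[symmetric] PX_eq[symmetric])
  have row: "(\<Sum>y\<in>UNIV. v $ (x, y)) = sqrt (PX P x) * \<phi> 1 $ x" for x
    by (simp add: v_def sum_distrib_right[symmetric] PYX_sum)
  have mixh: "mix_dXY r P h = (1 / (1 + r)) *\<^sub>R v"
  proof -
    have "a - r / (1 + r) * a = 1 / (1 + r) * a" for a :: real using r_nonneg by (simp add: field_simps)
    then show ?thesis by (simp add: vec_eq_iff mix_dXY_def h_def typ_X_def row) (simp add: v_def mult.assoc)
  qed
  define gY where "gY y = (\<Sum>x\<in>UNIV. v $ (x, y))" for y
  have Bphi: "(Bt P *v \<phi> 1) $ y = gY y / sqrt (PY P y)" for y
  proof -
    have "(Bt P *v \<phi> 1) $ y = (\<Sum>x\<in>UNIV. v $ (x, y) / sqrt (PY P y) - sqrt (PY P y) * (\<phi> 1 $ x * sqrt (PX P x)))"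
      unfolding matrix_vector_mult_def Bt_def vec_lambda_beta
    proof (intro sum.cong refl)
      fix x
      define p where "p = sqrt (PX P x)" define q where "q = sqrt (PY P y)"
      have pq: "0 < p" "0 < q" "PX P x = p * p" "PY P y = q * q"
        using PX_pos[of x] PY_pos[of y] by (auto simp: p_def q_def)
      show "(pmf P (x, y) - PX P x * PY P y) / sqrt (PX P x * PY P y) * \<phi> 1 $ x = v $ (x, y) / sqrt (PY P y) - sqrt (PY P y) * (\<phi> 1 $ x * sqrt (PX P x))"
        unfolding v_def PYX_def using pq by (simp add: real_sqrt_mult field_simps)
    qed
    also have "\<dots> = gY y / sqrt (PY P y) - sqrt (PY P y) * (\<phi> 1 \<bullet> root_X)"
      by (simp add: sum_subtractf sum_divide_distrib[symmetric] gY_def sum_distrib_left[symmetric] inner_vec_def root_X_def)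
    finally show ?thesis using orth[OF i1(1)] by simp
  qed
  \<comment> \<open>Verified by computation, but it is the derivative of a known identity: a
    dependence matrix annihilates the root of its own marginal, and that root moves by half of
    \<open>\<phi> 1\<close>.\<close>
  have dBroot: "dB P v *v root_X = (- 1/2) *\<^sub>R (Bt P *v \<phi> 1)"
  proof -
    have "(dB P v *v root_X) $ y = - 1/2 * (gY y / sqrt (PY P y))" for y
    proof -
      define q where "q = sqrt (PY P y)"
      have q: "0 < q" "PY P y = q * q" using PY_pos[of y] by (auto simp: q_def)
      have "(dB P v *v root_X) $ y = (\<Sum>x\<in>UNIV. (v $ (x, y) - 1/2 * gY y / PY P y * pmf P (x, y) - 1/2 * gY y * PX P x
          - 1/2 * PY P y * (\<phi> 1 $ x * sqrt (PX P x)) - 1/2 * v $ (x, y)) / q)"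
        unfolding matrix_vector_mult_def dB_def vec_lambda_beta row
      proof (intro sum.cong refl)
        fix x
        define p where "p = sqrt (PX P x)"
        have p: "0 < p" "PX P x = p * p" using PX_pos[of x] by (auto simp: p_def)
        have v: "v $ (x, y) = pmf P (x, y) / p * \<phi> 1 $ x"
          using p by (simp add: v_def PYX_def p_def[symmetric])
        show "(v $ (x, y) - 1/2 * (sqrt (PX P x) * \<phi> 1 $ x / PX P x + (\<Sum>x'\<in>UNIV. v $ (x', y)) / PY P y) * (pmf P (x, y) + PX P x * PY P y)) /
           sqrt (PX P x * PY P y) * root_X $ x
          = (v $ (x, y) - 1/2 * gY y / PY P y * pmf P (x, y) - 1/2 * gY y * PX P x
          - 1/2 * PY P y * (\<phi> 1 $ x * sqrt (PX P x)) - 1/2 * v $ (x, y)) / q"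
          unfolding gY_def[symmetric] v root_X_def vec_lambda_beta real_sqrt_mult p_def[symmetric] q_def[symmetric] p(2) q(2)
          using p(1) q(1) by (simp add: field_simps)
      qed
      also have "\<dots> = (gY y - 1/2 * gY y / PY P y * PY P y - 1/2 * gY y * 1 - 1/2 * PY P y * (\<phi> 1 \<bullet> root_X) - 1/2 * gY y) / q"
        by (simp only: sum_divide_distrib[symmetric] sum_subtractf sum_distrib_left[symmetric] gY_def[symmetric] PY_eq[symmetric]
            sum_PX inner_vec_def root_X_def vec_lambda_beta inner_real_def)
      also have "\<dots> = - 1/2 * (gY y / q)"
        using orth[OF i1(1)] q by (simp add: field_simps)
      finally show ?thesis by (simp add: q_def)
    qed
    then show ?thesis by (simp add: vec_eq_iff Bphi)
  qed
  have lin: "bilin (\<phi> 1) b (mix_dXY r P h) = 1 / (1 + r) * ((Bt P *v \<phi> 1) \<bullet> (dB P v *v b) + (Bt P *v b) \<bullet> (dB P v *v \<phi> 1))" for b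
  proof -
    have "dB P (c *\<^sub>R v) = c *\<^sub>R dB P v" for c
      by (simp add: vec_eq_iff dB_def sum_distrib_left[symmetric] algebra_simps add_divide_distrib diff_divide_distrib)
    then show ?thesis unfolding bilin_def mixh by (simp add: scaleR_matrix_vector_assoc[symmetric] distrib_left)
  qed
  \<comment> \<open>By \<open>orth\<close>, \<open>root_X\<close> is a combination of the
    \<open>\<phi> j\<close> with \<open>j > k\<close>. Were all these shifts zero,
    \<open>T root_X\<close> would vanish, whereas it is minus half the square of
    \<open>\<sigma> 1\<close>.\<close>
  have "\<exists>j\<in>{k+1..CARD('x)}. shift 1 j h \<noteq> 0"
  proof (rule ccontr)
    assume "\<not> ?thesis"
    then have zero: "(Bt P *v \<phi> 1) \<bullet> (dB P v *v \<phi> j) + (Bt P *v \<phi> j) \<bullet> (dB P v *v \<phi> 1) = 0" if "j \<in> {k+1..CARD('x)}" for j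
      using that r_nonneg by (simp add: lin)
    define T where "T b = (Bt P *v \<phi> 1) \<bullet> (dB P v *v b) + (Bt P *v b) \<bullet> (dB P v *v \<phi> 1)" for b
    have "linear T"
      unfolding T_def by (rule linearI) (simp_all add: matrix_vector_right_distrib matrix_vector_mult_scaleR inner_add_left inner_add_right algebra_simps)
    have "T root_X = T (\<Sum>j=1..CARD('x). (\<phi> j \<bullet> root_X) *\<^sub>R \<phi> j)"
      by (simp only: orthonormal_frame_expand[OF svd_frame[OF svd]])
    also have "\<dots> = (\<Sum>j=1..CARD('x). (\<phi> j \<bullet> root_X) * T (\<phi> j))"
      by (simp add: linear_sum[OF \<open>linear T\<close>] linear_cmul[OF \<open>linear T\<close>])
    also have "\<dots> = 0"
    proof (intro sum.neutral ballI)
      fix j assume "j \<in> {1..CARD('x)}"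
      then consider "j \<in> {1..k}" | "j \<in> {k+1..CARD('x)}" by fastforce
      then show "(\<phi> j \<bullet> root_X) * T (\<phi> j) = 0"
        by cases (auto simp: orth zero T_def)
    qed
    finally have "T root_X = 0" .
    moreover have "T root_X = - 1/2 * ((Bt P *v \<phi> 1) \<bullet> (Bt P *v \<phi> 1))"
      by (simp add: T_def dBroot Bt_root_X)
    moreover have "(Bt P *v \<phi> 1) \<bullet> (Bt P *v \<phi> 1) = (\<sigma> 1)\<^sup>2"
      using svd_inner[OF svd i1(2)] phi_orthonormal[OF i1(2) i1(2)] by simp
    ultimately show False using s1[OF i1(1)] by simp
  qed
  then obtain j where j: "j \<in> {k+1..CARD('x)}" "shift 1 j h \<noteq> 0" by blast
  have nn: "0 \<le> (shift i j h)\<^sup>2 / \<gamma> i j" if "i \<in> {1..k}" "j \<in> {k+1..CARD('x)}" for i j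
    using sigma_gap(2)[OF that] by simp
  have "0 < (shift 1 j h)\<^sup>2 / \<gamma> 1 j"
    using j sigma_gap(2)[OF i1(1) j(1)] by simp
  also have "\<dots> \<le> (\<Sum>j=k+1..CARD('x). (shift 1 j h)\<^sup>2 / \<gamma> 1 j)"
    using j nn[OF i1(1)] by (intro member_le_sum[of j _ "\<lambda>j. (shift 1 j h)\<^sup>2 / \<gamma> 1 j"]) auto
  also have "\<dots> \<le> loss_form h"
    unfolding loss_form_def using i1 nn
    by (intro member_le_sum[of 1 _ "\<lambda>i. \<Sum>j=k+1..CARD('x). (shift i j h)\<^sup>2 / \<gamma> i j"])
       (auto intro!: sum_nonneg)
  also have "\<dots> \<le> \<alpha> * chi2 h" by (rule loss_form_le[OF adm])
  finally have "0 < \<alpha> * chi2 h" .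
  moreover have "0 \<le> chi2 h" by (simp add: norm_normalise[symmetric])
  ultimately show ?thesis by (simp add: zero_less_mult_iff)
qed

text \<open>A unit maximiser of the form is denormalised and centred. This keeps the value
  \<open>\<alpha>\<close> and can only lower \<open>chi2\<close>, while \<open>loss_form_le\<close>
  with \<open>\<alpha> > 0\<close> forbids \<open>chi2\<close> below 1.\<close>

lemma optimal_direction:
  "\<exists>h. admissible_dir h \<and> (\<Sum>z\<in>UNIV. fst h $ z) = 0 \<and> (\<Sum>x\<in>UNIV. snd h $ x) = 0 \<and>
     loss_form h = \<alpha> \<and> chi2 h = 1"
proof -
  obtain u where u: "norm u = 1" "u \<bullet> (Gbar *v u) = \<alpha>"
    using psd_onorm_attained[OF bar_G_Cauchy_Schwarz bar_G_psd] by (auto simp: bar_alpha_def spectral_norm_def)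
  define g where "g = denormalise u"
  define h where "h = g - ((\<Sum>z\<in>UNIV. fst g $ z) *\<^sub>R vec_lambda (pmf P), (\<Sum>x\<in>UNIV. snd g $ x) *\<^sub>R vec_lambda (PX P))"
  have g: "admissible_dir g" unfolding g_def by (rule denormalise_admissible)
  then have adm: "admissible_dir h" by (auto simp: admissible_dir_def h_def zero_prod_def)
  have lf: "loss_form h = \<alpha>"
    using u(2) by (simp add: loss_form_def h_def bilin_mix_shift) (simp add: loss_form_def[symmetric] g_def loss_form_denormalise)
  have "chi2 h \<le> 1"
    using chi_square_center[OF g] chi_square_denormalise[of u] u(1) by (simp add: h_def g_def)
  moreover have "1 \<le> chi2 h"
    using loss_form_le[OF adm] lf alpha_pos by simp
  moreover have "(\<Sum>z\<in>UNIV. fst h $ z) = 0"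
    by (simp add: h_def sum_subtractf sum_distrib_left[symmetric] sum_pmf_eq_1)
  moreover have "(\<Sum>x\<in>UNIV. snd h $ x) = 0"
    by (simp add: h_def sum_subtractf sum_distrib_left[symmetric] sum_PX)
  ultimately show ?thesis using adm lf by (intro exI[of _ h]) auto
qed

lemma gram_at_true:
  assumes "i \<in> {1..CARD('x)}" "j \<in> {1..CARD('x)}"
  shows "(Bt P *v \<phi> i) \<bullet> (Bt P *v \<phi> j) = of_bool (i = j) * (\<sigma> i)\<^sup>2"
  using svd_inner[OF svd assms(2)] phi_orthonormal[OF assms] phi_orthonormal[OF assms(2,1)] by auto

text \<open>The Gram entries between the two blocks vanish at \<open>w0\<close>, so their squares
  agree with the squares of their derivatives up to a negligible error.\<close>

lemma loss_quad_expansion: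
  "negligible2 (\<lambda>w. loss_quad \<sigma> \<phi> k (mix_B r w) - loss_form (w - w0)) w0"
proof -
  have "negligible2 (\<lambda>w. \<Sum>i=1..k. \<Sum>j=k+1..CARD('x). 1 / \<gamma> i j *
     (((mix_B r w *v \<phi> i) \<bullet> (mix_B r w *v \<phi> j))\<^sup>2 - (shift i j (w - w0))\<^sup>2)) w0"
  proof (intro negligible2_sum negligible2_cmult has_derivative_square gram_has_derivative)
    fix i j assume "i \<in> {1..k}" "j \<in> {k+1..CARD('x)}"
    then show "(mix_B r w0 *v \<phi> i) \<bullet> (mix_B r w0 *v \<phi> j) = 0"
      using k_less by (simp add: mix_B_true gram_at_true)
  qed
  then show ?thesis
    by (simp add: loss_quad_def loss_form_def sum_subtractf[symmetric] diff_divide_distrib)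
qed

lemma gram_err_linear:
  "\<exists>K>0. eventually (\<lambda>w. gram_err \<sigma> \<phi> (mix_B r w) \<le> K * dist w w0) (nhds w0)"
proof -
  let ?I = "{1..CARD('x)} \<times> {1..CARD('x)}"
  define f where "f p w = (mix_B r w *v \<phi> (fst p)) \<bullet> (mix_B r w *v \<phi> (snd p)) - of_bool (fst p = snd p) * (\<sigma> (fst p))\<^sup>2" for p and w :: "('x, 'y) xy_pair"
  have "\<exists>K>0. eventually (\<lambda>w. \<bar>f p w\<bar> \<le> K * dist w w0) (nhds w0)" if "p \<in> ?I" for p
  proof (rule has_derivative_linear_bound)
    show "(f p has_derivative (\<lambda>h. bilin (\<phi> (fst p)) (\<phi> (snd p)) (mix_dXY r P h) - 0)) (at w0)"
      unfolding f_def by (intro has_derivative_diff gram_has_derivative has_derivative_const)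
    show "f p w0 = 0" using that by (auto simp: f_def mix_B_true gram_at_true)
  qed
  then have "\<forall>p\<in>?I. \<exists>K. 0 < K \<and> eventually (\<lambda>w. \<bar>f p w\<bar> \<le> K * dist w w0) (nhds w0)" by blast
  from bchoice[OF this] obtain K where K: "\<forall>p\<in>?I. 0 < K p \<and> eventually (\<lambda>w. \<bar>f p w\<bar> \<le> K p * dist w w0) (nhds w0)"
    by blast
  have ev: "eventually (\<lambda>w. \<forall>p\<in>?I. \<bar>f p w\<bar> \<le> K p * dist w w0) (nhds w0)"
    using K by (intro eventually_ball_finite) auto
  have "gram_err \<sigma> \<phi> (mix_B r w) \<le> (\<Sum>p\<in>?I. \<bar>f p w\<bar>)" for w
    using L2_set_le_sum_abs[of "\<lambda>p. f p w" ?I]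
    by (simp add: gram_err_def L2_set_def f_def sum.cartesian_product case_prod_beta)
  moreover have "(\<Sum>p\<in>?I. \<bar>f p w\<bar>) \<le> (\<Sum>p\<in>?I. K p) * dist w w0" if "\<forall>p\<in>?I. \<bar>f p w\<bar> \<le> K p * dist w w0" for w
    unfolding sum_distrib_right using that by (intro sum_mono) blast
  ultimately have "eventually (\<lambda>w. gram_err \<sigma> \<phi> (mix_B r w) \<le> (\<Sum>p\<in>?I. K p) * dist w w0) (nhds w0)"
    using ev by (elim eventually_mono) (blast intro: order_trans)
  moreover have "0 < (\<Sum>p\<in>?I. K p)" using K k_less by (intro sum_pos) auto
  ultimately show ?thesis by blast
qed

lemma gram_err_negligible:
  "negligible2 (\<lambda>w. gram_err \<sigma> \<phi> (mix_B r w) ^ 3 + gram_err \<sigma> \<phi> (mix_B r w) ^ 4) w0"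
proof -
  obtain K where "0 < K" "eventually (\<lambda>w. gram_err \<sigma> \<phi> (mix_B r w) \<le> K * dist w w0) (nhds w0)"
    using gram_err_linear by blast
  then show ?thesis by (rule negligible2_cubic) (simp add: gram_err_def sum_nonneg)
qed

end

section \<open>The smallest rate at a given loss\<close>

context estimation
begin

abbreviation R :: "('x, 'y) xy_pair \<Rightarrow> real" where
  "R \<equiv> rate r (pmf P) (PX P)"

abbreviation \<Delta> :: "('x, 'y) xy_pair set" where
  "\<Delta> \<equiv> rate_domain r (pmf P) (PX P)"

definition remainder :: "('x, 'y) xy_pair \<Rightarrow> real" where
  "remainder w = gram_err \<sigma> \<phi> (mix_B r w) ^ 3 + gram_err \<sigma> \<phi> (mix_B r w) ^ 4"

text \<open>The two envelopes bound the loss by functions of \<open>w\<close> alone with one and the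
  same second-order expansion; the loss itself lives on samples and involves a choice of singular
  vectors.\<close>

definition lower_env :: "real \<Rightarrow> ('x, 'y) xy_pair \<Rightarrow> real" where
  "lower_env C w = loss_quad \<sigma> \<phi> k (mix_B r w) - C * remainder w"

definition upper_env :: "real \<Rightarrow> ('x, 'y) xy_pair \<Rightarrow> real" where
  "upper_env C w = loss_quad \<sigma> \<phi> k (mix_B r w) + C * remainder w"

lemma remainder_nonneg: "0 \<le> remainder w"
  by (simp add: remainder_def gram_err_def sum_nonneg)

lemma env_negligible:
  "negligible2 (\<lambda>w. lower_env C w - loss_form (w - w0)) w0"
  "negligible2 (\<lambda>w. upper_env C w - loss_form (w - w0)) w0"
proof -
  have "negligible2 (\<lambda>w. (loss_quad \<sigma> \<phi> k (mix_B r w) - loss_form (w - w0)) + c * remainder w) w0" for c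
    unfolding remainder_def by (intro negligible2_add negligible2_cmult loss_quad_expansion gram_err_negligible)
  from this[of C] this[of "- C"]
  show "negligible2 (\<lambda>w. upper_env C w - loss_form (w - w0)) w0" "negligible2 (\<lambda>w. lower_env C w - loss_form (w - w0)) w0"
    by (simp_all add: upper_env_def lower_env_def algebra_simps)
qed

lemma continuous_on_loss_quad: "continuous_on UNIV (loss_quad \<sigma> \<phi> k :: real^'x^'y \<Rightarrow> real)"
  unfolding loss_quad_def divide_inverse
  by (intro continuous_intros continuous_on_matrix_vector_mult)

lemma isCont_lower_env:
  assumes "positive_pair r w"
  shows "isCont (lower_env C) w"
proof -
  have 1: "isCont (\<lambda>w. loss_quad \<sigma> \<phi> k (mix_B r w)) w"
    by (rule isCont_o2[OF isCont_mix_B[OF assms]])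
       (use continuous_on_loss_quad in \<open>simp add: continuous_on_eq_continuous_at\<close>)
  have c: "continuous_on UNIV (gram_err \<sigma> \<phi> :: real^'x^'y \<Rightarrow> real)" by (rule continuous_on_gram_err)
  have 2: "isCont (\<lambda>w. gram_err \<sigma> \<phi> (mix_B r w)) w"
    by (rule isCont_o2[OF isCont_mix_B[OF assms]])
       (use c in \<open>simp add: continuous_on_eq_continuous_at\<close>)
  show ?thesis
    unfolding lower_env_def remainder_def by (intro continuous_intros 1 2)
qed

lemma prob_vec_true: "prob_vec (pmf P)" "prob_vec (PX P)"
  using PX_pos by (auto simp: prob_vec_def sum_pmf_eq_1 sum_PX less_imp_le)

definition rate_const :: real where
  "rate_const = (if r = 0 then 1/4 else min 1 r / 4)"

lemma rate_const_pos: "0 < rate_const"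
  using r_nonneg by (auto simp: rate_const_def)

lemma rate_ge: "w \<in> \<Delta> \<Longrightarrow> rate_const * (dist w w0)\<^sup>2 \<le> R w"
  using rate_ge_square[OF prob_vec_true r_nonneg, of w] by (simp add: rate_const_def true_pair_def)

lemma rate_nonneg: "w \<in> \<Delta> \<Longrightarrow> 0 \<le> R w"
  using rate_ge[of w] rate_const_pos by (smt (verit) mult_nonneg_nonneg zero_le_power2)

lemma rate_near:
  assumes "0 < \<eta>"
  shows "eventually (\<lambda>w. w \<in> \<Delta> \<longrightarrow> \<bar>R w - chi2 (w - w0) / 2\<bar> \<le> \<eta> * (dist w w0)\<^sup>2) (nhds w0)"
  using rate_quadratic[OF r_nonneg prob_vec_true assms]
  unfolding true_pair_def eventually_nhds_metric by blast

lemma rate_domain_admissible: "w \<in> \<Delta> \<Longrightarrow> admissible_dir (w - w0)"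
  by (auto simp: admissible_dir_def rate_domain_def true_pair_def vec_eq_iff)

text \<open>Near \<open>w0\<close> the loss is at most about \<open>\<alpha> * chi2\<close>, and
  \<open>chi2\<close> is about twice the rate. Away from \<open>w0\<close> the rate is at least
  \<open>rate_const * \<delta>^2\<close>, and the bound on \<open>\<epsilon>\<close> is set so that
  this suffices.\<close>

lemma rate_lower_bound:
  assumes \<eta>: "0 < \<eta>"
  shows "\<exists>\<epsilon>0>0. \<forall>\<epsilon> w. 0 < \<epsilon> \<longrightarrow> \<epsilon> < \<epsilon>0 \<longrightarrow> w \<in> \<Delta> \<longrightarrow> \<epsilon> < upper_env C w \<longrightarrow> \<epsilon> \<le> R w * (2 * \<alpha> + \<eta>)"
proof -
  \<comment> \<open>The errors add up to \<open>\<eta>' * (2 * \<alpha> + 1)\<close> times the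
    squared distance: once from the envelope and \<open>2 * \<alpha>\<close> times from the rate.
    This choice makes the total at most \<open>\<eta>\<close> times the rate, by
    \<open>rate_ge\<close>.\<close>
  define \<eta>' where "\<eta>' = \<eta> * rate_const / (2 * \<alpha> + 1)"
  have a: "0 < \<alpha>" by (rule alpha_pos)
  have \<eta>': "0 < \<eta>'" using \<eta> a rate_const_pos by (simp add: \<eta>'_def)
  have "eventually (\<lambda>w. \<bar>upper_env C w - loss_form (w - w0)\<bar> \<le> \<eta>' * (dist w w0)\<^sup>2) (nhds w0)"
    using env_negligible(2) \<eta>' by (simp add: negligible2_def)
  from eventually_conj[OF this rate_near[OF \<eta>']]
  obtain \<delta> where \<delta>: "0 < \<delta>" and near: "\<And>w. dist w w0 < \<delta> \<Longrightarrow> \<bar>upper_env C w - loss_form (w - w0)\<bar> \<le> \<eta>' * (dist w w0)\<^sup>2"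
      "\<And>w. dist w w0 < \<delta> \<Longrightarrow> w \<in> \<Delta> \<Longrightarrow> \<bar>R w - chi2 (w - w0) / 2\<bar> \<le> \<eta>' * (dist w w0)\<^sup>2"
    unfolding eventually_nhds_metric by blast
  show ?thesis
  proof (intro exI conjI allI impI)
    show "0 < rate_const * \<delta>\<^sup>2 * (2 * \<alpha>)" using \<delta> a rate_const_pos by simp
    fix \<epsilon> w assume \<epsilon>: "0 < \<epsilon>" "\<epsilon> < rate_const * \<delta>\<^sup>2 * (2 * \<alpha>)" and w: "w \<in> \<Delta>" and up: "\<epsilon> < upper_env C w"
    show "\<epsilon> \<le> R w * (2 * \<alpha> + \<eta>)"
    proof (cases "dist w w0 < \<delta>")
      case True
      define D where "D = (dist w w0)\<^sup>2"
      define X where "X = chi2 (w - w0)"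
      have "X \<le> 2 * R w + 2 * \<eta>' * D" using near(2)[OF True w] by (simp add: X_def D_def abs_le_iff)
      then have "\<alpha> * X \<le> \<alpha> * (2 * R w + 2 * \<eta>' * D)" using a by (intro mult_left_mono) auto
      moreover have "loss_form (w - w0) \<le> \<alpha> * X"
        unfolding X_def by (intro loss_form_le rate_domain_admissible w)
      moreover have "upper_env C w \<le> loss_form (w - w0) + \<eta>' * D" using near(1)[OF True] by (simp add: D_def abs_le_iff)
      ultimately have "\<epsilon> \<le> 2 * \<alpha> * R w + \<eta>' * (2 * \<alpha> + 1) * D" using up by (simp add: algebra_simps)
      also have "\<eta>' * (2 * \<alpha> + 1) * D = \<eta> * (rate_const * D)" using a by (simp add: \<eta>'_def)
      also have "\<dots> \<le> \<eta> * R w" using \<eta> rate_ge[OF w] by (intro mult_left_mono) (auto simp: D_def)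
      finally show ?thesis by (simp add: algebra_simps)
    next
      case False
      have "\<epsilon> \<le> rate_const * \<delta>\<^sup>2 * (2 * \<alpha>)" using \<epsilon> by simp
      also have "\<dots> \<le> rate_const * (dist w w0)\<^sup>2 * (2 * \<alpha>)"
        using False \<delta> a rate_const_pos by (intro mult_right_mono mult_left_mono power_mono) auto
      also have "\<dots> \<le> R w * (2 * \<alpha> + \<eta>)"
        using rate_ge[OF w] rate_nonneg[OF w] a \<eta> by (intro mult_mono) auto
      finally show ?thesis .
    qed
  qed
qed

lemma loss_form_scale: "loss_form (t *\<^sub>R h) = t\<^sup>2 * loss_form h"
  by (simp add: loss_form_def linear_cmul[OF linear_bilin_mix] power_mult_distrib sum_distrib_left)

lemma chi_square_scale: "chi_square s p q (t *\<^sub>R h) = t\<^sup>2 * chi_square s p q h"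
  by (simp add: chi_square_def power_mult_distrib sum_distrib_left distrib_left mult_ac)

lemma eventually_interior:
  "eventually (\<lambda>w. (\<forall>z. 0 < pmf P z \<longrightarrow> 0 < fst w $ z) \<and> (\<forall>x. 0 < snd w $ x)) (nhds w0)"
proof -
  have pos: "eventually (\<lambda>w. 0 < f w) (nhds w0)" if "isCont f w0" "0 < f w0" for f :: "('x, 'y) xy_pair \<Rightarrow> real"
    using that unfolding isCont_def by (intro order_tendstoD(1)[of f "f w0"]) (auto simp: tendsto_at_iff_tendsto_nhds)
  have "eventually (\<lambda>w. 0 < pmf P z \<longrightarrow> 0 < fst w $ z) (nhds w0)" for z
  proof (cases "0 < pmf P z")
    case True
    have "eventually (\<lambda>w. 0 < fst w $ z) (nhds w0)"
      by (rule pos) (use True in \<open>auto intro!: continuous_intros simp: true_pair_def\<close>)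
    then show ?thesis by (rule eventually_mono) simp
  qed simp
  moreover have "eventually (\<lambda>w. 0 < snd w $ x) (nhds w0)" for x
    by (rule pos) (auto intro!: continuous_intros simp: true_pair_def PX_pos)
  ultimately show ?thesis by (intro eventually_conj eventually_all_finite) auto
qed

text \<open>The witness lies on the ray from \<open>w0\<close> in the optimal direction, just far
  enough for the lower envelope to exceed \<open>\<epsilon>\<close>.\<close>

lemma rate_upper_bound:
  assumes \<eta>: "0 < \<eta>" and \<rho>: "0 < \<rho>"
  shows "\<exists>\<epsilon>0>0. \<forall>\<epsilon>. 0 < \<epsilon> \<longrightarrow> \<epsilon> < \<epsilon>0 \<longrightarrow>
    (\<exists>w\<in>\<Delta>. dist w w0 < \<rho> \<and> \<epsilon> < lower_env C w \<and> R w \<le> \<epsilon> * (1 / (2 * \<alpha>) + \<eta>))"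
proof -
  have a: "0 < \<alpha>" by (rule alpha_pos)
  obtain h where h: "admissible_dir h" "(\<Sum>z\<in>UNIV. fst h $ z) = 0" "(\<Sum>x\<in>UNIV. snd h $ x) = 0"
    and hl: "loss_form h = \<alpha>" and hc: "chi2 h = 1"
    using optimal_direction by blast
  have "((\<lambda>x. (1 / 2 + x) / (\<alpha> - 2 * x)) \<longlongrightarrow> (1 / 2 + 0) / (\<alpha> - 2 * 0)) (at_right 0)"
    using a by (intro tendsto_intros) auto
  moreover have "(1 / 2 + 0) / (\<alpha> - 2 * 0) < 1 / (2 * \<alpha>) + \<eta>" using \<eta> by simp
  ultimately have "eventually (\<lambda>x. (1 / 2 + x) / (\<alpha> - 2 * x) < 1 / (2 * \<alpha>) + \<eta>) (at_right 0)"
    by (rule order_tendstoD(2))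
  moreover have "eventually (\<lambda>x. x < \<alpha> / 2) (at_right 0)" using eventually_at_right_real[of 0 "\<alpha> / 2"] a by (auto elim: eventually_mono)
  moreover have "eventually (\<lambda>x :: real. 0 < x) (at_right 0)" by (rule eventually_at_right_less)
  ultimately have "eventually (\<lambda>x. (1 / 2 + x) / (\<alpha> - 2 * x) < 1 / (2 * \<alpha>) + \<eta> \<and> x < \<alpha> / 2 \<and> 0 < x) (at_right 0)"
    by eventually_elim auto
  \<comment> \<open>A margin for the errors of the envelope and of the rate, small enough that the
    resulting ratio of rate to loss stays below the target.\<close>
  then obtain x where x: "(1 / 2 + x) / (\<alpha> - 2 * x) < 1 / (2 * \<alpha>) + \<eta>" "x < \<alpha> / 2" "0 < x"
    using eventually_happens'[OF trivial_limit_at_right_real] by blast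
  define K where "K = (norm h)\<^sup>2"
  have K: "0 \<le> K" by (simp add: K_def)
  define \<eta>' where "\<eta>' = x / (K + 1)"
  have \<eta>': "0 < \<eta>'" "\<eta>' * K < x" using x K by (auto simp: \<eta>'_def field_simps)
  have "eventually (\<lambda>w. \<bar>lower_env C w - loss_form (w - w0)\<bar> \<le> \<eta>' * (dist w w0)\<^sup>2) (nhds w0)"
    using env_negligible(1) \<eta>' by (simp add: negligible2_def)
  from eventually_conj[OF eventually_conj[OF this rate_near[OF \<eta>'(1)]] eventually_interior]
  obtain \<delta> where \<delta>: "0 < \<delta>" and near: "\<And>w. dist w w0 < \<delta> \<Longrightarrow> \<bar>lower_env C w - loss_form (w - w0)\<bar> \<le> \<eta>' * (dist w w0)\<^sup>2"
      "\<And>w. dist w w0 < \<delta> \<Longrightarrow> w \<in> \<Delta> \<Longrightarrow> \<bar>R w - chi2 (w - w0) / 2\<bar> \<le> \<eta>' * (dist w w0)\<^sup>2"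
      "\<And>w. dist w w0 < \<delta> \<Longrightarrow> (\<forall>z. 0 < pmf P z \<longrightarrow> 0 < fst w $ z) \<and> (\<forall>x. 0 < snd w $ x)"
    unfolding eventually_nhds_metric by blast
  define t0 where "t0 = min \<delta> \<rho> / (norm h + 1)"
  have t0: "0 < t0" using \<delta> \<rho> by (simp add: t0_def add_nonneg_pos)
  show ?thesis
  proof (intro exI conjI allI impI)
    show "0 < t0\<^sup>2 * (\<alpha> - 2 * x)" using t0 x by simp
    fix \<epsilon> assume \<epsilon>: "0 < \<epsilon>" "\<epsilon> < t0\<^sup>2 * (\<alpha> - 2 * x)"
    have ax: "0 < \<alpha> - 2 * x" using x by simp
    \<comment> \<open>The solution of \<open>t^2 * (\<alpha> - 2 * x) = \<epsilon>\<close>; the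
      bound on \<open>\<epsilon>\<close> keeps \<open>t\<close> below \<open>t0\<close> and thus
      \<open>w\<close> inside both neighbourhoods.\<close>
    define t where "t = sqrt (\<epsilon> / (\<alpha> - 2 * x))"
    have t: "0 < t" "t\<^sup>2 = \<epsilon> / (\<alpha> - 2 * x)" using \<epsilon> ax by (auto simp: t_def)
    have "t\<^sup>2 < t0\<^sup>2" unfolding t(2) using \<epsilon> ax by (simp add: field_simps)
    from power2_less_imp_less[OF this] have tt0: "t < t0" using t0 by simp
    define w where "w = w0 + t *\<^sub>R h"
    have wh: "w - w0 = t *\<^sub>R h" by (simp add: w_def)
    have dw: "dist w w0 = t * norm h" using t by (simp add: dist_norm wh)
    have "t * norm h \<le> t * (norm h + 1)" using t by (intro mult_left_mono) auto
    also have "\<dots> < t0 * (norm h + 1)" using tt0 by (intro mult_strict_right_mono) (auto intro: add_nonneg_pos)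
    also have "\<dots> = min \<delta> \<rho>" by (simp add: t0_def add_nonneg_pos less_imp_neq[symmetric] add_nonneg_eq_0_iff)
    finally have dmin: "dist w w0 < \<delta>" "dist w w0 < \<rho>" by (auto simp: dw)
    have "prob_vec (($) (fst w))"
      unfolding prob_vec_def
    proof (intro conjI allI)
      fix z
      show "0 \<le> fst w $ z"
      proof (cases "pmf P z = 0")
        case True
        then have "fst h $ z = 0" using h(1) unfolding admissible_dir_def by blast
        then show ?thesis by (simp add: w_def true_pair_def)
      next
        case False
        then have "0 < pmf P z" by (simp add: order_le_less)
        then show ?thesis using near(3)[OF dmin(1)] by (blast intro: less_imp_le)
      qed
    next
      show "(\<Sum>z\<in>UNIV. fst w $ z) = 1"
        using h(2) by (simp add: w_def true_pair_def sum.distrib sum_distrib_left[symmetric] sum_pmf_eq_1)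
    qed
    moreover have "prob_vec (($) (snd w))"
      using near(3)[OF dmin(1)] h(3)
      by (auto simp: prob_vec_def w_def true_pair_def sum.distrib sum_distrib_left[symmetric] sum_PX less_imp_le)
    ultimately have wD: "w \<in> \<Delta>"
      using h(1) PX_pos
      by (auto simp: rate_domain_def w_def true_pair_def admissible_dir_def less_imp_neq[symmetric])
    have dw2: "(dist w w0)\<^sup>2 = t\<^sup>2 * K" by (simp add: dw K_def power_mult_distrib)
    have "\<epsilon> = t\<^sup>2 * (\<alpha> - 2 * x)" using t ax by simp
    also have "\<dots> < t\<^sup>2 * (\<alpha> - \<eta>' * K)" using t(1) \<eta>'(2) x(3) by (intro mult_strict_left_mono) auto
    also have "\<dots> = loss_form (w - w0) - \<eta>' * (dist w w0)\<^sup>2"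
      unfolding wh loss_form_scale hl dw2 by (simp add: algebra_simps)
    also have "\<dots> \<le> lower_env C w" using near(1)[OF dmin(1)] by (simp add: abs_le_iff)
    finally have lo: "\<epsilon> < lower_env C w" .
    have "R w \<le> chi2 (w - w0) / 2 + \<eta>' * (dist w w0)\<^sup>2"
      using near(2)[OF dmin(1) wD] by (simp add: abs_le_iff)
    also have "\<dots> = t\<^sup>2 * (1 / 2 + \<eta>' * K)"
      unfolding wh chi_square_scale hc dw2 by (simp add: algebra_simps)
    also have "\<dots> \<le> t\<^sup>2 * (1 / 2 + x)" using \<eta>' by (intro mult_left_mono) auto
    also have "\<dots> = \<epsilon> * ((1 / 2 + x) / (\<alpha> - 2 * x))" unfolding t(2) by simp
    also have "\<dots> \<le> \<epsilon> * (1 / (2 * \<alpha>) + \<eta>)" using x \<epsilon> by (intro mult_left_mono) auto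
    finally have "R w \<le> \<epsilon> * (1 / (2 * \<alpha>) + \<eta>)" .
    with wD dmin lo show "\<exists>w\<in>\<Delta>. dist w w0 < \<rho> \<and> \<epsilon> < lower_env C w \<and> R w \<le> \<epsilon> * (1 / (2 * \<alpha>) + \<eta>)"
      by blast
  qed
qed

end

section \<open>From the types of the samples to the error exponent\<close>

context estimation
begin

abbreviation smp :: "('x \<times> 'y) list \<Rightarrow> 'x list \<Rightarrow> ('x, 'y) xy_pair" where
  "smp \<equiv> types (PX P)"

text \<open>Everything that is used of the estimator. Near \<open>w0\<close> its matrix is
  \<open>mix_B\<close>, which still has a gap, so the loss is squeezed by the envelopes and varies
  continuously with the types whatever singular vectors were chosen.\<close>

lemma types_envelope_near:
  assumes est: "\<And>zs us. top_right_singular_vectors k (bar_B r (c zs us) (b zs us) zs us) (\<Phi>bar zs us)"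
  shows "\<exists>C \<rho>. 0 \<le> C \<and> 0 < \<rho> \<and> (\<forall>w. dist w w0 < \<rho> \<longrightarrow> positive_pair r w) \<and>
    (\<forall>zs us. sample_pair r zs us \<longrightarrow> dist (smp zs us) w0 < \<rho> \<longrightarrow>
       lower_env C (smp zs us) \<le> gain k (Bt P) \<phi> - gain k (Bt P) (\<Phi>bar zs us) \<and>
       gain k (Bt P) \<phi> - gain k (Bt P) (\<Phi>bar zs us) \<le> upper_env C (smp zs us) \<and>
       (\<forall>e>0. \<exists>\<delta>>0. \<forall>zs' us'. sample_pair r zs' us' \<longrightarrow> dist (smp zs' us') (smp zs us) < \<delta> \<longrightarrow>
          \<bar>gain k (Bt P) (\<Phi>bar zs' us') - gain k (Bt P) (\<Phi>bar zs us)\<bar> < e))"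
proof -
  obtain C where C: "0 \<le> C" "\<And>(N :: real^'x^'y) \<tau> \<psi>. right_singular_system N \<tau> \<psi> \<Longrightarrow>
     \<bar>gain k (Bt P) \<phi> - gain k (Bt P) \<psi> - loss_quad \<sigma> \<phi> k N\<bar>
      \<le> C * (gram_err \<sigma> \<phi> N ^ 3 + gram_err \<sigma> \<phi> N ^ 4)"
    using loss_quad_bound[OF svd k_pos k_less gap] by blast
  obtain \<delta>g where \<delta>g: "0 < \<delta>g" "\<And>N \<tau> \<psi>. dist N (Bt P) < \<delta>g \<Longrightarrow> right_singular_system N \<tau> \<psi> \<Longrightarrow> \<tau> (k + 1) < \<tau> k"
    using svd_gap_near[OF svd k_pos k_less gap] by blast
  have "positive_pair r w0"
    using PX_pos PY_pos by (simp add: positive_pair_def typ_X_true mix_X_true mix_Y_true)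
  then have "isCont (mix_B r) w0" by (rule isCont_mix_B)
  then have "eventually (\<lambda>w. dist (mix_B r w) (mix_B r w0) < \<delta>g) (nhds w0)"
    using \<delta>g(1) unfolding continuous_at_eps_delta eventually_nhds_metric by blast
  from eventually_conj[OF this eventually_positive_pair]
  obtain \<rho> where \<rho>: "0 < \<rho>" "\<And>w. dist w w0 < \<rho> \<Longrightarrow> dist (mix_B r w) (Bt P) < \<delta>g \<and> positive_pair r w"
    unfolding eventually_nhds_metric mix_B_true by blast
  have sys: "\<exists>\<tau> \<psi>. right_singular_system (mix_B r (smp zs us)) \<tau> \<psi> \<and>
      frob_norm k (mat_cols (Bt P) (\<Phi>bar zs us)) = frob_norm k (mat_cols (Bt P) \<psi>)"
    if "sample_pair r zs us" "dist (smp zs us) w0 < \<rho>" for zs us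
  proof -
    have "top_right_singular_vectors k (mix_B r (smp zs us)) (\<Phi>bar zs us)"
      using est[of zs us] bar_B_types[OF that(1), of "PX P" "c zs us" "b zs us"] \<rho>(2)[OF that(2)] by simp
    then obtain \<tau> \<psi> where "right_singular_system (mix_B r (smp zs us)) \<tau> \<psi>" "\<forall>i\<in>{1..k}. \<Phi>bar zs us i = \<psi> i"
      unfolding top_right_singular_vectors_def by blast
    moreover from this(2) have "frob_norm k (mat_cols (Bt P) (\<Phi>bar zs us)) = frob_norm k (mat_cols (Bt P) \<psi>)"
      by (simp add: frob_norm_def mat_cols_def)
    ultimately show ?thesis by blast
  qed
  show ?thesis
  proof (rule exI[of _ C], rule exI[of _ \<rho>], intro conjI allI impI)
    fix zs :: "('x \<times> 'y) list" and us :: "'x list"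
    assume s: "sample_pair r zs us" "dist (smp zs us) w0 < \<rho>"
    let ?w = "smp zs us"
    obtain \<tau> \<psi> where \<psi>: "right_singular_system (mix_B r ?w) \<tau> \<psi>"
      "frob_norm k (mat_cols (Bt P) (\<Phi>bar zs us)) = frob_norm k (mat_cols (Bt P) \<psi>)"
      using sys[OF s] by blast
    from C(2)[OF \<psi>(1)]
    show "lower_env C ?w \<le> gain k (Bt P) \<phi> - gain k (Bt P) (\<Phi>bar zs us)"
      "gain k (Bt P) \<phi> - gain k (Bt P) (\<Phi>bar zs us) \<le> upper_env C ?w"
      by (simp_all add: \<psi>(2) lower_env_def upper_env_def remainder_def abs_le_iff)
    fix e :: real assume e: "0 < e"
    \<comment> \<open>The gap at the estimated matrix makes it a legitimate base point for
      \<open>frob_near\<close>.\<close>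
    have "\<tau> (k + 1) < \<tau> k" using \<delta>g(2) \<psi>(1) \<rho>(2)[OF s(2)] by blast
    from frob_near[OF \<psi>(1) k_pos k_less this e, of "Bt P"]
    obtain \<delta>1 where \<delta>1: "0 < \<delta>1" "\<And>N' \<tau>' \<psi>'. dist N' (mix_B r ?w) < \<delta>1 \<Longrightarrow> right_singular_system N' \<tau>' \<psi>' \<Longrightarrow>
       \<bar>gain k (Bt P) \<psi>' - gain k (Bt P) \<psi>\<bar> < e"
      by blast
    have "isCont (mix_B r) ?w" using \<rho>(2)[OF s(2)] by (intro isCont_mix_B) simp
    then obtain \<delta>2 where \<delta>2: "0 < \<delta>2" "\<And>w'. dist w' ?w < \<delta>2 \<Longrightarrow> dist (mix_B r w') (mix_B r ?w) < \<delta>1"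
      using \<delta>1(1) unfolding continuous_at_eps_delta by blast
    show "\<exists>\<delta>>0. \<forall>zs' us'. sample_pair r zs' us' \<longrightarrow> dist (smp zs' us') ?w < \<delta> \<longrightarrow>
          \<bar>gain k (Bt P) (\<Phi>bar zs' us') - gain k (Bt P) (\<Phi>bar zs us)\<bar> < e"
    proof (intro exI[of _ "min \<delta>2 (\<rho> - dist ?w w0)"] conjI allI impI)
      show "0 < min \<delta>2 (\<rho> - dist ?w w0)" using \<delta>2 s by simp
      fix zs' :: "('x \<times> 'y) list" and us' :: "'x list"
      assume s': "sample_pair r zs' us'" "dist (smp zs' us') ?w < min \<delta>2 (\<rho> - dist ?w w0)"
      then have "dist (smp zs' us') w0 < \<rho>"
        using dist_triangle[of "smp zs' us'" w0 ?w] by simp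
      from sys[OF s'(1) this] obtain \<tau>' \<psi>' where \<psi>': "right_singular_system (mix_B r (smp zs' us')) \<tau>' \<psi>'"
        "frob_norm k (mat_cols (Bt P) (\<Phi>bar zs' us')) = frob_norm k (mat_cols (Bt P) \<psi>')"
        by blast
      show "\<bar>gain k (Bt P) (\<Phi>bar zs' us') - gain k (Bt P) (\<Phi>bar zs us)\<bar> < e"
        unfolding \<psi>(2) \<psi>'(2) using s'(2) by (intro \<delta>1(2)[OF \<delta>2(2) \<psi>'(1)]) simp
    qed
  qed (use \<rho> C in auto)
qed

lemma error_exponent:
  assumes est: "\<And>zs us. top_right_singular_vectors k (bar_B r (c zs us) (b zs us) zs us) (\<Phi>bar zs us)"
  shows "\<exists>E :: real \<Rightarrow> ereal.
      (\<forall>\<^sub>F \<epsilon> in at_right 0.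
         ((\<lambda>n. log_prob (measure_pmf.prob (samples P n (nat \<lfloor>real n * r\<rfloor>))
                 {(zs, us). gain k (Bt P) \<phi>
                            - gain k (Bt P) (\<Phi>bar zs us) > \<epsilon>}) / ereal (real n))
          \<longlongrightarrow> E \<epsilon>) (admissible_at_top r)) \<and>
      ((\<lambda>\<epsilon>. - (E \<epsilon> / ereal \<epsilon>)) \<longlongrightarrow> 1 / (2 * ereal \<alpha>)) (at_right 0)"
proof -
  define F where "F zs us = gain k (Bt P) \<phi> - gain k (Bt P) (\<Phi>bar zs us)" for zs us
  obtain C \<rho> where C: "0 \<le> C" and \<rho>: "0 < \<rho>" and pos: "\<And>w. dist w w0 < \<rho> \<Longrightarrow> positive_pair r w"
    and lo: "\<And>zs us. sample_pair r zs us \<Longrightarrow> dist (smp zs us) w0 < \<rho> \<Longrightarrow> lower_env C (smp zs us) \<le> F zs us"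
    and up: "\<And>zs us. sample_pair r zs us \<Longrightarrow> dist (smp zs us) w0 < \<rho> \<Longrightarrow> F zs us \<le> upper_env C (smp zs us)"
    and cont: "\<And>zs us e. sample_pair r zs us \<Longrightarrow> dist (smp zs us) w0 < \<rho> \<Longrightarrow> 0 < e \<Longrightarrow>
       \<exists>\<delta>>0. \<forall>zs' us'. sample_pair r zs' us' \<longrightarrow> dist (smp zs' us') (smp zs us) < \<delta> \<longrightarrow> \<bar>F zs' us' - F zs us\<bar> < e"
    using types_envelope_near[OF est] unfolding F_def by (force simp: abs_minus_commute)
  txt \<open>Requiring the event for all samples with types near \<open>w\<close> avoids choosing singular vectors at
    points that are not pairs of types; the condition on the envelope keeps \<open>G \<epsilon>\<close> meaningful when
    there are no such samples, i.e. for irrational \<open>r\<close>.\<close>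
  define G where "G \<epsilon> = {w \<in> \<Delta>. dist w w0 < \<rho> \<and> \<epsilon> < upper_env C w \<and>
     (\<exists>\<delta>>0. \<forall>zs us. sample_pair r zs us \<longrightarrow> dist (smp zs us) w < \<delta> \<longrightarrow> \<epsilon> < F zs us)}" for \<epsilon>
  define I where "I \<epsilon> = Inf (R ` G \<epsilon>)" for \<epsilon>
  have a: "0 < \<alpha>" by (rule alpha_pos)
  have bdd: "bdd_below (R ` G \<epsilon>)" for \<epsilon>
    using rate_nonneg by (intro bdd_belowI[of _ 0]) (auto simp: G_def)
  \<comment> \<open>The point from \<open>rate_upper_bound\<close> belongs to
    \<open>G \<epsilon>\<close>: the lower envelope exceeds \<open>\<epsilon>\<close> on a whole
    neighbourhood, hence so does the loss of every sample with types there.\<close>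
  have upper: "eventually (\<lambda>\<epsilon>. \<exists>w\<in>G \<epsilon>. R w \<le> \<epsilon> * (1 / (2 * \<alpha>) + \<eta>)) (at_right 0)" if \<eta>: "0 < \<eta>" for \<eta>
  proof -
    obtain \<epsilon>0 where \<epsilon>0: "0 < \<epsilon>0" "\<And>\<epsilon>. 0 < \<epsilon> \<Longrightarrow> \<epsilon> < \<epsilon>0 \<Longrightarrow>
      \<exists>w\<in>\<Delta>. dist w w0 < \<rho> \<and> \<epsilon> < lower_env C w \<and> R w \<le> \<epsilon> * (1 / (2 * \<alpha>) + \<eta>)"
      using rate_upper_bound[OF \<eta> \<rho>, of C] by blast
    have "\<exists>w\<in>G \<epsilon>. R w \<le> \<epsilon> * (1 / (2 * \<alpha>) + \<eta>)" if \<epsilon>: "0 < \<epsilon>" "\<epsilon> < \<epsilon>0" for \<epsilon>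
    proof -
      obtain w where w: "w \<in> \<Delta>" "dist w w0 < \<rho>" "\<epsilon> < lower_env C w" "R w \<le> \<epsilon> * (1 / (2 * \<alpha>) + \<eta>)"
        using \<epsilon>0(2)[OF \<epsilon>] by blast
      have "isCont (lower_env C) w" using pos[OF w(2)] by (rule isCont_lower_env)
      moreover have "0 < lower_env C w - \<epsilon>" using w(3) by simp
      ultimately obtain \<delta> where \<delta>: "0 < \<delta>" "\<And>w'. dist w' w < \<delta> \<Longrightarrow> dist (lower_env C w') (lower_env C w) < lower_env C w - \<epsilon>"
        unfolding continuous_at_eps_delta by blast
      have "\<epsilon> < F zs us" if s: "sample_pair r zs us" "dist (smp zs us) w < min \<delta> (\<rho> - dist w w0)" for zs us
      proof -
        have "dist (smp zs us) w0 < \<rho>"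
          using s(2) dist_triangle[of "smp zs us" w0 w] by simp
        from lo[OF s(1) this] \<delta>(2)[of "smp zs us"] s(2) show ?thesis
          by (auto simp: dist_real_def abs_less_iff)
      qed
      moreover have "0 < min \<delta> (\<rho> - dist w w0)" using \<delta> w by simp
      ultimately have "\<exists>\<delta>>0. \<forall>zs us. sample_pair r zs us \<longrightarrow> dist (smp zs us) w < \<delta> \<longrightarrow> \<epsilon> < F zs us"
        by blast
      moreover have "lower_env C w \<le> upper_env C w"
        using C remainder_nonneg[of w] by (simp add: lower_env_def upper_env_def)
      ultimately have "w \<in> G \<epsilon>" using w unfolding G_def by auto
      with w(4) show ?thesis by blast
    qed
    then show ?thesis using \<epsilon>0(1) by (auto simp: eventually_at_right_field)
  qed
  have lower: "eventually (\<lambda>\<epsilon>. \<forall>w\<in>G \<epsilon>. \<epsilon> \<le> R w * (2 * \<alpha> + \<eta>)) (at_right 0)" if \<eta>: "0 < \<eta>" for \<eta>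
    using rate_lower_bound[OF \<eta>, of C] by (force simp: eventually_at_right_field G_def)
  have limit: "((\<lambda>n. log_prob (measure_pmf.prob (samples P n (nat \<lfloor>real n * r\<rfloor>)) {(zs, us). F zs us > \<epsilon>}) / ereal (real n))
      \<longlongrightarrow> ereal (- I \<epsilon>)) (admissible_at_top r)"
    if ne: "G \<epsilon> \<noteq> {}" and Ile: "I \<epsilon> \<le> rate_const * \<rho>\<^sup>2" for \<epsilon>
  proof -
    have pmfX: "pmf (map_pmf fst P) = PX P" by (simp add: fun_eq_iff PX_def)
    show ?thesis
      unfolding samples_def
    proof (rule pair_Sanov[where Q = "map_pmf fst P", unfolded pmfX, OF r_nonneg])
      fix zs :: "('x \<times> 'y) list" and us :: "'x list"
      assume s: "(zs, us) \<in> {(zs, us). F zs us > \<epsilon>}" "sample_pair r zs us" "smp zs us \<in> \<Delta>"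
      let ?w = "smp zs us"
      show "I \<epsilon> \<le> R ?w"
      proof (cases "dist ?w w0 < \<rho>")
        case True
        have "0 < F zs us - \<epsilon>" using s(1) by simp
        from cont[OF s(2) True this] have "\<exists>\<delta>>0. \<forall>zs' us'. sample_pair r zs' us' \<longrightarrow> dist (smp zs' us') ?w < \<delta> \<longrightarrow> \<epsilon> < F zs' us'"
          by (force simp: abs_less_iff)
        then have "?w \<in> G \<epsilon>" using s True up[OF s(2) True] by (auto simp: G_def)
        then show ?thesis unfolding I_def by (intro cInf_lower bdd) auto
      next
        \<comment> \<open>Types outside the ball cost at least as much as the infimum, whatever the
          estimator does there.\<close>
        case False
        have "I \<epsilon> \<le> rate_const * (dist ?w w0)\<^sup>2"
          using False \<rho> rate_const_pos by (intro order_trans[OF Ile] mult_left_mono power_mono) auto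
        then show ?thesis using rate_ge[OF s(3)] by simp
      qed
    next
      fix \<eta> :: real assume "0 < \<eta>"
      then have lt: "Inf (R ` G \<epsilon>) < I \<epsilon> + \<eta>" by (simp add: I_def)
      have "R ` G \<epsilon> \<noteq> {}" using ne by blast
      from cInf_lessD[OF this lt] obtain w where "w \<in> G \<epsilon>" "R w < I \<epsilon> + \<eta>"
        by (elim bexE imageE) simp
      then show "\<exists>w\<in>\<Delta>. R w < I \<epsilon> + \<eta> \<and> (\<exists>\<delta>>0. \<forall>zs us. sample_pair r zs us \<longrightarrow>
          dist (smp zs us) w < \<delta> \<longrightarrow> (zs, us) \<in> {(zs, us). F zs us > \<epsilon>})"
        by (auto simp: G_def)
    qed
  qed
  have I_le: "I \<epsilon> \<le> R w" if "w \<in> G \<epsilon>" for \<epsilon> w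
    unfolding I_def using that by (intro cInf_lower bdd) auto
  show ?thesis
  proof (intro exI[of _ "\<lambda>\<epsilon>. ereal (- I \<epsilon>)"] conjI)
    \<comment> \<open>The infimum is at most of order \<open>\<epsilon>\<close>, so for small
      \<open>\<epsilon>\<close> it falls below the fixed rate outside the ball, as
      \<open>limit\<close> requires.\<close>
    have "((\<lambda>\<epsilon>. \<epsilon> * (1 / (2 * \<alpha>) + 1)) \<longlongrightarrow> 0 * (1 / (2 * \<alpha>) + 1)) (at_right 0)"
      by (intro tendsto_intros)
    then have "eventually (\<lambda>\<epsilon>. \<epsilon> * (1 / (2 * \<alpha>) + 1) < rate_const * \<rho>\<^sup>2) (at_right 0)"
      using \<rho> rate_const_pos by (intro order_tendstoD(2)) auto
    with upper[OF zero_less_one]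
    have "eventually (\<lambda>\<epsilon>. ((\<lambda>n. log_prob (measure_pmf.prob (samples P n (nat \<lfloor>real n * r\<rfloor>)) {(zs, us). F zs us > \<epsilon>}) / ereal (real n))
        \<longlongrightarrow> ereal (- I \<epsilon>)) (admissible_at_top r)) (at_right 0)"
    proof eventually_elim
      case (elim \<epsilon>)
      then obtain w where w: "w \<in> G \<epsilon>" "R w \<le> \<epsilon> * (1 / (2 * \<alpha>) + 1)" by blast
      have "I \<epsilon> \<le> rate_const * \<rho>\<^sup>2" using I_le[OF w(1)] w(2) elim(2) by linarith
      then show ?case using w(1) by (intro limit) auto
    qed
    then show "\<forall>\<^sub>F \<epsilon> in at_right 0.
         ((\<lambda>n. log_prob (measure_pmf.prob (samples P n (nat \<lfloor>real n * r\<rfloor>))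
                 {(zs, us). gain k (Bt P) \<phi>
                            - gain k (Bt P) (\<Phi>bar zs us) > \<epsilon>}) / ereal (real n))
          \<longlongrightarrow> ereal (- I \<epsilon>)) (admissible_at_top r)"
      unfolding F_def .
    have "((\<lambda>\<epsilon>. I \<epsilon> / \<epsilon>) \<longlongrightarrow> 1 / (2 * \<alpha>)) (at_right 0)"
    proof (rule tendstoI)
      fix e :: real assume e: "0 < e"
      \<comment> \<open>The lower bound on the rate has its error in the denominator;
        \<open>\<eta>\<close> is chosen to turn this into the additive error
        \<open>e\<close>.\<close>
      have "((\<lambda>\<eta>. 1 / (2 * \<alpha> + \<eta>)) \<longlongrightarrow> 1 / (2 * \<alpha> + 0)) (at_right 0)"
        using a by (intro tendsto_intros) auto
      then have "eventually (\<lambda>\<eta>. 1 / (2 * \<alpha>) - e < 1 / (2 * \<alpha> + \<eta>)) (at_right 0)"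
        using e by (intro order_tendstoD(1)) auto
      moreover have "eventually (\<lambda>\<eta> :: real. 0 < \<eta>) (at_right 0)" by (rule eventually_at_right_less)
      ultimately have "eventually (\<lambda>\<eta>. 1 / (2 * \<alpha>) - e < 1 / (2 * \<alpha> + \<eta>) \<and> 0 < \<eta>) (at_right 0)"
        by eventually_elim auto
      then obtain \<eta> where \<eta>: "1 / (2 * \<alpha>) - e < 1 / (2 * \<alpha> + \<eta>)" "0 < \<eta>"
        using eventually_happens'[OF trivial_limit_at_right_real] by blast
      have e2: "0 < e / 2" using e by simp
      have "eventually (\<lambda>\<epsilon> :: real. 0 < \<epsilon>) (at_right 0)" by (rule eventually_at_right_less)
      with upper[OF e2] lower[OF \<eta>(2)]
      show "eventually (\<lambda>\<epsilon>. dist (I \<epsilon> / \<epsilon>) (1 / (2 * \<alpha>)) < e) (at_right 0)"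
      proof eventually_elim
        case (elim \<epsilon>)
        obtain w where w: "w \<in> G \<epsilon>" "R w \<le> \<epsilon> * (1 / (2 * \<alpha>) + e / 2)" using elim(1) by blast
        have "I \<epsilon> \<le> \<epsilon> * (1 / (2 * \<alpha>) + e / 2)" using I_le[OF w(1)] w(2) by simp
        then have 1: "I \<epsilon> / \<epsilon> \<le> 1 / (2 * \<alpha>) + e / 2" using elim(3) by (simp add: pos_divide_le_eq mult.commute)
        have "\<epsilon> / (2 * \<alpha> + \<eta>) \<le> I \<epsilon>"
          unfolding I_def
        proof (intro cInf_greatest)
          fix x assume "x \<in> R ` G \<epsilon>"
          then show "\<epsilon> / (2 * \<alpha> + \<eta>) \<le> x" using elim(2) a \<eta>(2) by (auto simp: pos_divide_le_eq)
        qed (use w in auto)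
        then have "1 / (2 * \<alpha> + \<eta>) \<le> I \<epsilon> / \<epsilon>" using elim(3) by (simp add: pos_le_divide_eq)
        with 1 \<eta>(1) e show ?case by (simp add: dist_real_def abs_less_iff)
      qed
    qed
    then have "((\<lambda>\<epsilon>. ereal (I \<epsilon> / \<epsilon>)) \<longlongrightarrow> ereal (1 / (2 * \<alpha>))) (at_right 0)" by (rule tendsto_ereal)
    moreover have "eventually (\<lambda>\<epsilon>. ereal (I \<epsilon> / \<epsilon>) = - (ereal (- I \<epsilon>) / ereal \<epsilon>)) (at_right 0)"
      using eventually_at_right_less[of "0 :: real"] by eventually_elim simp
    moreover have "ereal (1 / (2 * \<alpha>)) = 1 / (2 * ereal \<alpha>)"
      using a by (simp add: one_ereal_def numeral_eq_ereal)
    ultimately show "((\<lambda>\<epsilon>. - (ereal (- I \<epsilon>) / ereal \<epsilon>)) \<longlongrightarrow> 1 / (2 * ereal \<alpha>)) (at_right 0)"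
      using Lim_transform_eventually by fastforce
  qed
qed

end

text \<open>\<open>c\<close>, \<open>b\<close> and \<open>\<Phi>bar\<close> may depend on the
  samples in any way, even on their order, so every convention for vanishing denominators and ties
  is covered. For irrational \<open>r\<close> the filter is trivial and the inner limit is
  vacuous.\<close>

theorem theorem4:
  fixes P :: "('x::finite \<times> 'y::finite) pmf"
    and \<sigma> :: "nat \<Rightarrow> real" and \<phi> :: "nat \<Rightarrow> real^'x"
    and k :: nat and r :: real
    and c :: "('x \<times> 'y) list \<Rightarrow> 'x list \<Rightarrow> 'x \<Rightarrow> 'y \<Rightarrow> real"
    and b :: "('x \<times> 'y) list \<Rightarrow> 'x list \<Rightarrow> 'y \<Rightarrow> 'x \<Rightarrow> real"
    and \<Phi>bar :: "('x \<times> 'y) list \<Rightarrow> 'x list \<Rightarrow> nat \<Rightarrow> real^'x"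
  assumes PX_pos: "\<And>x. PX P x > 0"
    and PY_pos: "\<And>y. PY P y > 0"
    and svd: "right_singular_system (Bt P) \<sigma> \<phi>"
    and k: "1 \<le> k" "k < CARD('x)"
    and r: "0 \<le> r"
    and estimator: "\<And>zs us.
      top_right_singular_vectors k (bar_B r (c zs us) (b zs us) zs us) (\<Phi>bar zs us)"
    and gap: "\<sigma> k > \<sigma> (k + 1)"
  shows "\<exists>E :: real \<Rightarrow> ereal.
      (\<forall>\<^sub>F \<epsilon> in at_right 0.
         ((\<lambda>n. log_prob (measure_pmf.prob (samples P n (nat \<lfloor>real n * r\<rfloor>))
                 {(zs, us). (frob_norm k (mat_cols (Bt P) \<phi>))\<^sup>2
                            - (frob_norm k (mat_cols (Bt P) (\<Phi>bar zs us)))\<^sup>2 > \<epsilon>}) / ereal (real n))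
          \<longlongrightarrow> E \<epsilon>) (admissible_at_top r)) \<and>
      ((\<lambda>\<epsilon>. - (E \<epsilon> / ereal \<epsilon>)) \<longlongrightarrow> 1 / (2 * ereal (bar_alpha P \<sigma> \<phi> k r))) (at_right 0)"
proof -
  interpret estimation P r \<sigma> \<phi> k
    by unfold_locales (use assms in auto)
  show ?thesis by (rule error_exponent[OF estimator])
qed

end
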